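(* Let each edge $e$ of the complete digraph $\vec{K}_n$ on $n$ vertices be assigned a random weight $W_e$ and a random cost $C_e$, where $\{W_e,C_e\}_{e}$ is a family of i.i.d. random variables uniform on $[0,1]$. Given $c_0=c_0(n)>0$, let $W^*_{arb}$ be the optimum value of the problem: minimise $W(A)$ over spanning arborescences $A$ of $\vec{K}_n$ subject to $C(A)\le c_0$. For $\beta>0$ define $$f(\beta)=\beta^{1/2}\int_0^{\beta^{1/2}}e^{-t^2/2}\,dt+e^{-\beta/2},\qquad g(\beta)=\beta f(1/\beta)=\beta^{1/2}\int_0^{\beta^{-1/2}}e^{-t^2/2}\,dt+\beta e^{-1/(2\beta)}.$$ The following hold with high probability as $n\to\infty$. Case 1: If $c_0\in[\omega,\frac{n}{\omega}]$ where $\omega=\omega(n)\to\infty$, then $W^*_{arb}\approx\frac{\pi n}{8c_0}$. Case 2: Suppose $c_0=\alpha n$, where $\alpha>0$ is a constant. (i) If $\alpha>1/2$ then $W^*_{arb}\approx 1$. (ii) If $\alpha<1/2$ then $W^*_{arb}\approx f(\beta^* )-\alpha\beta^*$, where $\beta^*$ is the unique positive solution to $f'(\beta)=\alpha$. Case 3: Suppose $c_0=\alpha$, where $\alpha>0$ is a constant. (i) If $\alpha<1$ then the problem has no feasible solution. (ii) If $\alpha>1$ then $W^*_{arb}\approx(g(\beta^* )-\alpha\beta^* )n$, where $\beta^*$ is the unique positive solution to $g'(\beta)=\alpha$.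
   Context: $\vec{K}_n$ is the digraph on $[n]$ containing every ordered pair $(i,j)$ with $i\ne j$ as an edge. A spanning arborescence is a rooted spanning tree in which every edge is directed away from the root. For an arborescence $A$, $W(A)=\sum_{e\in A}W_e$ and $C(A)=\sum_{e\in A}C_e$. "With high probability" (w.h.p.) means with probability tending to $1$ as $n\to\infty$. For sequences, $A_n\approx B_n$ means there is $\varepsilon(n)\to0$ such that $(1-\varepsilon)A_n\le B_n\le(1+\varepsilon)A_n$ for all $n$; for random quantities, "w.h.p. $A_n\approx B_n$" means there is a deterministic $\varepsilon(n)\to 0$ such that these inequalities hold with probability tending to $1$. *)

theory Defs
  imports "HOL-Probability.Probability"
begin

section \<open>Arborescences of the complete digraph\<close>

definition complete_arcs :: "nat \<Rightarrow> (nat \<times> nat) set" where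
  "complete_arcs n = {(i, j). i \<in> {1..n} \<and> j \<in> {1..n} \<and> i \<noteq> j}"

definition adjacent :: "('v \<times> 'v) set \<Rightarrow> 'v \<Rightarrow> 'v \<Rightarrow> bool" where
  "adjacent A u v \<longleftrightarrow> (u, v) \<in> A \<or> (v, u) \<in> A"

text \<open>Paths and cycles of the underlying undirected graph, as lists of distinct vertices.\<close>

definition upath :: "('v \<times> 'v) set \<Rightarrow> 'v list \<Rightarrow> bool" where
  "upath A p \<longleftrightarrow> p \<noteq> [] \<and> distinct p \<and> successively (adjacent A) p"

definition ucycle :: "('v \<times> 'v) set \<Rightarrow> 'v list \<Rightarrow> bool" where
  "ucycle A p \<longleftrightarrow> upath A p \<and> length p \<ge> 3 \<and> adjacent A (last p) (hd p)"

text \<open>An arc set whose underlying undirected graph is a spanning tree on \<open>V\<close>.  The asymmetry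
  condition says that each tree edge occurs in one direction only (a pair of opposite arcs is
  not excluded by \<^const>\<open>ucycle\<close>, which has length at least 3).  The predicate \<open>tree\<close> of the AFP
  entry \<open>Graph_Theory\<close> is not suitable here: it only excludes directed cycles.\<close>

definition oriented_spanning_tree :: "'v set \<Rightarrow> ('v \<times> 'v) set \<Rightarrow> bool" where
  "oriented_spanning_tree V A \<longleftrightarrow>
     A \<subseteq> V \<times> V \<and> (\<forall>u v. (u, v) \<in> A \<longrightarrow> (v, u) \<notin> A) \<and>
     (\<forall>u\<in>V. \<forall>v\<in>V. \<exists>p. upath A p \<and> hd p = u \<and> last p = v) \<and>
     (\<nexists>p. ucycle A p)"

text \<open>Every arc \<open>(u, v)\<close> points away from the root \<open>r\<close>: the path in the tree from \<open>r\<close> to \<open>v\<close>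
  ends with the step from \<open>u\<close> to \<open>v\<close>.\<close>

definition directed_away :: "('v \<times> 'v) set \<Rightarrow> 'v \<Rightarrow> bool" where
  "directed_away A r \<longleftrightarrow>
     (\<forall>(u, v)\<in>A. \<exists>p. upath A (p @ [u, v]) \<and> hd (p @ [u, v]) = r)"

definition spanning_arborescence :: "nat \<Rightarrow> (nat \<times> nat) set \<Rightarrow> bool" where
  "spanning_arborescence n A \<longleftrightarrow>
     A \<subseteq> complete_arcs n \<and> oriented_spanning_tree {1..n} A \<and>
     (\<exists>r\<in>{1..n}. directed_away A r)"

section \<open>The constrained optimisation problem\<close>

definition feasible_arbs :: "nat \<Rightarrow> (nat \<times> nat \<Rightarrow> real) \<Rightarrow> real \<Rightarrow> (nat \<times> nat) set set" where
  "feasible_arbs n c c0 = {A. spanning_arborescence n A \<and> (\<Sum>e\<in>A. c e) \<le> c0}"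

text \<open>The optimum is \<open>\<infinity>\<close> exactly if there is no feasible solution; otherwise the infimum is
  a minimum, as there are only finitely many arborescences.\<close>

definition arb_opt ::
    "nat \<Rightarrow> (nat \<times> nat \<Rightarrow> real) \<Rightarrow> (nat \<times> nat \<Rightarrow> real) \<Rightarrow> real \<Rightarrow> ereal" where
  "arb_opt n w c c0 = (INF A\<in>feasible_arbs n c c0. ereal (\<Sum>e\<in>A. w e))"

section \<open>Random weights and costs; asymptotics\<close>

definition iid_uniform_weights_costs ::
    "nat \<Rightarrow> 'a measure \<Rightarrow> (nat \<times> nat \<Rightarrow> 'a \<Rightarrow> real) \<Rightarrow> (nat \<times> nat \<Rightarrow> 'a \<Rightarrow> real) \<Rightarrow> bool" where
  "iid_uniform_weights_costs n M W C \<longleftrightarrow>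
     prob_space M \<and>
     prob_space.indep_vars M (\<lambda>_. borel)
       (\<lambda>s. case s of Inl e \<Rightarrow> W e | Inr e \<Rightarrow> C e)
       (complete_arcs n <+> complete_arcs n) \<and>
     (\<forall>e\<in>complete_arcs n.
        distr M borel (W e) = uniform_measure lborel {0..1} \<and>
        distr M borel (C e) = uniform_measure lborel {0..1})"

definition whp :: "(nat \<Rightarrow> 'a measure) \<Rightarrow> (nat \<Rightarrow> 'a \<Rightarrow> bool) \<Rightarrow> bool" where
  "whp M P \<longleftrightarrow> (\<lambda>n. \<P>(x in M n. P n x)) \<longlonglongrightarrow> 1"

definition W_arb_opt ::
    "(nat \<Rightarrow> nat \<times> nat \<Rightarrow> 'a \<Rightarrow> real) \<Rightarrow> (nat \<Rightarrow> nat \<times> nat \<Rightarrow> 'a \<Rightarrow> real) \<Rightarrow>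
     (nat \<Rightarrow> real) \<Rightarrow> nat \<Rightarrow> 'a \<Rightarrow> ereal" where
  "W_arb_opt W C c0 n x = arb_opt n (\<lambda>e. W n e x) (\<lambda>e. C n e x) (c0 n)"

text \<open>If \<open>A n x = \<infinity>\<close> and \<open>\<epsilon> n < 1\<close> then the first inequality below fails, so
  for infeasible problems the approximation does not hold vacuously.\<close>

definition whp_approx ::
    "(nat \<Rightarrow> 'a measure) \<Rightarrow> (nat \<Rightarrow> 'a \<Rightarrow> ereal) \<Rightarrow> (nat \<Rightarrow> real) \<Rightarrow> bool" where
  "whp_approx M A B \<longleftrightarrow>
     (\<exists>\<epsilon>. \<epsilon> \<longlonglongrightarrow> 0 \<and>
        whp M (\<lambda>n x. ereal (1 - \<epsilon> n) * A n x \<le> ereal (B n) \<and>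
                      ereal (B n) \<le> ereal (1 + \<epsilon> n) * A n x))"

section \<open>The limit functions\<close>

definition f_lim :: "real \<Rightarrow> real" where
  "f_lim \<beta> = sqrt \<beta> * integral {0..sqrt \<beta>} (\<lambda>t. exp (- t\<^sup>2 / 2)) + exp (- \<beta> / 2)"

definition g_lim :: "real \<Rightarrow> real" where
  "g_lim \<beta> = sqrt \<beta> * integral {0..1 / sqrt \<beta>} (\<lambda>t. exp (- t\<^sup>2 / 2)) + \<beta> * exp (- 1 / (2 * \<beta>))"

lemma g_lim_eq: "\<beta> > 0 \<Longrightarrow> g_lim \<beta> = \<beta> * f_lim (1 / \<beta>)"
proof -
  assume "\<beta> > 0"
  then have "\<beta> * x / sqrt \<beta> = sqrt \<beta> * x" for x
    by (metis order_less_imp_le real_div_sqrt times_divide_eq_left)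
  then show ?thesis
    by (simp add: g_lim_def f_lim_def real_sqrt_divide distrib_left mult.commute[of \<beta> 2])
qed

end

(* Lagrangian relaxation reduces the problem to the sum over the vertices v of
   min_u (W (u, v) + l C (u, v)), a sum of n i.i.d. terms whose mean is computed by the layer cake
   formula and which concentrates by Chebyshev's inequality.  Every vertex except the root has an
   in-arc, so this sum is a lower bound.  Conversely, letting every vertex choose its best in-arc
   gives a random mapping with few cycles (the expected number of cyclic vertices on cycles of
   length k is at most n times the largest probability of a single choice).  One vertex of each
   cycle is reattached to a fixed root by a path with two cheap arcs, at negligible total cost.
   Since the relaxed optimum is a concave function of l, its difference quotients control the cost
   and the weight of the greedy mapping separately. *)

theory Submission
  imports
    Defs
    "HOL-Combinatorics.Orbits"
    "HOL-Real_Asymp.Real_Asymp"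
begin

section \<open>Paths in oriented trees; arborescences from parent functions and from
  mappings\<close>

section \<open>Arborescences\<close>

text \<open>The multiplier depends on \<open>n\<close>, and in the middle regime it may lie on
  either side of 1 as \<open>n\<close> varies, so the probabilistic estimates hold from some
  \<open>n\<close> on simultaneously for all multipliers. The law of one arc is computed only for
  \<open>l \<le> 1\<close>; exchanging weights and costs sends \<open>l\<close> to
  \<open>1 / l\<close>. The repair of the greedy mapping has to be cheap in weight and cost at once:
  for \<open>c0 = \<alpha> n\<close> the whole weight stays bounded, for
  \<open>c0 = \<alpha>\<close> the whole cost does. Its total price must tend to 0, hence the
  pairing of detour arcs below \<open>n powr (- 1 / 5)\<close> with at most
  \<open>n powr (1 / 10)\<close> cycles. The relaxed optimum is known only up to a small relative
  error at finitely many fixed multipliers, which gives no derivative at a point; difference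
  quotients between three multipliers take its place. If the budget binds, all three lie slightly
  above the critical one, where strict concavity leaves positive slack in the budget. Events that
  quantify over arborescences are handled through measurable subsets of large probability;
  measurability is shown only for the final statements.\<close>

lemma upath_of_rtrancl:
  assumes "(u, v) \<in> {(a, b). adjacent A a b \<and> a \<in> S \<and> b \<in> S}\<^sup>*" and "u \<in> S"
  shows "\<exists>p. upath A p \<and> hd p = u \<and> last p = v \<and> set p \<subseteq> S"
  using assms
proof (induction rule: rtrancl_induct)
  case base
  then show ?case by (intro exI[of _ "[u]"]) (auto simp: upath_def)
next
  case (step y z)
  then obtain p where p: "upath A p" "hd p = u" "last p = y" "set p \<subseteq> S" by auto
  from step have yz: "adjacent A y z" "z \<in> S" by auto
  show ?case
  proof (cases "z \<in> set p")
    case True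
    \<comment> \<open>A revisited vertex cuts the path back, which keeps it free of repetitions.
      With \<open>S\<close> the complement of a vertex the same lemma yields paths avoiding that
      vertex.\<close>
    then obtain xs ys where "p = xs @ z # ys" by (meson split_list)
    with p show ?thesis
      by (intro exI[of _ "xs @ [z]"])
         (auto simp: upath_def successively_append_iff hd_append split: if_splits)
  next
    case False
    with p yz show ?thesis
      by (intro exI[of _ "p @ [z]"]) (auto simp: upath_def successively_append_iff)
  qed
qed

lemma rtrancl_of_upath:
  assumes "upath A p" and "set p \<subseteq> S"
  shows "(hd p, last p) \<in> {(a, b). adjacent A a b \<and> a \<in> S \<and> b \<in> S}\<^sup>*"
  using assms
proof (induction p)
  case Nil
  then show ?case by (simp add: upath_def)
next
  case (Cons x p)
  show ?case
  proof (cases p)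
    case Nil
    then show ?thesis by simp
  next
    case (Cons y ys)
    with Cons.prems have "upath A p" "adjacent A x y" "x \<in> S" "y \<in> S"
      by (auto simp: upath_def)
    then show ?thesis
      using Cons.IH Cons.prems Cons by (auto intro: converse_rtrancl_into_rtrancl)
  qed
qed

lemma adjacent_sym: "adjacent A u v \<longleftrightarrow> adjacent A v u"
  by (auto simp: adjacent_def)

text \<open>All arcs on the tree path from \<open>r\<close> to \<open>v\<close> point forward, so
  the last one enters \<open>v\<close>. If an arc \<open>(y, u)\<close> pointed backward right after
  a forward arc \<open>(w, u)\<close>, then \<open>u\<close> would have two in-neighbours, each
  joined to \<open>r\<close> by a path avoiding \<open>u\<close>; so \<open>y\<close> and
  \<open>w\<close> are connected without \<open>u\<close>, and \<open>u\<close> closes a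
  cycle.\<close>

lemma arborescence_in_arc:
  assumes tree: "oriented_spanning_tree V A" and away: "directed_away A r"
    and r: "r \<in> V" and v: "v \<in> V" "v \<noteq> r"
  shows "\<exists>u. (u, v) \<in> A"
proof -
  obtain p where p: "upath A p" "hd p = r" "last p = v"
    using tree r v unfolding oriented_spanning_tree_def by blast
  have ne: "p \<noteq> []" and dist: "distinct p" using p by (auto simp: upath_def)
  have adj: "adjacent A (p ! k) (p ! Suc k)" if "Suc k < length p" for k
    using p that by (auto simp: upath_def successively_conv_nth)
  have to_root: "\<exists>q. upath A (q @ [a, b]) \<and> hd (q @ [a, b]) = r" if "(a, b) \<in> A" for a b
    using away that by (auto simp: directed_away_def)
  have forward: "(p ! k, p ! Suc k) \<in> A" if "Suc k < length p" for k
    using that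
  proof (induction k)
    case 0
    show ?case
    proof (rule ccontr)
      \<comment> \<open>A backward first arc would enter the root, but the path ending with this arc
        also starts at the root.\<close>
      assume "(p ! 0, p ! Suc 0) \<notin> A"
      with adj[OF 0] have "(p ! Suc 0, p ! 0) \<in> A" by (auto simp: adjacent_def)
      then obtain q where q: "upath A (q @ [p ! Suc 0, p ! 0])" "hd (q @ [p ! Suc 0, p ! 0]) = r"
        using to_root by blast
      moreover have "p ! 0 = r" using p ne by (simp add: hd_conv_nth)
      ultimately show False by (cases q) (auto simp: upath_def)
    qed
  next
    case (Suc k)
    show ?case
    proof (rule ccontr)
      define u where "u = p ! Suc k"
      define y where "y = p ! Suc (Suc k)"
      define w where "w = p ! k"
      assume "(p ! Suc k, p ! Suc (Suc k)) \<notin> A"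
      with adj[OF Suc.prems] have yu: "(y, u) \<in> A" by (auto simp: adjacent_def u_def y_def)
      have wu: "(w, u) \<in> A" using Suc by (auto simp: w_def u_def)
      have "y \<noteq> w" using dist Suc.prems by (auto simp: y_def w_def nth_eq_iff_index_eq)
      obtain q where q: "upath A (q @ [y, u])" "hd (q @ [y, u]) = r" using to_root[OF yu] by blast
      obtain q' where q': "upath A (q' @ [w, u])" "hd (q' @ [w, u]) = r" using to_root[OF wu] by blast
      \<comment> \<open>Dropping the last vertex \<open>u\<close> from a path with distinct vertices
        leaves a path in the complement of \<open>u\<close>.\<close>
      let ?R = "{(a, b). adjacent A a b \<and> a \<in> -{u} \<and> b \<in> -{u}}"
      have "sym ?R" by (auto simp: sym_def adjacent_sym)
      have "(hd (q @ [y]), last (q @ [y])) \<in> ?R\<^sup>*"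
        using q by (intro rtrancl_of_upath) (auto simp: upath_def successively_append_iff)
      moreover have "(hd (q' @ [w]), last (q' @ [w])) \<in> ?R\<^sup>*"
        using q' by (intro rtrancl_of_upath) (auto simp: upath_def successively_append_iff)
      moreover have "hd (q @ [y]) = r" "hd (q' @ [w]) = r" using q q' by (auto simp: hd_append)
      ultimately have "(y, w) \<in> ?R\<^sup>*"
        using sym_rtrancl[OF \<open>sym ?R\<close>] by (auto dest: symD intro: rtrancl_trans)
      moreover have "y \<in> -{u}" using q by (auto simp: upath_def)
      ultimately obtain c where c: "upath A c" "hd c = y" "last c = w" "set c \<subseteq> -{u}"
        using upath_of_rtrancl[of y w A "-{u}"] by blast
      \<comment> \<open>Here \<open>y \<noteq> w\<close> matters: \<open>ucycle\<close> asks for at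
        least three vertices.\<close>
      then have "length c \<ge> 2" using \<open>y \<noteq> w\<close>
        by (cases c; cases "tl c") (auto simp: upath_def)
      moreover have "adjacent A w u" "adjacent A u y" using wu yu by (auto simp: adjacent_def)
      ultimately have "ucycle A (c @ [u])"
        using c by (auto simp: ucycle_def upath_def successively_append_iff hd_append)
      with tree show False by (auto simp: oriented_spanning_tree_def)
    qed
  qed
  have "length p \<ge> 2" using p v ne by (cases p; cases "tl p") auto
  then have "(p ! (length p - 2), p ! Suc (length p - 2)) \<in> A" by (intro forward) auto
  moreover have "p ! Suc (length p - 2) = v"
    using p ne \<open>length p \<ge> 2\<close> by (auto simp: last_conv_nth Suc_diff_Suc numeral_2_eq_2)
  ultimately show ?thesis by auto
qed

lemma ucycle_rotate:
  assumes "ucycle A (xs @ ys)" shows "ucycle A (ys @ xs)"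
  using assms
  by (cases "xs = []"; cases "ys = []")
     (auto simp: ucycle_def upath_def successively_append_iff)

text \<open>Any rank \<open>d\<close> that drops from a vertex to its parent will do. It makes
  parent chains end in \<open>r\<close> and keeps their vertices distinct. A vertex of largest rank
  on a cycle would have its parent as both neighbours, which a cycle of length at least 3
  excludes.\<close>

lemma spanning_arborescence_parent:
  fixes d :: "nat \<Rightarrow> nat"
  assumes r: "r \<in> {1..n}"
    and par: "\<And>v. v \<in> {1..n} - {r} \<Longrightarrow> par v \<in> {1..n}"
    and d: "\<And>v. v \<in> {1..n} - {r} \<Longrightarrow> d (par v) < d v"
  shows "spanning_arborescence n ((\<lambda>v. (par v, v)) ` ({1..n} - {r}))" (is "spanning_arborescence n ?A")
proof -
  let ?V = "{1..n}"
  have parne: "par v \<noteq> v" if "v \<in> ?V - {r}" for v using d[OF that] by auto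
  have A1: "?A \<subseteq> complete_arcs n" using par parne by (force simp: complete_arcs_def)
  have mem: "(u, v) \<in> ?A \<longleftrightarrow> v \<in> ?V - {r} \<and> u = par v" for u v by auto
  have asym: "\<forall>u v. (u, v) \<in> ?A \<longrightarrow> (v, u) \<notin> ?A"
  proof (intro allI impI notI)
    fix u v assume "(u, v) \<in> ?A" "(v, u) \<in> ?A"
    then have "v \<in> ?V - {r}" "u = par v" "u \<in> ?V - {r}" "v = par u" unfolding mem by auto
    then have "d u < d v" "d v < d u" using d by metis+
    then show False by simp
  qed
  let ?R = "{(a, b). adjacent ?A a b \<and> a \<in> ?V \<and> b \<in> ?V}"
  have symR: "sym ?R" by (auto simp: sym_def adjacent_sym)
  have conn: "(v, r) \<in> ?R\<^sup>*" if "v \<in> ?V" for v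
    using that
  proof (induction "d v" arbitrary: v rule: less_induct)
    case less
    show ?case
    proof (cases "v = r")
      case False
      then have v: "v \<in> ?V - {r}" using less by auto
      then have "(v, par v) \<in> ?R" using par[OF v] by (auto simp: adjacent_def)
      moreover have "(par v, r) \<in> ?R\<^sup>*" using less d[OF v] par[OF v] by auto
      ultimately show ?thesis by (rule converse_rtrancl_into_rtrancl)
    qed auto
  qed
  have paths: "\<exists>p. upath ?A p \<and> hd p = u \<and> last p = v" if "u \<in> ?V" "v \<in> ?V" for u v
  proof -
    have "(r, v) \<in> ?R\<^sup>*" using conn[OF that(2)] sym_rtrancl[OF symR] by (auto dest: symD)
    then have "(u, v) \<in> ?R\<^sup>*" using conn[OF that(1)] by (rule rtrancl_trans[rotated])
    from upath_of_rtrancl[OF this that(1)] show ?thesis by blast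
  qed
  have acyc: "\<not> ucycle ?A p" for p
  proof
    assume c: "ucycle ?A p"
    then have "set p \<noteq> {}" by (auto simp: ucycle_def)
    then have "Max (d ` set p) \<in> d ` set p" by (intro Max_in) auto
    then obtain v where "v \<in> set p" "d v = Max (d ` set p)" by force
    then have v: "v \<in> set p" "\<And>u. u \<in> set p \<Longrightarrow> d u \<le> d v" by auto
    then obtain xs ys where p: "p = xs @ v # ys" by (meson split_list)
    define q where "q = ys @ xs"
    have cyc: "ucycle ?A (v # q)" using ucycle_rotate[of ?A xs "v # ys"] c p by (simp add: q_def)
    have le: "d u \<le> d v" if "u \<in> set q" for u using v that by (auto simp: p q_def)
    have q2: "length q \<ge> 2" using cyc by (auto simp: ucycle_def)
    then have qne: "q \<noteq> []" by auto
    have "adjacent ?A v (hd q)" "adjacent ?A (last q) v"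
      using cyc qne by (auto simp: ucycle_def upath_def successively_Cons)
    then have adj: "adjacent ?A (hd q) v" "adjacent ?A (last q) v"
      by (simp_all add: adjacent_sym[of _ v])
    \<comment> \<open>An arc from \<open>v\<close> to \<open>u\<close> would give \<open>u\<close> a
      larger rank than \<open>v\<close>, so the arc must enter \<open>v\<close>.\<close>
    have nbr: "u = par v" if "adjacent ?A u v" "u \<in> set q" for u
      using that(1) le[OF that(2)] d unfolding adjacent_def mem by force
    have "hd q = last q"
      using nbr[OF adj(1) hd_in_set[OF qne]] nbr[OF adj(2) last_in_set[OF qne]] by simp
    moreover have "distinct q" using cyc by (auto simp: ucycle_def upath_def)
    ultimately show False using q2 by (cases q) (auto dest: last_in_set split: if_splits)
  qed
  have up: "\<exists>p. upath ?A (p @ [v]) \<and> hd (p @ [v]) = r \<and> (\<forall>x\<in>set p. d x < d v)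
                 \<and> (v \<noteq> r \<longrightarrow> p \<noteq> [] \<and> last p = par v)"
    if "v \<in> ?V" for v
    using that
  proof (induction "d v" arbitrary: v rule: less_induct)
    case less
    show ?case
    proof (cases "v = r")
      case True
      then show ?thesis by (intro exI[of _ "[]"]) (auto simp: upath_def)
    next
      case False
      then have v: "v \<in> ?V - {r}" using less by auto
      obtain p where p: "upath ?A (p @ [par v])" "hd (p @ [par v]) = r" "\<forall>x\<in>set p. d x < d (par v)"
        using less(1)[OF d[OF v] par[OF v]] by blast
      have "adjacent ?A (par v) v" using v by (auto simp: adjacent_def)
      moreover have above: "\<forall>x\<in>set (p @ [par v]). d x < d v"
        using p(3) d[OF v] by auto
      moreover have "v \<notin> set (p @ [par v])" using above less_irrefl by blast
      ultimately have "upath ?A ((p @ [par v]) @ [v])"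
        using p(1) unfolding upath_def successively_append_iff[of _ "p @ [par v]"] by simp
      moreover have "hd ((p @ [par v]) @ [v]) = r" using p(2) by (cases p) simp_all
      ultimately show ?thesis using above by (intro exI[of _ "p @ [par v]"]) simp
    qed
  qed
  have "directed_away ?A r"
    unfolding directed_away_def
  proof (rule ballI, clarify del: imageE)
    fix u v assume "(u, v) \<in> ?A"
    then have v: "v \<in> ?V - {r}" "u = par v" by auto
    then obtain p where p: "upath ?A (p @ [v])" "hd (p @ [v]) = r" "p \<noteq> []" "last p = par v"
      using up[of v] by auto
    then obtain p' where "p = p' @ [u]" using v by (metis append_butlast_last_id)
    then show "\<exists>p. upath ?A (p @ [u, v]) \<and> hd (p @ [u, v]) = r"
      using p(1,2) by (intro exI[of _ p']) simp
  qed
  moreover have "oriented_spanning_tree ?V ?A"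
    unfolding oriented_spanning_tree_def
  proof (intro conjI ballI notI)
    show "?A \<subseteq> ?V \<times> ?V" using A1 by (auto simp: complete_arcs_def)
  qed (use asym paths acyc in blast)+
  ultimately show ?thesis using A1 r by (auto simp: spanning_arborescence_def)
qed

text \<open>\<open>orbit\<close> starts with the first image, so \<open>x \<in> orbit f x\<close>
  says that \<open>x\<close> is periodic, and the orbit is then its cycle.\<close>

lemma orbit_eq:
  assumes "x \<in> orbit f x" "y \<in> orbit f x" shows "orbit f y = orbit f x"
  using assms orbit_swap[OF assms] by (auto intro: orbit_trans)

text \<open>Each cycle of \<open>\<phi>\<close> contributes 1.\<close>

definition cycle_count :: "nat \<Rightarrow> (nat \<Rightarrow> nat) \<Rightarrow> real" where
  "cycle_count n \<phi> = (\<Sum>v\<in>{v\<in>{1..n}. v \<in> orbit \<phi> v}. 1 / card (orbit \<phi> v))"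

text \<open>The minimum of each cycle, unless it is \<open>r\<close>, becomes a child of its detour
  vertex, and every detour vertex becomes a child of \<open>r\<close>. All other vertices keep
  \<open>\<phi>\<close>, so following parents from any vertex ends in \<open>r\<close>.\<close>

lemma spanning_arborescence_of_mapping:
  fixes \<phi> u :: "nat \<Rightarrow> nat"
  assumes r: "r \<in> {1..n}" and phi: "\<And>v. v \<in> {1..n} \<Longrightarrow> \<phi> v \<in> {1..n}"
    and u: "\<And>v. v \<in> {1..n} - {r} \<Longrightarrow> u v \<in> {1..n} - {r}"
  shows "\<exists>A B. spanning_arborescence n A \<and> B \<subseteq> {1..n} - {r} \<and>
     real (card B) \<le> cycle_count n \<phi> \<and>
     A \<subseteq> (\<lambda>v. (\<phi> v, v)) ` {1..n} \<union> (\<lambda>v. (u v, v)) ` B \<union> (\<lambda>v. (r, u v)) ` B"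
proof -
  let ?V = "{1..n}"
  define Per where "Per = {v \<in> ?V. v \<in> orbit \<phi> v}"
  define B0 where "B0 = {v \<in> Per. v = Min (orbit \<phi> v)}"
  define B where "B = B0 - {r}"
  define R where "R = u ` B"
  \<comment> \<open>The image of \<open>B\<close> under \<open>u\<close> may meet \<open>B\<close>;
    then the arc from \<open>r\<close> takes precedence. The value at \<open>r\<close> is a default
    that makes \<open>r\<close> a fixed point of \<open>par\<close>.\<close>
  define par where "par v = (if v \<in> insert r R then r else if v \<in> B then u v else \<phi> v)" for v
  have funV: "(\<phi> ^^ k) v \<in> ?V" if "v \<in> ?V" for k v
    using that phi by (induction k) auto
  have orbV: "orbit \<phi> v \<subseteq> ?V" if "v \<in> ?V" for v
    using funV[OF that] by (auto simp: orbit_altdef)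
  then have finorb: "finite (orbit \<phi> v)" if "v \<in> ?V" for v
    using that finite_subset by blast
  have BV: "B \<subseteq> ?V - {r}" by (auto simp: B_def B0_def Per_def)
  have RV: "R \<subseteq> ?V - {r}" using BV u unfolding R_def by blast
  have parV: "par v \<in> ?V" if "v \<in> ?V" for v
    using that r phi[of v] BV u[of v] unfolding par_def by (auto split: if_splits)
  have base: "\<exists>j. (par ^^ j) v = r" if "v \<in> insert r R \<union> B0" for v
  proof (cases "v \<in> insert r R")
    case True
    then show ?thesis by (intro exI[of _ 1]) (auto simp: par_def)
  next
    case False
    with that have "v \<in> B" by (auto simp: B_def)
    then have "par (par v) = r" using False by (auto simp: par_def R_def)
    then show ?thesis by (intro exI[of _ 2]) (auto simp: numeral_2_eq_2)
  qed
  \<comment> \<open>Until the first visit of \<open>insert r R \<union> B0\<close> the functions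
    \<open>par\<close> and \<open>\<phi>\<close> agree, and from there at most two steps lead to
    \<open>r\<close>.\<close>
  have reach: "\<exists>j. (par ^^ j) v = r" if "(\<phi> ^^ k) v \<in> insert r R \<union> B0" for k v
    using that
  proof (induction k arbitrary: v)
    case 0
    then show ?case using base by simp
  next
    case (Suc k)
    show ?case
    proof (cases "v \<in> insert r R \<union> B0")
      case True
      then show ?thesis by (rule base)
    next
      case False
      then have "par v = \<phi> v" by (auto simp: par_def B_def)
      moreover have "(\<phi> ^^ k) (\<phi> v) \<in> insert r R \<union> B0"
        using Suc.prems by (simp add: funpow_swap1)
      ultimately obtain j where "(par ^^ j) (par v) = r" using Suc.IH by metis
      then show ?thesis by (intro exI[of _ "Suc j"]) (simp add: funpow_swap1)
    qed
  qed
  have min_in: "Min (orbit \<phi> w) \<in> B0 \<and> Min (orbit \<phi> w) \<in> orbit \<phi> w" if w: "w \<in> Per" for w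
  proof -
    have wV: "w \<in> ?V" and ww: "w \<in> orbit \<phi> w" using w by (auto simp: Per_def)
    let ?m = "Min (orbit \<phi> w)"
    have m: "?m \<in> orbit \<phi> w" using finorb[OF wV] ww by (intro Min_in) auto
    then have "orbit \<phi> ?m = orbit \<phi> w" using ww by (rule orbit_eq[rotated])
    then show ?thesis using m orbV[OF wV] by (auto simp: B0_def Per_def)
  qed
  have hits: "\<exists>k. (\<phi> ^^ k) v \<in> B0" if v: "v \<in> ?V" for v
  proof -
    have "finite (range (\<lambda>k. (\<phi> ^^ k) v))"
      by (rule finite_subset[OF image_subsetI[OF funV[OF v]]]) (rule finite_atLeastAtMost)
    then have "\<not> inj_on (\<lambda>k. (\<phi> ^^ k) v) (UNIV :: nat set)"
      by (metis finite_imageD infinite_UNIV_nat)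
    then obtain i j where ij: "i < j" "(\<phi> ^^ i) v = (\<phi> ^^ j) v"
      unfolding inj_on_def by (metis linorder_neqE_nat)
    define w where "w = (\<phi> ^^ i) v"
    have "(\<phi> ^^ (j - i)) w = w"
      using ij funpow_add[of "j - i" i \<phi>] by (simp add: w_def)
    then have "w \<in> orbit \<phi> w" using ij by (auto simp: orbit_altdef intro!: exI[of _ "j - i"])
    then have "w \<in> Per" using funV[OF v] by (auto simp: Per_def w_def)
    from min_in[OF this] obtain k where "(\<phi> ^^ k) w \<in> B0" by (auto simp: orbit_altdef)
    then show ?thesis by (intro exI[of _ "k + i"]) (simp add: w_def funpow_add)
  qed
  have reach: "\<exists>j. (par ^^ j) v = r" if "v \<in> ?V" for v
    using hits[OF that] reach by blast
  define d where "d v = (LEAST j. (par ^^ j) v = r)" for v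
  have d: "d (par v) < d v" if v: "v \<in> ?V - {r}" for v
  proof -
    have ex: "(par ^^ d v) v = r" unfolding d_def using reach[of v] v by (auto intro: LeastI_ex)
    then obtain k where k: "d v = Suc k" using v by (cases "d v") auto
    with ex have "(par ^^ k) (par v) = r" by (simp add: funpow_swap1)
    then have "d (par v) \<le> k" unfolding d_def by (rule Least_le)
    then show ?thesis using k by simp
  qed
  have "spanning_arborescence n ((\<lambda>v. (par v, v)) ` (?V - {r}))"
  proof (rule spanning_arborescence_parent[where d = d, OF r])
    show "par v \<in> ?V" if "v \<in> ?V - {r}" for v using that parV by blast
  qed (rule d)
  moreover have "(\<lambda>v. (par v, v)) ` (?V - {r}) \<subseteq>
      (\<lambda>v. (\<phi> v, v)) ` ?V \<union> (\<lambda>v. (u v, v)) ` B \<union> (\<lambda>v. (r, u v)) ` B"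
    by (auto simp: par_def R_def)
  moreover have "real (card B) \<le> cycle_count n \<phi>"
  proof -
    have fPer: "finite Per" by (auto simp: Per_def)
    then have fB0: "finite B0" by (auto simp: B0_def)
    have B0: "b \<in> ?V" "b \<in> orbit \<phi> b" "b = Min (orbit \<phi> b)" if "b \<in> B0" for b
      using that by (auto simp: B0_def Per_def)
    have "real (card B) \<le> real (card B0)" using fB0 by (auto simp: B_def intro!: card_mono)
    also have "\<dots> = (\<Sum>b\<in>B0. \<Sum>v\<in>orbit \<phi> b. 1 / card (orbit \<phi> v))"
    proof -
      have "(\<Sum>v\<in>orbit \<phi> b. 1 / card (orbit \<phi> v)) = (1::real)" if b: "b \<in> B0" for b
      proof -
        have "(\<Sum>v\<in>orbit \<phi> b. 1 / card (orbit \<phi> v)) = (\<Sum>v\<in>orbit \<phi> b. 1 / real (card (orbit \<phi> b)))"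
          using orbit_eq[OF B0(2)[OF b]] by (intro sum.cong) auto
        also have "\<dots> = 1" using finorb[OF B0(1)[OF b]] B0(2)[OF b] by (auto simp: card_gt_0_iff)
        finally show ?thesis .
      qed
      then show ?thesis by simp
    qed
    also have "\<dots> = (\<Sum>v\<in>(\<Union>b\<in>B0. orbit \<phi> b). 1 / card (orbit \<phi> v))"
    proof (rule sum.UNION_disjoint[symmetric])
      show "\<forall>i\<in>B0. \<forall>j\<in>B0. i \<noteq> j \<longrightarrow> orbit \<phi> i \<inter> orbit \<phi> j = {}"
      proof (intro ballI impI, rule ccontr)
        fix i j assume ij: "i \<in> B0" "j \<in> B0" "i \<noteq> j" "orbit \<phi> i \<inter> orbit \<phi> j \<noteq> {}"
        then obtain x where "x \<in> orbit \<phi> i" "x \<in> orbit \<phi> j" by auto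
        then have "orbit \<phi> i = orbit \<phi> j"
          using orbit_eq[OF B0(2)[OF ij(1)]] orbit_eq[OF B0(2)[OF ij(2)]] by metis
        then show False using B0(3) ij by metis
      qed
    qed (use fB0 finorb B0 in auto)
    also have "\<dots> \<le> (\<Sum>v\<in>Per. 1 / card (orbit \<phi> v))"
    proof (rule sum_mono2[OF fPer])
      show "(\<Union>b\<in>B0. orbit \<phi> b) \<subseteq> Per"
      proof (rule UN_least, rule subsetI)
        fix b x assume "b \<in> B0" "x \<in> orbit \<phi> b"
        then show "x \<in> Per"
          using B0(1,2)[of b] orbV[of b] orbit_eq[of b \<phi> x] unfolding Per_def by blast
      qed
    qed auto
    finally show ?thesis unfolding cycle_count_def Per_def .
  qed
  ultimately show ?thesis using BV by blast
qed

section \<open>The Gaussian integral; strict concavity of both limit functions\<close>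

section \<open>The limit functions\<close>

text \<open>For \<open>y \<ge> 0\<close> a rescaled error function: \<open>sqrt (pi / 2)\<close>
  times \<open>erf (y / sqrt 2)\<close>.\<close>

definition gauss :: "real \<Rightarrow> real" where
  "gauss y = integral {0..y} (\<lambda>t. exp (- t\<^sup>2 / 2))"

lemma gauss_0 [simp]: "gauss 0 = 0"
  by (simp add: gauss_def)

lemma gauss_deriv:
  assumes "0 < y" shows "(gauss has_real_derivative exp (- y\<^sup>2 / 2)) (at y)"
proof -
  have "((\<lambda>x. integral {0..x} (\<lambda>t. exp (- t\<^sup>2 / 2))) has_real_derivative exp (- y\<^sup>2 / 2))
          (at y within {0..y + 1})"
    using assms by (intro integral_has_real_derivative continuous_intros) auto
  moreover have "at y within {0..y + 1} = at y"
    using assms by (intro at_within_interior) auto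
  ultimately show ?thesis by (simp add: gauss_def[abs_def])
qed

lemma gauss_cont: "continuous_on {0..y} gauss"
proof -
  have "continuous_on {0..y} (\<lambda>x. integral {0..x} (\<lambda>t. exp (- t\<^sup>2 / 2) :: real))"
    by (intro indefinite_integral_continuous_1 integrable_continuous_interval continuous_intros) auto
  then show ?thesis by (simp add: gauss_def[abs_def])
qed

lemma gauss_cont0: "continuous_on {0..} gauss"
proof (rule continuous_on_subset[of "{0..}"])
  show "continuous_on {0..} gauss"
    unfolding continuous_on_eq_continuous_within
  proof
    fix x :: real assume x: "x \<in> {0..}"
    show "continuous (at x within {0..}) gauss"
    proof (cases "x = 0")
      case True
      have "continuous (at 0 within {0..1}) gauss"
        using gauss_cont[of 1] by (simp add: continuous_on_eq_continuous_within)
      moreover have "at (0::real) within {0..1} = at 0 within {0..}"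
        by (rule at_within_nhd[of _ "{..<1}"]) auto
      ultimately show ?thesis using True by (simp add: continuous_within)
    next
      case False
      then show ?thesis
        using x gauss_deriv[of x] by (auto intro: continuous_at_imp_continuous_at_within DERIV_isCont)
    qed
  qed
qed simp

text \<open>The integrand decreases, so the integral exceeds its length times the final value. This
  is what makes \<open>f_lim'\<close> and \<open>g_lim'\<close> strictly decreasing.\<close>

lemma gauss_gt:
  assumes "0 < y" shows "y * exp (- y\<^sup>2 / 2) < gauss y"
proof -
  have "(\<lambda>x. gauss x - x * exp (- x\<^sup>2 / 2)) 0 < (\<lambda>x. gauss x - x * exp (- x\<^sup>2 / 2)) y"
  proof (rule DERIV_pos_imp_increasing_open[OF assms])
    fix x :: real assume x: "0 < x" "x < y"
    have "((\<lambda>x. gauss x - x * exp (- x\<^sup>2 / 2)) has_real_derivative x\<^sup>2 * exp (- x\<^sup>2 / 2)) (at x)"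
      using x by (auto intro!: derivative_eq_intros gauss_deriv simp: power2_eq_square algebra_simps)
    moreover have "0 < x\<^sup>2 * exp (- x\<^sup>2 / 2)" using x by simp
    ultimately show "\<exists>z. ((\<lambda>x. gauss x - x * exp (- x\<^sup>2 / 2)) has_real_derivative z) (at x) \<and> 0 < z"
      by blast
  qed (intro continuous_intros gauss_cont; simp)
  then show ?thesis by simp
qed

lemma gauss_pos: "0 < y \<Longrightarrow> 0 < gauss y"
  using gauss_gt[of y] by (meson exp_gt_zero less_trans mult_pos_pos)

lemma gauss_nonneg: "0 \<le> y \<Longrightarrow> 0 \<le> gauss y"
  using gauss_pos[of y] by (cases "y = 0") auto

lemma gauss_less:
  assumes "0 < y" shows "gauss y < y"
proof -
  have "(\<lambda>x. x - gauss x) 0 < (\<lambda>x. x - gauss x) y"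
  proof (rule DERIV_pos_imp_increasing_open[OF assms])
    fix x :: real assume x: "0 < x" "x < y"
    have "((\<lambda>x. x - gauss x) has_real_derivative 1 - exp (- x\<^sup>2 / 2)) (at x)"
      using x by (auto intro!: derivative_eq_intros gauss_deriv)
    moreover have "0 < 1 - exp (- x\<^sup>2 / 2)" using x by simp
    ultimately show "\<exists>z. ((\<lambda>x. x - gauss x) has_real_derivative z) (at x) \<and> 0 < z"
      by blast
  qed (intro continuous_intros gauss_cont)
  then show ?thesis by simp
qed

lemma gauss_strict_mono:
  assumes "0 \<le> x" "x < y" shows "gauss x < gauss y"
proof (rule DERIV_pos_imp_increasing_open[OF assms(2)])
  fix z assume "x < z" "z < y"
  then show "\<exists>w. (gauss has_real_derivative w) (at z) \<and> 0 < w"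
    using assms gauss_deriv[of z] exp_gt_zero by (metis le_less_trans)
next
  show "continuous_on {x..y} gauss"
    using gauss_cont[of y] by (rule continuous_on_subset) (use assms in auto)
qed

lemma gauss_tendsto: "(gauss \<longlongrightarrow> sqrt (pi / 2)) at_top"
proof -
  let ?f = "\<lambda>x. indicator {0..} x *\<^sub>R exp (- x\<^sup>2 / 2) :: real"
  \<comment> \<open>The integral of \<open>exp (- x\<^sup>2)\<close> over the half-line is
    \<open>sqrt pi / 2\<close>; scaling by \<open>1 / sqrt 2\<close> turns it into the one needed
    here.\<close>
  have "has_bochner_integral lborel (\<lambda>x. indicator {0..} (0 + (1 / sqrt 2) * x) *\<^sub>R exp (- (0 + (1 / sqrt 2) * x)\<^sup>2) :: real)
          ((sqrt pi / 2) /\<^sub>R \<bar>1 / sqrt 2\<bar>)"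
    using gaussian_moment_0
    by (subst (asm) lborel_has_bochner_integral_real_affine_iff[where c = "1 / sqrt 2" and t = 0]) auto
  also have "(\<lambda>x. indicator {0..} (0 + (1 / sqrt 2) * x) *\<^sub>R exp (- (0 + (1 / sqrt 2) * x)\<^sup>2)) = ?f"
    by (auto simp: fun_eq_iff indicator_def power_mult_distrib field_simps)
  also have "(sqrt pi / 2) /\<^sub>R \<bar>1 / sqrt 2\<bar> = sqrt (pi / 2)"
    by (simp add: real_sqrt_divide field_simps)
  finally have B: "has_bochner_integral lborel ?f (sqrt (pi / 2))" .
  then have int: "integrable lborel ?f" and val: "integral\<^sup>L lborel ?f = sqrt (pi / 2)"
    by (auto simp: has_bochner_integral_iff)
  have "((\<lambda>y. \<integral>x. indicator {..y} x *\<^sub>R ?f x \<partial>lborel) \<longlongrightarrow> sqrt (pi / 2)) at_top"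
    using tendsto_integral_at_top[OF _ int] val by simp
  moreover have "\<integral>x. indicator {..y} x *\<^sub>R ?f x \<partial>lborel = gauss y" for y
  proof -
    have "(\<integral>x. indicator {..y} x *\<^sub>R ?f x \<partial>lborel) = (LINT x:{0..y}|lborel. exp (- x\<^sup>2 / 2))"
      unfolding set_lebesgue_integral_def by (intro Bochner_Integration.integral_cong) (auto simp: indicator_def)
    also have "\<dots> = gauss y"
      unfolding gauss_def by (intro set_borel_integral_eq_integral borel_integrable_atLeastAtMost') (intro continuous_intros; simp)
    finally show ?thesis .
  qed
  ultimately show ?thesis by simp
qed

lemma f_lim_gauss: "f_lim \<beta> = sqrt \<beta> * gauss (sqrt \<beta>) + exp (- \<beta> / 2)"
  by (simp add: f_lim_def gauss_def)

lemma g_lim_gauss: "g_lim \<beta> = sqrt \<beta> * gauss (1 / sqrt \<beta>) + \<beta> * exp (- 1 / (2 * \<beta>))"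
  by (simp add: g_lim_def gauss_def)

text \<open>The exponential terms produced by differentiating the upper limit and the last summand
  of \<open>f_lim\<close> cancel, which leaves this quotient.\<close>

definition f_lim' :: "real \<Rightarrow> real" where
  "f_lim' \<beta> = gauss (sqrt \<beta>) / (2 * sqrt \<beta>)"

definition g_lim' :: "real \<Rightarrow> real" where
  "g_lim' \<beta> = gauss (1 / sqrt \<beta>) / (2 * sqrt \<beta>) + exp (- 1 / (2 * \<beta>))"

lemma f_lim_deriv:
  assumes "0 < \<beta>" shows "(f_lim has_real_derivative f_lim' \<beta>) (at \<beta>)"
proof -
  have g: "((\<lambda>x. gauss (sqrt x)) has_real_derivative exp (- (sqrt \<beta>)\<^sup>2 / 2) * (inverse (sqrt \<beta>) / 2)) (at \<beta>)"
    using assms by (intro DERIV_chain2[of gauss] gauss_deriv DERIV_real_sqrt) auto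
  have "((\<lambda>x. sqrt x * gauss (sqrt x) + exp (- x / 2)) has_real_derivative f_lim' \<beta>) (at \<beta>)"
    using assms unfolding f_lim'_def
    by (auto intro!: derivative_eq_intros g simp: field_simps)
  then show ?thesis by (simp add: f_lim_gauss[abs_def])
qed

lemma f_lim_cont: "continuous_on {0..} f_lim"
proof -
  have "continuous_on {0..} (\<lambda>x. gauss (sqrt x))"
    by (intro continuous_on_compose2[OF gauss_cont0] continuous_intros) auto
  then show ?thesis unfolding f_lim_gauss[abs_def] by (intro continuous_intros) auto
qed

lemma f_lim'_pos: "0 < \<beta> \<Longrightarrow> 0 < f_lim' \<beta>"
  by (simp add: f_lim'_def gauss_pos)

lemma f_lim'_less: "0 < \<beta> \<Longrightarrow> f_lim' \<beta> < 1 / 2"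
  using gauss_less[of "sqrt \<beta>"] by (simp add: f_lim'_def field_simps)

lemma f_lim_strict_mono:
  assumes "0 \<le> x" "x < y" shows "f_lim x < f_lim y"
proof (rule DERIV_pos_imp_increasing_open[OF assms(2)])
  fix z assume "x < z" "z < y"
  then show "\<exists>w. (f_lim has_real_derivative w) (at z) \<and> 0 < w"
    using assms f_lim_deriv[of z] f_lim'_pos[of z] by (metis le_less_trans)
next
  show "continuous_on {x..y} f_lim"
    using f_lim_cont by (rule continuous_on_subset) (use assms in auto)
qed

lemma f_lim_mono: "0 \<le> x \<Longrightarrow> x \<le> y \<Longrightarrow> f_lim x \<le> f_lim y"
  using f_lim_strict_mono[of x y] by (cases "x = y") auto

lemma f_lim_0: "f_lim 0 = 1"
  by (simp add: f_lim_gauss)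

lemma f_lim_ge_1: "0 \<le> x \<Longrightarrow> 1 \<le> f_lim x"
  using f_lim_mono[of 0 x] by (simp add: f_lim_0)

lemma f_lim_le: "0 \<le> x \<Longrightarrow> f_lim x \<le> 1 + x"
  using mult_left_mono[of "gauss (sqrt x)" "sqrt x" "sqrt x"] gauss_less[of "sqrt x"]
  by (cases "x = 0") (auto simp: f_lim_gauss intro!: add_mono[where b = x and d = 1, simplified add.commute])

text \<open>Up to the factor 1/2, \<open>f_lim' \<beta>\<close> is the average of the decreasing
  function \<open>exp (- t\<^sup>2 / 2)\<close> over \<open>{0..sqrt \<beta>}\<close>, and such
  averages decrease.\<close>

lemma f_lim'_strict_antimono:
  assumes "0 < a" "a < b" shows "f_lim' b < f_lim' a"
proof -
  have "gauss (sqrt b) / sqrt b < gauss (sqrt a) / sqrt a"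
  proof (rule DERIV_neg_imp_decreasing_open[where f = "\<lambda>y. gauss y / y"])
    fix y assume y: "sqrt a < y" "y < sqrt b"
    then have "0 < y" using real_sqrt_gt_zero[OF assms(1)] by linarith
    then have "((\<lambda>y. gauss y / y) has_real_derivative (exp (- y\<^sup>2 / 2) * y - gauss y * 1) / (y * y)) (at y)"
      by (intro derivative_intros gauss_deriv) auto
    moreover have "(exp (- y\<^sup>2 / 2) * y - gauss y * 1) / (y * y) < 0"
      using \<open>0 < y\<close> gauss_gt[of y] by (intro divide_neg_pos) (auto simp: mult.commute)
    ultimately show "\<exists>z. ((\<lambda>y. gauss y / y) has_real_derivative z) (at y) \<and> z < 0" by blast
  next
    show "continuous_on {sqrt a..sqrt b} (\<lambda>y. gauss y / y)"
      using assms by (intro continuous_intros continuous_on_subset[OF gauss_cont0]) auto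
  qed (use assms in auto)
  then show ?thesis by (simp add: f_lim'_def)
qed

lemma gauss_isCont: "0 < y \<Longrightarrow> isCont gauss y"
  by (rule DERIV_isCont[OF gauss_deriv])

lemma f_lim'_cont:
  assumes "0 < \<beta>" shows "isCont f_lim' \<beta>"
proof -
  have g: "isCont (\<lambda>x. gauss (sqrt x)) \<beta>"
    using assms by (intro isCont_o2[OF isCont_real_sqrt] gauss_isCont) simp
  show ?thesis
    unfolding f_lim'_def[abs_def] using assms by (intro continuous_intros g) simp
qed

text \<open>The derivative falls from 1/2 near 0, where \<open>gauss_gt\<close> bounds it below by
  \<open>exp (- x / 2) / 2\<close>, to 0 at infinity, because \<open>gauss\<close> is bounded. Hence
  the threshold 1/2.\<close>

lemma f_lim'_solution:
  assumes "0 < \<alpha>" "\<alpha> < 1 / 2" shows "\<exists>\<beta>>0. f_lim' \<beta> = \<alpha>"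
proof -
  have "((\<lambda>x::real. exp (- x / 2) / 2) \<longlongrightarrow> 1 / 2) (at_right 0)"
    by real_asymp
  then have "eventually (\<lambda>x. exp (- x / 2) / 2 > \<alpha>) (at_right 0)"
    using assms by (intro order_tendstoD(1)[where a = \<alpha>]) auto
  moreover have "eventually (\<lambda>x. x > (0::real)) (at_right 0)" by (simp add: eventually_at_right_less)
  ultimately have "eventually (\<lambda>x. x > 0 \<and> exp (- x / 2) / 2 > \<alpha>) (at_right 0)" by eventually_elim auto
  then obtain a where a: "a > 0" "exp (- a / 2) / 2 > \<alpha>"
    using eventually_happens'[of "at_right (0::real)"] by force
  have "sqrt a * exp (- a / 2) < gauss (sqrt a)" using gauss_gt[of "sqrt a"] a(1) by simp
  then have "exp (- a / 2) / 2 < f_lim' a" using a(1) by (simp add: f_lim'_def field_simps)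
  with a have fa: "\<alpha> < f_lim' a" by linarith
  have "((\<lambda>y. gauss y / y) \<longlongrightarrow> 0) at_top"
    by (rule tendsto_divide_0[OF gauss_tendsto]) (simp add: filterlim_at_top_imp_at_infinity filterlim_ident)
  then have "eventually (\<lambda>y. gauss y / y < 2 * \<alpha>) at_top"
    using assms by (intro order_tendstoD(2)) auto
  moreover have "eventually (\<lambda>y. y > sqrt a) at_top" by (rule eventually_gt_at_top)
  ultimately have "eventually (\<lambda>y. y > sqrt a \<and> gauss y / y < 2 * \<alpha>) at_top" by eventually_elim auto
  then obtain y where y: "y > sqrt a" "gauss y / y < 2 * \<alpha>"
    using eventually_happens'[of "at_top :: real filter"] by force
  have y0: "0 < y" using y(1) real_sqrt_gt_zero[OF a(1)] by linarith
  have "(sqrt a)\<^sup>2 < y\<^sup>2" using y(1) a(1) by (intro power_strict_mono) auto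
  then have b: "a < y\<^sup>2" using a(1) by simp
  have fb: "f_lim' (y\<^sup>2) < \<alpha>" using y y0 by (simp add: f_lim'_def)
  have "\<exists>x\<ge>a. x \<le> y\<^sup>2 \<and> f_lim' x = \<alpha>"
    using a b fa fb f_lim'_cont by (intro IVT2) auto
  then show ?thesis using a(1) by (metis less_le_trans)
qed

lemma g_lim_deriv:
  assumes "0 < \<beta>" shows "(g_lim has_real_derivative g_lim' \<beta>) (at \<beta>)"
proof -
  have sq: "(1 / sqrt \<beta>)\<^sup>2 / 2 = 1 / (2 * \<beta>)" using assms by (simp add: power_divide)
  have "((\<lambda>x. 1 / sqrt x) has_real_derivative - (1 / (2 * \<beta> * sqrt \<beta>))) (at \<beta>)"
    using assms by (auto intro!: derivative_eq_intros simp: field_simps)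
  then have g: "((\<lambda>x. gauss (1 / sqrt x)) has_real_derivative exp (- (1 / sqrt \<beta>)\<^sup>2 / 2) * - (1 / (2 * \<beta> * sqrt \<beta>))) (at \<beta>)"
    using assms by (intro DERIV_chain2[of gauss] gauss_deriv) auto
  have e: "((\<lambda>x. x * exp (- 1 / (2 * x))) has_real_derivative
      exp (- 1 / (2 * \<beta>)) + \<beta> * (exp (- 1 / (2 * \<beta>)) * (1 / (2 * \<beta>\<^sup>2)))) (at \<beta>)"
    using assms by (auto intro!: derivative_eq_intros simp: power2_eq_square field_simps)
  have s: "(sqrt has_real_derivative inverse (sqrt \<beta>) / 2) (at \<beta>)"
    using assms by (rule DERIV_real_sqrt)
  have "((\<lambda>x. sqrt x * gauss (1 / sqrt x) + x * exp (- 1 / (2 * x))) has_real_derivative g_lim' \<beta>) (at \<beta>)"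
    by (rule DERIV_cong[OF DERIV_add[OF DERIV_mult[OF s g] e]])
       (use assms sq in \<open>simp add: g_lim'_def field_simps power2_eq_square\<close>)
  then show ?thesis by (simp add: g_lim_gauss[abs_def])
qed

text \<open>In the variable \<open>y = 1 / sqrt \<beta>\<close> the derivative is
  \<open>y * gauss y / 2 + exp (- y\<^sup>2 / 2)\<close>, which increases with \<open>y\<close> by
  \<open>gauss_gt\<close>.\<close>

lemma g_lim'_strict_antimono:
  assumes "0 < a" "a < b" shows "g_lim' b < g_lim' a"
proof -
  let ?H = "\<lambda>y. y * gauss y / 2 + exp (- y\<^sup>2 / 2)"
  have H: "g_lim' x = ?H (1 / sqrt x)" if "0 < x" for x
    using that by (simp add: g_lim'_def power_divide field_simps)
  have "?H (1 / sqrt b) < ?H (1 / sqrt a)"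
  proof (rule DERIV_pos_imp_increasing_open[where f = ?H])
    fix y assume "1 / sqrt b < y" "y < 1 / sqrt a"
    moreover have "0 < 1 / sqrt b" using assms by simp
    ultimately have y: "0 < y" by linarith
    have "(?H has_real_derivative (gauss y - y * exp (- y\<^sup>2 / 2)) / 2) (at y)"
      using y by (auto intro!: derivative_eq_intros gauss_deriv simp: field_simps)
    then show "\<exists>z. (?H has_real_derivative z) (at y) \<and> 0 < z"
      using gauss_gt[OF y] by (intro exI conjI) auto
  next
    have "{1 / sqrt b..1 / sqrt a} \<subseteq> {0..}" using assms by (auto intro: order_trans[rotated])
    then show "continuous_on {1 / sqrt b..1 / sqrt a} ?H"
      by (intro continuous_intros continuous_on_subset[OF gauss_cont0]) auto
  qed (use assms in \<open>auto simp: frac_less2\<close>)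
  then show ?thesis using H assms by simp
qed

lemma g_lim'_cont:
  assumes "0 < \<beta>" shows "isCont g_lim' \<beta>"
proof -
  have "isCont (\<lambda>x. 1 / sqrt x) \<beta>" using assms by (intro continuous_intros) auto
  then have g: "isCont (\<lambda>x. gauss (1 / sqrt x)) \<beta>"
    by (rule isCont_o2[OF _ gauss_isCont]) (use assms in simp)
  show ?thesis
    unfolding g_lim'_def[abs_def] using assms by (intro continuous_intros g) auto
qed

lemma g_lim'_solution:
  assumes "1 < \<alpha>" shows "\<exists>\<beta>>0. g_lim' \<beta> = \<alpha>"
proof -
  \<comment> \<open>With \<open>y = sqrt (\<alpha> - 1)\<close> the derivative at \<open>?b\<close>
    is at most \<open>y\<^sup>2 / 2 + 1\<close>, that is
    \<open>(\<alpha> + 1) / 2 < \<alpha>\<close>.\<close>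
  let ?b = "1 / (\<alpha> - 1)"
  have lo: "g_lim' ?b < \<alpha>"
  proof -
    define y where "y = sqrt (\<alpha> - 1)"
    have y: "y > 0" "y\<^sup>2 = \<alpha> - 1" using assms by (auto simp: y_def)
    have "g_lim' ?b = y * gauss y / 2 + exp (- (\<alpha> - 1) / 2)"
      using assms by (simp add: g_lim'_def y_def real_sqrt_divide)
    also have "\<dots> \<le> y * y / 2 + 1"
      using y assms gauss_less[of y] by (intro add_mono divide_right_mono mult_left_mono) auto
    also have "\<dots> < \<alpha>" using y assms by (simp add: power2_eq_square field_simps)
    finally show ?thesis .
  qed
  \<comment> \<open>The first entry makes \<open>y * gauss y / 2\<close> at least
    \<open>\<alpha>\<close> once \<open>y \<ge> 1\<close>; the second gives \<open>y \<ge> 1\<close>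
    and puts \<open>1 / y\<^sup>2\<close> below \<open>?b\<close>.\<close>
  define y where "y = max (2 * \<alpha> / gauss 1) (1 + sqrt (\<alpha> - 1))"
  have y1: "y \<ge> 1" "y > sqrt (\<alpha> - 1)" using assms using gauss_pos[of 1] by (auto simp: y_def max.coboundedI2)
  have hi: "\<alpha> < g_lim' (1 / y\<^sup>2)"
  proof -
    have "2 * \<alpha> \<le> y * gauss 1" using gauss_pos[of 1] by (simp add: y_def max_def field_simps)
    also have "\<dots> \<le> y * gauss y"
      using y1 gauss_strict_mono[of 1 y] by (cases "y = 1") auto
    finally have "2 * \<alpha> \<le> y * gauss y" .
    moreover have "g_lim' (1 / y\<^sup>2) = y * gauss y / 2 + exp (- y\<^sup>2 / 2)"
      using y1 by (simp add: g_lim'_def real_sqrt_divide)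
    ultimately show ?thesis using exp_gt_zero[of "- y\<^sup>2 / 2"] by linarith
  qed
  have "(sqrt (\<alpha> - 1))\<^sup>2 < y\<^sup>2" using y1(2) assms by (intro power_strict_mono) auto
  then have "\<alpha> - 1 < y\<^sup>2" using assms by simp
  then have ab: "1 / y\<^sup>2 < ?b" using assms y1 by (intro divide_strict_left_mono mult_pos_pos) auto
  have pos: "0 < 1 / y\<^sup>2" using y1 by auto
  have ct: "isCont g_lim' x" if "1 / y\<^sup>2 \<le> x" for x
    using pos that by (intro g_lim'_cont) linarith
  have "\<exists>x\<ge>1 / y\<^sup>2. x \<le> ?b \<and> g_lim' x = \<alpha>"
    using lo hi ab ct by (intro IVT2) auto
  then show ?thesis using pos by (metis less_le_trans)
qed

text \<open>The exponential term disappears in the limit. The constant is the full half-line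
  Gaussian integral, the source of \<open>pi\<close> in the middle regime.\<close>

lemma f_lim_asymp: "((\<lambda>x. f_lim x / sqrt x) \<longlongrightarrow> sqrt (pi / 2)) at_top"
proof -
  have "((\<lambda>x. gauss (sqrt x) + exp (- x / 2) / sqrt x) \<longlongrightarrow> sqrt (pi / 2) + 0) at_top"
  proof (rule tendsto_add)
    show "((\<lambda>x. gauss (sqrt x)) \<longlongrightarrow> sqrt (pi / 2)) at_top"
      using gauss_tendsto sqrt_at_top by (rule filterlim_compose)
    show "((\<lambda>x::real. exp (- x / 2) / sqrt x) \<longlongrightarrow> 0) at_top" by real_asymp
  qed
  moreover have "eventually (\<lambda>x. gauss (sqrt x) + exp (- x / 2) / sqrt x = f_lim x / sqrt x) at_top"
    using eventually_gt_at_top[of 0]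
    by eventually_elim (simp add: f_lim_gauss add_divide_distrib)
  ultimately show ?thesis using Lim_transform_eventually by fastforce
qed

section \<open>Exponential integrals of the area function\<close>

section \<open>The tail integral\<close>

text \<open>\<open>tailq l t\<close> is the area of \<open>{(w, c) \<in> [0,1]\<^sup>2. w + l c \<le> t}\<close> for \<open>t \<le> 1\<close>, \<open>l \<le> 1\<close>.\<close>

definition tailq :: "real \<Rightarrow> real \<Rightarrow> real" where
  "tailq l t = (if t \<le> l then t\<^sup>2 / (2 * l) else t - l / 2)"

lemma tailq_measurable [measurable]: "tailq l \<in> borel_measurable borel"
  unfolding tailq_def[abs_def] by measurable

text \<open>The chance that \<open>N\<close> independent arcs all exceed \<open>t\<close> is about
  \<open>exp (- N * tailq l t)\<close>, so the integral approximates the mean of their minimum; this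
  is where \<open>f_lim\<close> comes from. The quadratic part of \<open>tailq\<close> gives the
  Gaussian term, the linear part the exponential one.\<close>

lemma nn_integral_tail:
  assumes N: "0 < N" and l: "0 < l"
  shows "(\<integral>\<^sup>+t. ennreal (exp (- N * tailq l t)) * indicator {0..} t \<partial>lborel) = ennreal (f_lim (N * l) / N)"
proof -
  \<comment> \<open>The substitution \<open>t = ?c * x\<close> turns
    \<open>N * t\<^sup>2 / (2 * l)\<close> into \<open>x\<^sup>2 / 2\<close> and the end point
    \<open>l\<close> into \<open>sqrt (N * l)\<close>.\<close>
  let ?c = "sqrt (l / N)"
  have c: "0 < ?c" using assms by simp
  have "(\<integral>\<^sup>+t. ennreal (exp (- N * t\<^sup>2 / (2 * l))) * indicator {0..l} t \<partial>lborel)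
     = ennreal \<bar>?c\<bar> * (\<integral>\<^sup>+x. ennreal (exp (- N * (0 + ?c * x)\<^sup>2 / (2 * l))) * indicator {0..l} (0 + ?c * x) \<partial>lborel)"
    using c by (intro nn_integral_real_affine) auto
  also have "(\<lambda>x. ennreal (exp (- N * (0 + ?c * x)\<^sup>2 / (2 * l))) * indicator {0..l} (0 + ?c * x))
      = (\<lambda>x. ennreal (exp (- x\<^sup>2 / 2) * indicator {0..sqrt (N * l)} x))"
  proof (rule ext)
    fix x :: real
    have "N * (?c * x)\<^sup>2 / (2 * l) = x\<^sup>2 / 2" using assms by (simp add: power_mult_distrib)
    moreover have "?c * x \<le> l \<longleftrightarrow> x \<le> sqrt (N * l)"
    proof -
      have "sqrt (N * l) = l / ?c"
        using assms by (simp add: real_sqrt_divide real_sqrt_mult field_simps)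
      then show ?thesis using c by (simp add: field_simps)
    qed
    moreover have "0 \<le> ?c * x \<longleftrightarrow> 0 \<le> x" using c by (simp add: zero_le_mult_iff)
    ultimately show "ennreal (exp (- N * (0 + ?c * x)\<^sup>2 / (2 * l))) * indicator {0..l} (0 + ?c * x)
        = ennreal (exp (- x\<^sup>2 / 2) * indicator {0..sqrt (N * l)} x)"
      by (auto simp: indicator_def)
  qed
  also have "(\<integral>\<^sup>+x. ennreal (exp (- x\<^sup>2 / 2) * indicator {0..sqrt (N * l)} x) \<partial>lborel) = ennreal (gauss (sqrt (N * l)))"
  proof (rule nn_integral_has_integral_lborel)
    have "((\<lambda>t. exp (- t\<^sup>2 / 2)) has_integral gauss (sqrt (N * l))) {0..sqrt (N * l)}"
      unfolding gauss_def by (intro integrable_integral integrable_continuous_interval continuous_intros) auto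
    then show "((\<lambda>x. exp (- x\<^sup>2 / 2) * indicator {0..sqrt (N * l)} x) has_integral gauss (sqrt (N * l))) UNIV"
      by (subst (asm) has_integral_restrict_UNIV[symmetric]) (simp add: indicator_def of_bool_def if_distrib cong: if_cong)
  qed auto
  finally have I1: "(\<integral>\<^sup>+t. ennreal (exp (- N * t\<^sup>2 / (2 * l))) * indicator {0..l} t \<partial>lborel)
      = ennreal (?c * gauss (sqrt (N * l)))"
    using c assms by (simp add: ennreal_mult gauss_nonneg)
  have I2: "(\<integral>\<^sup>+t. ennreal (exp (- N * (t - l / 2))) * indicator {l..} t \<partial>lborel)
      = ennreal (0 - (- exp (- N * (l - l / 2)) / N))"
  proof (rule nn_integral_FTC_atLeast[where F = "\<lambda>t. - exp (- N * (t - l / 2)) / N"])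
    show "((\<lambda>t. - exp (- N * (t - l / 2)) / N) has_real_derivative exp (- N * (t - l / 2))) (at t)" for t
      using N by (auto intro!: derivative_eq_intros)
    show "((\<lambda>t. - exp (- N * (t - l / 2)) / N) \<longlongrightarrow> 0) at_top"
      using N by real_asymp
  qed auto
  have "(\<integral>\<^sup>+t. ennreal (exp (- N * tailq l t)) * indicator {0..} t \<partial>lborel)
     = (\<integral>\<^sup>+t. ennreal (exp (- N * t\<^sup>2 / (2 * l))) * indicator {0..l} t
          + ennreal (exp (- N * (t - l / 2))) * indicator {l..} t \<partial>lborel)"
  proof (rule nn_integral_cong_AE)
    show "AE t in lborel. ennreal (exp (- N * tailq l t)) * indicator {0..} t
       = ennreal (exp (- N * t\<^sup>2 / (2 * l))) * indicator {0..l} t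
          + ennreal (exp (- N * (t - l / 2))) * indicator {l..} t"
      using AE_lborel_singleton[of l]
      by eventually_elim (use l in \<open>auto simp: tailq_def indicator_def\<close>)
  qed
  also have "\<dots> = ennreal (?c * gauss (sqrt (N * l))) + ennreal (exp (- N * l / 2) / N)"
    using I1 I2 by (subst nn_integral_add) (auto simp: field_simps)
  also have "\<dots> = ennreal (?c * gauss (sqrt (N * l)) + exp (- N * l / 2) / N)"
    using N l c by (intro ennreal_plus[symmetric]) (auto intro!: mult_nonneg_nonneg gauss_nonneg)
  also have "?c = sqrt (N * l) / N"
    using assms by (simp add: real_sqrt_divide real_sqrt_mult field_simps)
  finally show ?thesis by (simp add: f_lim_gauss add_divide_distrib)
qed

lemma tailq_nonneg: "0 < l \<Longrightarrow> 0 \<le> t \<Longrightarrow> 0 \<le> tailq l t"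
  by (auto simp: tailq_def)

lemma tailq_mono:
  assumes "0 < l" "0 \<le> s" "s \<le> t" shows "tailq l s \<le> tailq l t"
proof (cases "t \<le> l")
  case True
  then show ?thesis using assms by (auto simp: tailq_def intro!: divide_right_mono power_mono)
next
  case False
  show ?thesis
  proof (cases "s \<le> l")
    case True
    then have "s\<^sup>2 \<le> l\<^sup>2" using assms by (intro power_mono) auto
    then have "s\<^sup>2 / (2 * l) \<le> l / 2" using assms by (simp add: power2_eq_square field_simps)
    then show ?thesis using False True by (simp add: tailq_def)
  qed (use assms in \<open>auto simp: tailq_def\<close>)
qed

text \<open>\<open>tailq l\<close> is convex and vanishes at 0. For
  \<open>G t = exp (- N * tailq l t)\<close> this yields
  \<open>G t \<le> (G (t / 2))\<^sup>2\<close>, the key to the second moment.\<close>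

lemma tailq_double:
  assumes "0 < l" "0 \<le> t" shows "2 * tailq l t \<le> tailq l (2 * t)"
proof -
  have *: "2 * (t\<^sup>2 / (2 * l)) \<le> 2 * t - l / 2" if "t \<le> l" "l \<le> 2 * t"
  proof -
    have "0 \<le> (2 * t - l) * (l - t)" using that by simp
    moreover have "0 \<le> t * l" using assms by simp
    ultimately have "2 * (t * t) \<le> 4 * (t * l) - l * l" by (simp add: algebra_simps)
    then show ?thesis using assms by (simp add: field_simps power2_eq_square)
  qed
  show ?thesis
  proof (cases "2 * t \<le> l")
    case True
    then show ?thesis using assms by (simp add: tailq_def power_mult_distrib field_simps)
  next
    case False
    then show ?thesis using assms * by (auto simp: tailq_def)
  qed
qed

lemma tailq_le: "0 < l \<Longrightarrow> 0 \<le> t \<Longrightarrow> tailq l t \<le> t"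
  by (auto simp: tailq_def power2_eq_square field_simps intro: order_trans[OF mult_left_mono])

text \<open>Linear growth makes the part of the integral beyond \<open>\<epsilon>\<close>
  exponentially small in \<open>N\<close>.\<close>

lemma tailq_ge:
  assumes "0 < l" "l \<le> 1" "0 < \<epsilon>" "\<epsilon> \<le> 1" "\<epsilon> \<le> t" shows "\<epsilon> / 2 * t \<le> tailq l t"
proof (cases "t \<le> l")
  case True
  have "\<epsilon> * t * l \<le> t * t * 1" using assms by (intro mult_mono) auto
  then show ?thesis using True assms by (simp add: tailq_def field_simps power2_eq_square)
next
  case False
  have "\<epsilon> * t \<le> 1 * t" using assms by (intro mult_right_mono) auto
  then have "\<epsilon> / 2 * t \<le> t - l / 2" using False by (simp add: field_simps)
  then show ?thesis using False by (simp add: tailq_def)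
qed

text \<open>The dependence on \<open>N\<close> can be read off the integral in
  \<open>nn_integral_tail\<close>, though not off the closed form.\<close>

lemma f_lim_div_antimono:
  assumes "0 < N" "N \<le> K" "0 < l" shows "f_lim (K * l) / K \<le> f_lim (N * l) / N"
proof -
  have "ennreal (f_lim (K * l) / K) \<le> ennreal (f_lim (N * l) / N)"
    unfolding nn_integral_tail[symmetric, OF less_le_trans[OF assms(1,2)] assms(3)]
      nn_integral_tail[symmetric, OF assms(1,3)]
  proof (rule nn_integral_mono)
    fix t :: real
    show "ennreal (exp (- K * tailq l t)) * indicator {0..} t \<le> ennreal (exp (- N * tailq l t)) * indicator {0..} t"
      using assms tailq_nonneg[of l t] by (auto simp: indicator_def intro!: ennreal_leI mult_right_mono)
  qed
  moreover have "0 \<le> f_lim (N * l) / N" using f_lim_ge_1[of "N * l"] assms by auto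
  ultimately show ?thesis by (simp add: ennreal_le_iff)
qed

text \<open>The truncation at \<open>\<epsilon>\<close> prepares a comparison with
  \<open>(1 - q) ^ k\<close>, which has an exponential lower bound of nearly the right rate only for
  small \<open>q\<close>.\<close>

lemma nn_integral_tail_lower:
  assumes N: "0 < N" and l: "0 < l" "l \<le> 1" and e: "0 < \<epsilon>" "\<epsilon> \<le> 1"
  shows "ennreal (f_lim (N * l) / N - 2 / (N * \<epsilon>) * exp (- N * \<epsilon>\<^sup>2 / 2))
    \<le> (\<integral>\<^sup>+t. ennreal (exp (- N * tailq l t)) * indicator {0..\<epsilon>} t \<partial>lborel)" (is "_ \<le> ?J")
proof -
  have I: "(\<integral>\<^sup>+t. ennreal (exp (- (N * \<epsilon> / 2) * t)) * indicator {\<epsilon>..} t \<partial>lborel)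
      = ennreal (0 - (- exp (- (N * \<epsilon> / 2) * \<epsilon>) / (N * \<epsilon> / 2)))"
  proof (rule nn_integral_FTC_atLeast[where F = "\<lambda>t. - exp (- (N * \<epsilon> / 2) * t) / (N * \<epsilon> / 2)"])
    show "((\<lambda>t. - exp (- (N * \<epsilon> / 2) * t) / (N * \<epsilon> / 2)) has_real_derivative exp (- (N * \<epsilon> / 2) * t)) (at t)" for t
      using N e by (auto intro!: derivative_eq_intros simp: field_simps)
    have "((\<lambda>t. - exp (- c * t) / c) \<longlongrightarrow> 0) at_top" if "0 < c" for c :: real
      using that by real_asymp
    moreover have "0 < N * \<epsilon> / 2" using N e by simp
    ultimately show "((\<lambda>t. - exp (- (N * \<epsilon> / 2) * t) / (N * \<epsilon> / 2)) \<longlongrightarrow> 0) at_top"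
      by blast
  qed auto
  have "ennreal (f_lim (N * l) / N) = (\<integral>\<^sup>+t. ennreal (exp (- N * tailq l t)) * indicator {0..} t \<partial>lborel)"
    using nn_integral_tail[OF N l(1)] by simp
  also have "\<dots> \<le> (\<integral>\<^sup>+t. ennreal (exp (- N * tailq l t)) * indicator {0..\<epsilon>} t
       + ennreal (exp (- (N * \<epsilon> / 2) * t)) * indicator {\<epsilon>..} t \<partial>lborel)"
  proof (rule nn_integral_mono)
    fix t :: real
    have "ennreal (exp (- N * tailq l t)) \<le> ennreal (exp (- (N * \<epsilon> / 2) * t))" if "\<epsilon> \<le> t"
      using mult_left_mono[OF tailq_ge[OF l e that], of N] N by (intro ennreal_leI) (simp add: mult.assoc)
    then show "ennreal (exp (- N * tailq l t)) * indicator {0..} t \<le> ennreal (exp (- N * tailq l t)) * indicator {0..\<epsilon>} t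
       + ennreal (exp (- (N * \<epsilon> / 2) * t)) * indicator {\<epsilon>..} t"
      by (auto simp: indicator_def)
  qed
  also have "\<dots> = ?J + ennreal (2 / (N * \<epsilon>) * exp (- N * \<epsilon>\<^sup>2 / 2))"
    using I by (subst nn_integral_add) (auto simp: power2_eq_square field_simps)
  finally show ?thesis
    using N e by (subst ennreal_minus[symmetric]) (auto simp: ennreal_minus_le_iff add.commute)
qed

section \<open>Independent groups of arcs and the law of a single arc\<close>

section \<open>Minimal in-arcs\<close>

lemma (in prob_space) indep_vars_group:
  assumes "indep_vars M' X I" "\<And>j. j \<in> L \<Longrightarrow> K j \<subseteq> I" "disjoint_family_on K L"
    and "\<And>j. j \<in> L \<Longrightarrow> Y j \<in> measurable (PiM (K j) M') (N j)"
  shows "indep_vars N (\<lambda>j \<omega>. Y j (restrict (\<lambda>i. X i \<omega>) (K j))) L"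
  by (rule indep_vars_compose2[OF indep_vars_restrict[OF assms(1,2,3)] assms(4)])

lemma (in prob_space) prob_indep_group:
  assumes "indep_vars M' X I" "\<And>j. j \<in> L \<Longrightarrow> K j \<subseteq> I" "disjoint_family_on K L"
    and L: "finite L" "L \<noteq> {}"
    and Q: "\<And>j. j \<in> L \<Longrightarrow> Measurable.pred (PiM (K j) M') (Q j)"
  shows "prob {\<omega>\<in>space M. \<forall>j\<in>L. Q j (restrict (\<lambda>i. X i \<omega>) (K j))}
       = (\<Prod>j\<in>L. prob {\<omega>\<in>space M. Q j (restrict (\<lambda>i. X i \<omega>) (K j))})"
proof -
  have ind: "indep_vars (\<lambda>_. count_space UNIV) (\<lambda>j \<omega>. Q j (restrict (\<lambda>i. X i \<omega>) (K j))) L"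
    using assms by (intro indep_vars_group) auto
  have "prob (\<Inter>j\<in>L. (\<lambda>\<omega>. Q j (restrict (\<lambda>i. X i \<omega>) (K j))) -` {True} \<inter> space M)
      = (\<Prod>j\<in>L. prob ((\<lambda>\<omega>. Q j (restrict (\<lambda>i. X i \<omega>) (K j))) -` {True} \<inter> space M))"
    using L by (intro indep_varsD_finite[OF ind]) auto
  moreover have "(\<Inter>j\<in>L. (\<lambda>\<omega>. Q j (restrict (\<lambda>i. X i \<omega>) (K j))) -` {True} \<inter> space M)
      = {\<omega>\<in>space M. \<forall>j\<in>L. Q j (restrict (\<lambda>i. X i \<omega>) (K j))}"
    using L by auto
  moreover have "(\<lambda>\<omega>. Q j (restrict (\<lambda>i. X i \<omega>) (K j))) -` {True} \<inter> space M
      = {\<omega>\<in>space M. Q j (restrict (\<lambda>i. X i \<omega>) (K j))}" for j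
    by auto
  ultimately show ?thesis by simp
qed

definition others :: "nat \<Rightarrow> nat \<Rightarrow> nat set" where
  "others n v = {1..n} - {v}"

definition min_in :: "nat \<Rightarrow> (nat \<times> nat \<Rightarrow> 'a \<Rightarrow> real) \<Rightarrow> (nat \<times> nat \<Rightarrow> 'a \<Rightarrow> real) \<Rightarrow> real \<Rightarrow> nat \<Rightarrow> 'a \<Rightarrow> real" where
  "min_in n W C l v \<omega> = Min ((\<lambda>u. W (u, v) \<omega> + l * C (u, v) \<omega>) ` others n v)"

definition min_tot :: "nat \<Rightarrow> (nat \<times> nat \<Rightarrow> 'a \<Rightarrow> real) \<Rightarrow> (nat \<times> nat \<Rightarrow> 'a \<Rightarrow> real) \<Rightarrow> real \<Rightarrow> 'a \<Rightarrow> real" where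
  "min_tot n W C l \<omega> = (\<Sum>v\<in>{1..n}. min_in n W C l v \<omega>)"

lemma finite_others [simp]: "finite (others n v)"
  by (simp add: others_def)

lemma others_nonempty: "2 \<le> n \<Longrightarrow> others n v \<noteq> {}"
proof -
  assume "2 \<le> n"
  then have "(if v = 1 then 2 else 1) \<in> others n v" by (auto simp: others_def)
  then show ?thesis by blast
qed

lemma card_others: "v \<in> {1..n} \<Longrightarrow> card (others n v) = n - 1"
  by (simp add: others_def)

lemma others_arc: "v \<in> {1..n} \<Longrightarrow> u \<in> others n v \<Longrightarrow> (u, v) \<in> complete_arcs n"
  by (auto simp: others_def complete_arcs_def)

lemma finite_complete_arcs [simp]: "finite (complete_arcs n)"
  by (rule finite_subset[of _ "{1..n} \<times> {1..n}"]) (auto simp: complete_arcs_def)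

locale arc_weights =
  fixes n :: nat and M :: "'a measure" and W C :: "nat \<times> nat \<Rightarrow> 'a \<Rightarrow> real"
  assumes iid: "iid_uniform_weights_costs n M W C"

sublocale arc_weights \<subseteq> prob_space M
  using iid by (simp add: iid_uniform_weights_costs_def)

context arc_weights
begin

definition WC :: "(nat \<times> nat) + (nat \<times> nat) \<Rightarrow> 'a \<Rightarrow> real" where
  "WC s = (case s of Inl e \<Rightarrow> W e | Inr e \<Rightarrow> C e)"

abbreviation "arcs \<equiv> complete_arcs n"

lemma WC_simps [simp]: "WC (Inl e) = W e" "WC (Inr e) = C e"
  by (simp_all add: WC_def)

lemma indep: "indep_vars (\<lambda>_. borel) WC (arcs <+> arcs)"
  using iid by (simp add: iid_uniform_weights_costs_def WC_def[abs_def])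

lemma WC_measurable: "s \<in> arcs <+> arcs \<Longrightarrow> random_variable borel (WC s)"
  using indep by (auto simp: indep_vars_def)

lemma W_measurable: "e \<in> arcs \<Longrightarrow> random_variable borel (W e)"
  using WC_measurable[of "Inl e"] by auto

lemma C_measurable: "e \<in> arcs \<Longrightarrow> random_variable borel (C e)"
  using WC_measurable[of "Inr e"] by auto

lemma distr_W: "e \<in> arcs \<Longrightarrow> distr M borel (W e) = uniform_measure lborel {0..1}"
  and distr_C: "e \<in> arcs \<Longrightarrow> distr M borel (C e) = uniform_measure lborel {0..1}"
  using iid by (auto simp: iid_uniform_weights_costs_def)

text \<open>A multiplier \<open>l > 1\<close> for weights and costs corresponds to
  \<open>1 / l < 1\<close> with the roles exchanged, so the area formula for
  \<open>l \<le> 1\<close> suffices.\<close>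

lemma swap: "arc_weights n M C W"
proof -
  \<comment> \<open>Each new variable reads a one-element block of the old family, so independence
    survives the re-indexing.\<close>
  let ?K = "\<lambda>s. {case s of Inl e \<Rightarrow> Inr e | Inr e \<Rightarrow> Inl e}"
  have "indep_vars (\<lambda>_. borel)
      (\<lambda>s \<omega>. (\<lambda>f. f (case s of Inl e \<Rightarrow> Inr e | Inr e \<Rightarrow> Inl e)) (restrict (\<lambda>i. WC i \<omega>) (?K s))) (arcs <+> arcs)"
    by (rule indep_vars_group[OF indep])
       (auto simp: disjoint_family_on_def split: sum.splits)
  also have "(\<lambda>s \<omega>. (\<lambda>f. f (case s of Inl e \<Rightarrow> Inr e | Inr e \<Rightarrow> Inl e)) (restrict (\<lambda>i. WC i \<omega>) (?K s)))
      = (\<lambda>s. case s of Inl e \<Rightarrow> C e | Inr e \<Rightarrow> W e)"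
    by (auto simp: fun_eq_iff split: sum.splits)
  finally show ?thesis
    using distr_W distr_C prob_space_axioms
    by unfold_locales (auto simp: iid_uniform_weights_costs_def)
qed

lemma uniform_atMost: "emeasure (uniform_measure lborel {0..1::real}) {..a} = ennreal (min 1 (max 0 a))"
proof -
  have "{0..1} \<inter> {..a} = (if a < 0 then {} else {0..min 1 a})" by auto
  then show ?thesis by (auto simp: divide_ennreal_def max_def)
qed

lemma prob_W_le:
  assumes "e \<in> arcs" "0 \<le> a" "a \<le> 1" shows "prob {\<omega>\<in>space M. W e \<omega> \<le> a} = a"
proof -
  have "emeasure M {\<omega>\<in>space M. W e \<omega> \<le> a} = emeasure (distr M borel (W e)) {..a}"
    using W_measurable[OF assms(1)] by (subst emeasure_distr) (auto intro!: arg_cong[where f = "emeasure M"])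
  also have "\<dots> = ennreal a" using assms by (simp add: distr_W uniform_atMost)
  finally show ?thesis using assms by (simp add: measure_def)
qed

lemma AE_W: "e \<in> arcs \<Longrightarrow> AE \<omega> in M. 0 \<le> W e \<omega> \<and> W e \<omega> \<le> 1"
proof -
  assume e: "e \<in> arcs"
  have "AE x in uniform_measure lborel {0..1::real}. 0 \<le> x \<and> x \<le> 1"
    by (subst AE_uniform_measure) auto
  then show ?thesis using W_measurable[OF e]
    by (subst (asm) distr_W[OF e, symmetric], subst (asm) AE_distr_iff) auto
qed

lemma indep_var_W_C: "e \<in> arcs \<Longrightarrow> indep_var borel (W e) borel (C e)"
proof -
  assume e: "e \<in> arcs"
  have "indep_var (PiM {Inl e} (\<lambda>_. borel)) (\<lambda>\<omega>. restrict (\<lambda>i. WC i \<omega>) {Inl e})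
      (PiM {Inr e} (\<lambda>_. borel)) (\<lambda>\<omega>. restrict (\<lambda>i. WC i \<omega>) {Inr e})"
    using e by (intro indep_var_restrict[OF indep]) auto
  then have "indep_var borel ((\<lambda>f. f (Inl e)) \<circ> (\<lambda>\<omega>. restrict (\<lambda>i. WC i \<omega>) {Inl e}))
      borel ((\<lambda>f. f (Inr e)) \<circ> (\<lambda>\<omega>. restrict (\<lambda>i. WC i \<omega>) {Inr e}))"
    by (rule indep_var_compose) auto
  then show ?thesis by (simp add: comp_def)
qed

text \<open>Fubini over the cost: for cost \<open>c\<close> the admissible weights form an interval
  of length \<open>max 0 (t - l * c)\<close>. The hypothesis \<open>t \<le> 1\<close> keeps this
  length at most 1, and it vanishes from \<open>c = t / l\<close> on.\<close>

lemma prob_arc_le: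
  assumes e: "e \<in> arcs" and l: "0 < l" "l \<le> 1" and t: "0 \<le> t" "t \<le> 1"
  shows "prob {\<omega>\<in>space M. W e \<omega> + l * C e \<omega> \<le> t} = tailq l t"
proof -
  let ?U = "uniform_measure lborel {0..1::real}"
  interpret U: prob_space ?U by (rule prob_space_uniform_measure) auto
  interpret UU: pair_prob_space ?U ?U ..
  have [measurable]: "W e \<in> borel_measurable M" "C e \<in> borel_measurable M"
    using e W_measurable C_measurable by auto
  have D: "distr M (borel \<Otimes>\<^sub>M borel) (\<lambda>\<omega>. (W e \<omega>, C e \<omega>)) = ?U \<Otimes>\<^sub>M ?U"
    using indep_var_W_C[OF e] by (simp add: indep_var_distribution_eq distr_W[OF e] distr_C[OF e])
  let ?A = "{p :: real \<times> real. fst p + l * snd p \<le> t}"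
  have A[measurable]: "?A \<in> sets (borel \<Otimes>\<^sub>M borel)"
  proof -
    have "{p \<in> space (borel \<Otimes>\<^sub>M borel). fst p + l * snd p \<le> t} \<in> sets (borel \<Otimes>\<^sub>M (borel :: real measure))"
      by measurable
    then show ?thesis by (simp add: space_pair_measure)
  qed
  have "emeasure M {\<omega>\<in>space M. W e \<omega> + l * C e \<omega> \<le> t}
      = emeasure (distr M (borel \<Otimes>\<^sub>M borel) (\<lambda>\<omega>. (W e \<omega>, C e \<omega>))) ?A"
    by (subst emeasure_distr) (auto intro!: arg_cong[where f = "emeasure M"])
  also have "\<dots> = (\<integral>\<^sup>+c. emeasure ?U ((\<lambda>w. (w, c)) -` ?A) \<partial>?U)"
    unfolding D by (rule UU.emeasure_pair_measure_alt2) (simp cong: sets_pair_measure_cong)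
  also have "\<dots> = (\<integral>\<^sup>+c. ennreal (max 0 (t - l * c)) * indicator {0..1} c \<partial>lborel)"
  proof -
    have "emeasure ?U ((\<lambda>w. (w, c)) -` ?A) = ennreal (min 1 (max 0 (t - l * c)))" for c
    proof -
      have "(\<lambda>w. (w, c)) -` ?A = {..t - l * c}" by auto
      then show ?thesis using uniform_atMost by metis
    qed
    then have "(\<integral>\<^sup>+c. emeasure ?U ((\<lambda>w. (w, c)) -` ?A) \<partial>?U)
        = (\<integral>\<^sup>+c. ennreal (min 1 (max 0 (t - l * c))) \<partial>?U)" by presburger
    also have "\<dots> = (\<integral>\<^sup>+c. ennreal (min 1 (max 0 (t - l * c))) * indicator {0..1} c \<partial>lborel) / emeasure lborel {0..1::real}"
      by (rule nn_integral_uniform_measure) auto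
    also have "\<dots> = (\<integral>\<^sup>+c. ennreal (min 1 (max 0 (t - l * c))) * indicator {0..1} c \<partial>lborel)"
      by (simp add: divide_ennreal_def)
    also have "\<dots> = (\<integral>\<^sup>+c. ennreal (max 0 (t - l * c)) * indicator {0..1} c \<partial>lborel)"
    proof (rule nn_integral_cong)
      fix c :: real
      have "t - l * c \<le> 1" if "0 \<le> c"
        using mult_nonneg_nonneg[of l c] that l t by linarith
      then show "ennreal (min 1 (max 0 (t - l * c))) * indicator {0..1} c
          = ennreal (max 0 (t - l * c)) * indicator {0..1} c"
        by (auto simp: indicator_def min_def)
    qed
    finally show ?thesis .
  qed
  also have "\<dots> = (\<integral>\<^sup>+c. ennreal (t - l * c) * indicator {0..min 1 (t / l)} c \<partial>lborel)"
  proof (rule nn_integral_cong)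
    fix c :: real
    have "t - l * c \<le> 0 \<longleftrightarrow> t / l \<le> c" "t < l * c \<longleftrightarrow> t / l < c"
      using l by (simp_all add: field_simps)
    then show "ennreal (max 0 (t - l * c)) * indicator {0..1} c = ennreal (t - l * c) * indicator {0..min 1 (t / l)} c"
      by (auto simp: indicator_def max_def)
  qed
  also have "\<dots> = ennreal ((t * min 1 (t / l) - l * (min 1 (t / l))\<^sup>2 / 2) - (t * 0 - l * 0\<^sup>2 / 2))"
  proof (rule nn_integral_FTC_Icc[where F = "\<lambda>c. t * c - l * c\<^sup>2 / 2"])
    show "DERIV (\<lambda>c. t * c - l * c\<^sup>2 / 2) x :> t - l * x" for x
      by (auto intro!: derivative_eq_intros)
    show "0 \<le> t - l * x" if "x \<in> {0..min 1 (t / l)}" for x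
      using that l by (auto simp: field_simps)
  qed (use l t in auto)
  also have "(t * min 1 (t / l) - l * (min 1 (t / l))\<^sup>2 / 2) - (t * 0 - l * 0\<^sup>2 / 2) = tailq l t"
    using l by (auto simp: tailq_def min_def field_simps power2_eq_square)
  finally show ?thesis using tailq_nonneg[OF l(1) t(1)] by (simp add: measure_def)
qed

end

section \<open>Moments of the minimal in-arc\<close>

section \<open>Concentration\<close>

text \<open>The choice \<open>h t = 1\<close> yields the mean and \<open>h t = 2 * t\<close> the
  second moment.\<close>

lemma (in prob_space) layer_cake:
  fixes X :: "'a \<Rightarrow> real" and h :: "real \<Rightarrow> ennreal"
  assumes [measurable]: "X \<in> borel_measurable M" "h \<in> borel_measurable borel"
  shows "(\<integral>\<^sup>+\<omega>. (\<integral>\<^sup>+t. h t * indicator {0..<X \<omega>} t \<partial>lborel) \<partial>M)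
       = (\<integral>\<^sup>+t. h t * indicator {0..} t * emeasure M {\<omega>\<in>space M. t < X \<omega>} \<partial>lborel)"
proof -
  interpret P: pair_sigma_finite M lborel ..
  have eq: "h t * indicator {0..<X \<omega>} t = (if 0 \<le> t \<and> t < X \<omega> then h t else 0)" for t \<omega>
    by (auto simp: indicator_def)
  have "(\<integral>\<^sup>+\<omega>. (\<integral>\<^sup>+t. h t * indicator {0..<X \<omega>} t \<partial>lborel) \<partial>M)
      = (\<integral>\<^sup>+t. (\<integral>\<^sup>+\<omega>. h t * indicator {0..<X \<omega>} t \<partial>M) \<partial>lborel)"
    unfolding eq by (rule P.Fubini'[symmetric]) measurable
  also have "\<dots> = (\<integral>\<^sup>+t. h t * indicator {0..} t * emeasure M {\<omega>\<in>space M. t < X \<omega>} \<partial>lborel)"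
  proof (rule nn_integral_cong)
    fix t :: real
    have "(\<integral>\<^sup>+\<omega>. h t * indicator {0..<X \<omega>} t \<partial>M)
        = (\<integral>\<^sup>+\<omega>. (h t * indicator {0..} t) * indicator {\<omega>\<in>space M. t < X \<omega>} \<omega> \<partial>M)"
      by (intro nn_integral_cong) (auto simp: indicator_def)
    also have "\<dots> = h t * indicator {0..} t * emeasure M {\<omega>\<in>space M. t < X \<omega>}"
      by (subst nn_integral_cmult_indicator) auto
    finally show "(\<integral>\<^sup>+\<omega>. h t * indicator {0..<X \<omega>} t \<partial>M)
        = h t * indicator {0..} t * emeasure M {\<omega>\<in>space M. t < X \<omega>}" .
  qed
  finally show ?thesis .
qed

text \<open>After centring, the mixed terms vanish by independence, and each variance is at most the
  second moment.\<close>

lemma (in prob_space) expectation_square_sum_indep: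
  fixes X :: "'i \<Rightarrow> 'a \<Rightarrow> real"
  assumes I: "finite I" and ind: "indep_vars (\<lambda>_. borel) X I"
    and int: "\<And>i. i \<in> I \<Longrightarrow> integrable M (X i)" "\<And>i. i \<in> I \<Longrightarrow> integrable M (\<lambda>\<omega>. (X i \<omega>)\<^sup>2)"
  shows "integrable M (\<lambda>\<omega>. (\<Sum>i\<in>I. X i \<omega>)\<^sup>2)"
    and "variance (\<lambda>\<omega>. \<Sum>i\<in>I. X i \<omega>) \<le> (\<Sum>i\<in>I. expectation (\<lambda>\<omega>. (X i \<omega>)\<^sup>2))"
proof -
  define Y where "Y i \<omega> = X i \<omega> - expectation (X i)" for i \<omega>
  have pair: "integrable M (\<lambda>\<omega>. Z i \<omega> * Z j \<omega>) \<and>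
      expectation (\<lambda>\<omega>. Z i \<omega> * Z j \<omega>) = expectation (Z i) * expectation (Z j)"
    if "i \<in> I" "j \<in> I" "i \<noteq> j" "indep_vars (\<lambda>_. borel) Z I" "\<And>i. i \<in> I \<Longrightarrow> integrable M (Z i)"
    for Z :: "'i \<Rightarrow> 'a \<Rightarrow> real" and i j
  proof -
    have "indep_vars (\<lambda>_. borel) Z {i, j}" using that by (intro indep_vars_subset[OF that(4)]) auto
    from indep_vars_lebesgue_integral[OF _ this] indep_vars_integrable[OF _ this]
    show ?thesis using that by auto
  qed
  have sq: "integrable M (\<lambda>\<omega>. X i \<omega> * X j \<omega>)" if "i \<in> I" "j \<in> I" for i j
    using pair[OF that _ ind int(1)] int(2)[OF that(1)] by (cases "i = j") (auto simp: power2_eq_square)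
  then show "integrable M (\<lambda>\<omega>. (\<Sum>i\<in>I. X i \<omega>)\<^sup>2)"
    by (auto simp: power2_eq_square sum_product)
  have Yint: "integrable M (Y i)" if "i \<in> I" for i using int(1)[OF that] by (auto simp: Y_def[abs_def])
  have Y0: "expectation (Y i) = 0" if "i \<in> I" for i
    using int(1)[OF that] by (auto simp: Y_def[abs_def] prob_space)
  have Yind: "indep_vars (\<lambda>_. borel) Y I"
    unfolding Y_def[abs_def] by (rule indep_vars_compose2[OF ind]) auto
  have Ysq: "integrable M (\<lambda>\<omega>. Y i \<omega> * Y j \<omega>)" if "i \<in> I" "j \<in> I" for i j
    using sq[OF that] int(1)[OF that(1)] int(1)[OF that(2)] unfolding Y_def by (auto simp: algebra_simps)
  have "variance (\<lambda>\<omega>. \<Sum>i\<in>I. X i \<omega>) = expectation (\<lambda>\<omega>. \<Sum>i\<in>I. \<Sum>j\<in>I. Y i \<omega> * Y j \<omega>)"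
    using int by (subst Bochner_Integration.integral_sum) (auto simp: Y_def power2_eq_square sum_subtractf sum_product[symmetric])
  also have "\<dots> = (\<Sum>i\<in>I. \<Sum>j\<in>I. expectation (\<lambda>\<omega>. Y i \<omega> * Y j \<omega>))"
    using Ysq by (subst Bochner_Integration.integral_sum) (auto intro!: sum.cong Bochner_Integration.integral_sum)
  also have "\<dots> = (\<Sum>i\<in>I. expectation (\<lambda>\<omega>. Y i \<omega> * Y i \<omega>))"
  proof (rule sum.cong[OF refl])
    fix i assume i: "i \<in> I"
    have "(\<Sum>j\<in>I. expectation (\<lambda>\<omega>. Y i \<omega> * Y j \<omega>)) = (\<Sum>j\<in>{i}. expectation (\<lambda>\<omega>. Y i \<omega> * Y j \<omega>))"
      using I i pair[OF i _ _ Yind Yint] Y0 by (intro sum.mono_neutral_right) auto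
    then show "(\<Sum>j\<in>I. expectation (\<lambda>\<omega>. Y i \<omega> * Y j \<omega>)) = expectation (\<lambda>\<omega>. Y i \<omega> * Y i \<omega>)" by simp
  qed
  also have "\<dots> \<le> (\<Sum>i\<in>I. expectation (\<lambda>\<omega>. (X i \<omega>)\<^sup>2))"
  proof (rule sum_mono)
    fix i assume i: "i \<in> I"
    have "expectation (\<lambda>\<omega>. Y i \<omega> * Y i \<omega>) = variance (X i)" by (simp add: Y_def power2_eq_square)
    also have "\<dots> = expectation (\<lambda>\<omega>. (X i \<omega>)\<^sup>2) - (expectation (X i))\<^sup>2"
      using int i by (intro variance_eq) auto
    finally show "expectation (\<lambda>\<omega>. Y i \<omega> * Y i \<omega>) \<le> expectation (\<lambda>\<omega>. (X i \<omega>)\<^sup>2)" by simp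
  qed
  finally show "variance (\<lambda>\<omega>. \<Sum>i\<in>I. X i \<omega>) \<le> (\<Sum>i\<in>I. expectation (\<lambda>\<omega>. (X i \<omega>)\<^sup>2))" .
qed

text \<open>Let \<open>G t = exp (- N * tailq l t)\<close> with integral \<open>m\<close>.
  Monotonicity gives \<open>t * G t \<le> m\<close> and \<open>tailq_double\<close> gives
  \<open>G t \<le> (G (t / 2))\<^sup>2\<close>, so
  \<open>2 * t * G t \<le> 4 * m * G (t / 2)\<close>. The second moment of a minimum is thus
  controlled by its squared mean.\<close>

lemma nn_integral_tail_first_moment:
  assumes N: "0 < N" and l: "0 < l"
  shows "(\<integral>\<^sup>+t. ennreal (2 * t * exp (- N * tailq l t)) * indicator {0..} t \<partial>lborel)
    \<le> ennreal (8 * (f_lim (N * l) / N)\<^sup>2)"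
proof -
  define m where "m = f_lim (N * l) / N"
  have m0: "0 < m" using f_lim_ge_1[of "N * l"] N l by (auto simp: m_def)
  let ?G = "\<lambda>t. exp (- N * tailq l t)"
  have Gm: "t * ?G t \<le> m" if t: "0 \<le> t" for t
  proof -
    have "ennreal (t * ?G t) = (\<integral>\<^sup>+s. ennreal (?G t) * indicator {0..t} s \<partial>lborel)"
      using t by (subst nn_integral_cmult_indicator) (auto simp: ennreal_mult' mult.commute)
    also have "\<dots> \<le> (\<integral>\<^sup>+s. ennreal (?G s) * indicator {0..} s \<partial>lborel)"
      using tailq_mono[OF l, of _ t] N
      by (intro nn_integral_mono) (auto simp: indicator_def intro!: ennreal_leI)
    also have "\<dots> = ennreal m" using nn_integral_tail[OF N l] by (simp add: m_def)
    finally show ?thesis using m0 by (simp add: ennreal_le_iff)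
  qed
  have "(\<integral>\<^sup>+t. ennreal (2 * t * ?G t) * indicator {0..} t \<partial>lborel)
      \<le> (\<integral>\<^sup>+t. ennreal (4 * m) * (ennreal (?G (t / 2)) * indicator {0..} (t / 2)) \<partial>lborel)"
  proof (rule nn_integral_mono)
    fix t :: real
    have "2 * t * ?G t \<le> 4 * m * ?G (t / 2)" if t: "0 \<le> t"
    proof -
      have "?G t \<le> exp (- N * (2 * tailq l (t / 2)))"
        using mult_left_mono[OF tailq_double[OF l, of "t / 2"], of N] N t by simp
      also have "\<dots> = ?G (t / 2) * ?G (t / 2)" by (simp flip: exp_add)
      finally have "2 * t * ?G t \<le> 2 * t * (?G (t / 2) * ?G (t / 2))" using t by (intro mult_left_mono) auto
      also have "\<dots> = 4 * (t / 2 * ?G (t / 2)) * ?G (t / 2)" by simp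
      also have "\<dots> \<le> 4 * m * ?G (t / 2)" using Gm[of "t / 2"] t by (intro mult_right_mono) auto
      finally show ?thesis .
    qed
    then show "ennreal (2 * t * ?G t) * indicator {0..} t \<le> ennreal (4 * m) * (ennreal (?G (t / 2)) * indicator {0..} (t / 2))"
      using m0 by (auto simp: indicator_def ennreal_mult'[symmetric] intro!: ennreal_leI)
  qed
  also have "\<dots> = ennreal (4 * m) * (\<integral>\<^sup>+t. ennreal (?G (t / 2)) * indicator {0..} (t / 2) \<partial>lborel)"
    by (rule nn_integral_cmult) measurable
  also have "(\<integral>\<^sup>+t. ennreal (?G (t / 2)) * indicator {0..} (t / 2) \<partial>lborel) = ennreal (2 * m)"
  proof -
    have "(\<integral>\<^sup>+t. ennreal (?G (t / 2)) * indicator {0..} (t / 2) \<partial>lborel)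
      = ennreal \<bar>2\<bar> * (\<integral>\<^sup>+t. ennreal (?G ((0 + 2 * t) / 2)) * indicator {0..} ((0 + 2 * t) / 2) \<partial>lborel)"
      by (rule nn_integral_real_affine[where c = 2 and t = 0]) auto
    also have "\<dots> = ennreal 2 * ennreal m" using nn_integral_tail[OF N l] by (simp add: m_def)
    finally show ?thesis using m0 by (simp add: ennreal_mult)
  qed
  also have "ennreal (4 * m) * ennreal (2 * m) = ennreal (8 * m\<^sup>2)"
    using m0 by (simp add: ennreal_mult[symmetric] power2_eq_square)
  finally show ?thesis by (simp add: m_def)
qed

context arc_weights
begin

lemma min_in_measurable:
  "v \<in> {1..n} \<Longrightarrow> random_variable borel (min_in n W C l v)"
  unfolding min_in_def[abs_def]
  by (intro borel_measurable_Min borel_measurable_add borel_measurable_times measurable_const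
      W_measurable C_measurable others_arc) auto

lemma min_in_indep: "indep_vars (\<lambda>_. borel) (min_in n W C l) {1..n}"
proof -
  define K :: "nat \<Rightarrow> ((nat \<times> nat) + (nat \<times> nat)) set"
    where "K v = (\<lambda>u. Inl (u, v)) ` others n v \<union> (\<lambda>u. Inr (u, v)) ` others n v" for v
  define Y where "Y v f = Min ((\<lambda>u. f (Inl (u, v)) + l * f (Inr (u, v)) :: real) ` others n v)" for v f
  have "indep_vars (\<lambda>_. borel) (\<lambda>v \<omega>. Y v (restrict (\<lambda>i. WC i \<omega>) (K v))) {1..n}"
  proof (rule indep_vars_group[where K = K and Y = Y, OF indep])
    show "K v \<subseteq> arcs <+> arcs" if "v \<in> {1..n}" for v
      using others_arc[OF that] by (auto simp: K_def)
    show "disjoint_family_on K {1..n}"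
      by (auto simp: disjoint_family_on_def K_def)
    show "Y v \<in> borel_measurable (PiM (K v) (\<lambda>_. borel))" for v
      unfolding Y_def
      by (intro borel_measurable_Min borel_measurable_add borel_measurable_times measurable_const measurable_component_singleton)
         (auto simp: K_def)
  qed
  moreover have "Y v (restrict (\<lambda>i. WC i \<omega>) (K v)) = min_in n W C l v \<omega>" for v \<omega>
    unfolding Y_def min_in_def by (intro arg_cong[where f = Min] image_cong) (auto simp: K_def)
  ultimately show ?thesis by simp
qed

lemma prob_min_in_gt:
  assumes n: "2 \<le> n" and v: "v \<in> {1..n}" and l: "0 < l" "l \<le> 1" and t: "0 \<le> t" "t \<le> 1"
  shows "prob {\<omega>\<in>space M. t < min_in n W C l v \<omega>} = (1 - tailq l t) ^ (n - 1)"
proof -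
  define K where "K u = {Inl (u, v), Inr (u, v)}" for u :: nat
  define Q where "Q u f \<longleftrightarrow> t < f (Inl (u, v)) + l * f (Inr (u, v))"
    for u and f :: "(nat \<times> nat) + (nat \<times> nat) \<Rightarrow> real"
  have Q: "Q u (restrict (\<lambda>i. WC i \<omega>) (K u)) \<longleftrightarrow> t < W (u, v) \<omega> + l * C (u, v) \<omega>" for u \<omega>
    by (simp add: Q_def K_def)
  have "{\<omega>\<in>space M. t < min_in n W C l v \<omega>}
     = {\<omega>\<in>space M. \<forall>u\<in>others n v. Q u (restrict (\<lambda>i. WC i \<omega>) (K u))}"
    unfolding Q using others_nonempty[OF n, of v] by (auto simp: min_in_def)
  also have "prob \<dots> = (\<Prod>u\<in>others n v. prob {\<omega>\<in>space M. Q u (restrict (\<lambda>i. WC i \<omega>) (K u))})"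
  proof (rule prob_indep_group[OF indep])
    show "K u \<subseteq> arcs <+> arcs" if "u \<in> others n v" for u
      using others_arc[OF v that] by (auto simp: K_def)
    show "disjoint_family_on K (others n v)" by (auto simp: disjoint_family_on_def K_def)
    show "Measurable.pred (PiM (K u) (\<lambda>_. borel)) (Q u)" for u
      unfolding Q_def K_def by measurable
  qed (simp_all add: others_nonempty[OF n])
  also have "\<dots> = (\<Prod>u\<in>others n v. 1 - tailq l t)"
  proof (rule prod.cong[OF refl])
    fix u assume u: "u \<in> others n v"
    note e = others_arc[OF v u]
    have [measurable]: "W (u, v) \<in> borel_measurable M" "C (u, v) \<in> borel_measurable M"
      using e W_measurable C_measurable by auto
    have "prob {\<omega>\<in>space M. Q u (restrict (\<lambda>i. WC i \<omega>) (K u))}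
        = prob (space M - {\<omega>\<in>space M. W (u, v) \<omega> + l * C (u, v) \<omega> \<le> t})"
      unfolding Q by (intro arg_cong[where f = prob]) auto
    also have "\<dots> = 1 - tailq l t"
      using prob_arc_le[OF e l t] by (subst prob_compl) auto
    finally show "prob {\<omega>\<in>space M. Q u (restrict (\<lambda>i. WC i \<omega>) (K u))} = 1 - tailq l t" .
  qed
  finally show ?thesis by (simp add: card_others[OF v])
qed

lemma AE_C: "e \<in> arcs \<Longrightarrow> AE \<omega> in M. 0 \<le> C e \<omega> \<and> C e \<omega> \<le> 1"
  using arc_weights.AE_W[OF swap] .

lemma AE_arcs: "AE \<omega> in M. \<forall>e\<in>arcs. 0 \<le> W e \<omega> \<and> W e \<omega> \<le> 1 \<and> 0 \<le> C e \<omega> \<and> C e \<omega> \<le> 1"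
  using AE_W AE_C by (intro AE_finite_allI) auto

lemma AE_min_in:
  assumes n: "2 \<le> n" and v: "v \<in> {1..n}" and l: "0 \<le> l"
  shows "AE \<omega> in M. 0 \<le> min_in n W C l v \<omega> \<and> min_in n W C l v \<omega> \<le> 1 + l"
  using AE_arcs
proof eventually_elim
  fix \<omega> assume *: "\<forall>e\<in>arcs. 0 \<le> W e \<omega> \<and> W e \<omega> \<le> 1 \<and> 0 \<le> C e \<omega> \<and> C e \<omega> \<le> 1"
  obtain u where u: "u \<in> others n v" using others_nonempty[OF n, of v] by auto
  have "W (u, v) \<omega> + l * C (u, v) \<omega> \<le> 1 + l * 1"
    using * others_arc[OF v u] l by (intro add_mono mult_left_mono) auto
  moreover have "0 \<le> W (u, v) \<omega> + l * C (u, v) \<omega>" if "u \<in> others n v" for u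
    using * others_arc[OF v that] l by auto
  ultimately show "0 \<le> min_in n W C l v \<omega> \<and> min_in n W C l v \<omega> \<le> 1 + l"
    using u others_nonempty[OF n, of v] by (auto simp: min_in_def Min_le_iff)
qed

lemma min_in_integrable:
  assumes n: "2 \<le> n" and v: "v \<in> {1..n}" and l: "0 \<le> l"
  shows "integrable M (min_in n W C l v)" "integrable M (\<lambda>\<omega>. (min_in n W C l v \<omega>)\<^sup>2)"
proof -
  note [measurable] = min_in_measurable[OF v]
  show "integrable M (min_in n W C l v)"
    by (rule integrable_const_bound[where B = "1 + l"])
       (rule eventually_mono[OF AE_min_in[OF assms]], simp_all)
  show "integrable M (\<lambda>\<omega>. (min_in n W C l v \<omega>)\<^sup>2)"
    by (rule integrable_const_bound[where B = "(1 + l)\<^sup>2"])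
       (rule eventually_mono[OF AE_min_in[OF assms]], simp_all add: power_mono)
qed

text \<open>The area formula ends at \<open>t = 1\<close>. Between 1 and 2 the probability is at
  most its value \<open>(l / 2) ^ (n - 1)\<close> at 1, and beyond 2 it vanishes because the minimum
  is at most \<open>1 + l\<close> almost surely.\<close>

lemma emeasure_min_in_gt_le:
  assumes n: "2 \<le> n" and v: "v \<in> {1..n}" and l: "0 < l" "l \<le> 1" and t: "0 \<le> t"
  shows "emeasure M {\<omega>\<in>space M. t < min_in n W C l v \<omega>}
    \<le> ennreal (exp (- (real n - 1) * tailq l t)) + ennreal ((1 / 2) ^ (n - 1)) * indicator {0..2} t"
proof -
  note [measurable] = min_in_measurable[OF v]
  have n1: "real n - 1 = real (n - 1)" using n by simp
  consider "t \<le> 1" | "1 < t" "t \<le> 2" | "2 < t" by linarith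
  then show ?thesis
  proof cases
    case 1
    have q: "tailq l t \<le> 1" using tailq_le[OF l(1) t] 1 by simp
    have "(1 - tailq l t) ^ (n - 1) \<le> exp (- tailq l t) ^ (n - 1)"
      using q exp_ge_add_one_self[of "- tailq l t"] by (intro power_mono) auto
    also have "\<dots> = exp (- (real n - 1) * tailq l t)"
      unfolding n1 by (simp flip: exp_of_nat_mult)
    finally have "ennreal ((1 - tailq l t) ^ (n - 1)) \<le> ennreal (exp (- (real n - 1) * tailq l t))"
      by (rule ennreal_leI)
    then have "emeasure M {\<omega>\<in>space M. t < min_in n W C l v \<omega>} \<le> ennreal (exp (- (real n - 1) * tailq l t))"
      using prob_min_in_gt[OF n v l t 1] by (simp add: emeasure_eq_measure)
    then show ?thesis by (rule order_trans) simp
  next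
    case 2
    have q: "1 - tailq l 1 = l / 2" using l by (auto simp: tailq_def)
    have "prob {\<omega>\<in>space M. t < min_in n W C l v \<omega>} \<le> prob {\<omega>\<in>space M. 1 < min_in n W C l v \<omega>}"
      using 2 by (intro finite_measure_mono) auto
    also have "\<dots> = (l / 2) ^ (n - 1)" using prob_min_in_gt[OF n v l, of 1] q by simp
    also have "\<dots> \<le> (1 / 2) ^ (n - 1)" using l by (intro power_mono) auto
    finally have "emeasure M {\<omega>\<in>space M. t < min_in n W C l v \<omega>} \<le> ennreal ((1 / 2) ^ (n - 1)) * indicator {0..2} t"
      using 2 by (simp add: emeasure_eq_measure ennreal_leI)
    then show ?thesis by (rule order_trans) simp
  next
    case 3
    have "AE \<omega> in M. \<not> t < min_in n W C l v \<omega>"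
      by (rule eventually_mono[OF AE_min_in[OF n v, of l]]) (use l 3 in auto)
    then have "emeasure M {\<omega>\<in>space M. t < min_in n W C l v \<omega>} = 0"
      by (subst AE_iff_measurable[symmetric, where P = "\<lambda>\<omega>. \<not> t < min_in n W C l v \<omega>"]) auto
    then show ?thesis by simp
  qed
qed

lemma nn_integral_min_in:
  assumes n: "2 \<le> n" and v: "v \<in> {1..n}" and l: "0 < l"
  shows "ennreal (expectation (min_in n W C l v))
     = (\<integral>\<^sup>+t. indicator {0..} t * emeasure M {\<omega>\<in>space M. t < min_in n W C l v \<omega>} \<partial>lborel)"
proof -
  note [measurable] = min_in_measurable[OF v]
  note AE = AE_min_in[OF n v less_imp_le[OF l]]
  have "ennreal (expectation (min_in n W C l v)) = (\<integral>\<^sup>+\<omega>. ennreal (min_in n W C l v \<omega>) \<partial>M)"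
    using min_in_integrable[OF n v] AE l by (intro nn_integral_eq_integral[symmetric]) (auto elim!: eventually_mono)
  also have "\<dots> = (\<integral>\<^sup>+\<omega>. (\<integral>\<^sup>+t. 1 * indicator {0..<min_in n W C l v \<omega>} t \<partial>lborel) \<partial>M)"
    by (rule nn_integral_cong_AE) (use AE in eventually_elim, auto)
  also have "\<dots> = (\<integral>\<^sup>+t. 1 * indicator {0..} t * emeasure M {\<omega>\<in>space M. t < min_in n W C l v \<omega>} \<partial>lborel)"
    by (rule layer_cake) auto
  finally show ?thesis by simp
qed

lemma nn_integral_min_in_square:
  assumes n: "2 \<le> n" and v: "v \<in> {1..n}" and l: "0 < l"
  shows "ennreal (expectation (\<lambda>\<omega>. (min_in n W C l v \<omega>)\<^sup>2))
     = (\<integral>\<^sup>+t. ennreal (2 * t) * indicator {0..} t * emeasure M {\<omega>\<in>space M. t < min_in n W C l v \<omega>} \<partial>lborel)"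
proof -
  note [measurable] = min_in_measurable[OF v]
  note AE = AE_min_in[OF n v less_imp_le[OF l]]
  have sq: "(\<integral>\<^sup>+t. ennreal (2 * t) * indicator {0..<a} t \<partial>lborel) = ennreal (a\<^sup>2)" if "0 \<le> a" for a :: real
  proof -
    have "(\<integral>\<^sup>+t. ennreal (2 * t) * indicator {0..<a} t \<partial>lborel) = (\<integral>\<^sup>+t. ennreal (2 * t) * indicator {0..a} t \<partial>lborel)"
      using AE_lborel_singleton[of a] by (intro nn_integral_cong_AE) (auto simp: indicator_def elim!: eventually_mono)
    also have "\<dots> = ennreal (a\<^sup>2 - 0\<^sup>2)"
      using that by (intro nn_integral_FTC_Icc) (auto intro!: derivative_eq_intros)
    finally show ?thesis by simp
  qed
  have "ennreal (expectation (\<lambda>\<omega>. (min_in n W C l v \<omega>)\<^sup>2)) = (\<integral>\<^sup>+\<omega>. ennreal ((min_in n W C l v \<omega>)\<^sup>2) \<partial>M)"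
    using min_in_integrable[OF n v] l by (intro nn_integral_eq_integral[symmetric]) auto
  also have "\<dots> = (\<integral>\<^sup>+\<omega>. (\<integral>\<^sup>+t. ennreal (2 * t) * indicator {0..<min_in n W C l v \<omega>} t \<partial>lborel) \<partial>M)"
    by (rule nn_integral_cong_AE) (use AE in eventually_elim, simp add: sq)
  also have "\<dots> = (\<integral>\<^sup>+t. ennreal (2 * t) * indicator {0..} t * emeasure M {\<omega>\<in>space M. t < min_in n W C l v \<omega>} \<partial>lborel)"
    by (rule layer_cake) auto
  finally show ?thesis .
qed

lemma expectation_min_in_le:
  assumes n: "2 \<le> n" and v: "v \<in> {1..n}" and l: "0 < l" "l \<le> 1"
  shows "expectation (min_in n W C l v) \<le> f_lim ((real n - 1) * l) / (real n - 1) + 2 * (1 / 2) ^ (n - 1)"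
proof -
  have N: "0 < real n - 1" using n by simp
  have F: "0 \<le> f_lim ((real n - 1) * l) / (real n - 1)" using f_lim_ge_1[of "(real n - 1) * l"] N l by auto
  have "ennreal (expectation (min_in n W C l v))
     \<le> (\<integral>\<^sup>+t. ennreal (exp (- (real n - 1) * tailq l t)) * indicator {0..} t
         + ennreal ((1 / 2) ^ (n - 1)) * indicator {0..2} t \<partial>lborel)"
    unfolding nn_integral_min_in[OF n v l(1)]
    using emeasure_min_in_gt_le[OF n v l] by (intro nn_integral_mono) (auto simp: indicator_def)
  also have "\<dots> = ennreal (f_lim ((real n - 1) * l) / (real n - 1)) + ennreal ((1 / 2) ^ (n - 1)) * 2"
    using nn_integral_tail[OF N l(1)] by (subst nn_integral_add) (auto simp: nn_integral_cmult_indicator)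
  also have "\<dots> = ennreal (f_lim ((real n - 1) * l) / (real n - 1) + 2 * (1 / 2) ^ (n - 1))"
    using F by (simp add: ennreal_plus ennreal_mult mult.commute)
  finally show ?thesis using F by (subst (asm) ennreal_le_iff) (auto intro!: add_nonneg_nonneg)
qed

lemma expectation_min_in_square_le:
  assumes n: "2 \<le> n" and v: "v \<in> {1..n}" and l: "0 < l" "l \<le> 1"
  shows "expectation (\<lambda>\<omega>. (min_in n W C l v \<omega>)\<^sup>2)
    \<le> 8 * (f_lim ((real n - 1) * l) / (real n - 1))\<^sup>2 + 8 * (1 / 2) ^ (n - 1)"
proof -
  have N: "0 < real n - 1" using n by simp
  have "ennreal (expectation (\<lambda>\<omega>. (min_in n W C l v \<omega>)\<^sup>2))
     \<le> (\<integral>\<^sup>+t. ennreal (2 * t * exp (- (real n - 1) * tailq l t)) * indicator {0..} t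
         + ennreal (4 * (1 / 2) ^ (n - 1)) * indicator {0..2} t \<partial>lborel)"
    unfolding nn_integral_min_in_square[OF n v l(1)]
  proof (rule nn_integral_mono)
    fix t :: real
    show "ennreal (2 * t) * indicator {0..} t * emeasure M {\<omega>\<in>space M. t < min_in n W C l v \<omega>}
      \<le> ennreal (2 * t * exp (- (real n - 1) * tailq l t)) * indicator {0..} t
         + ennreal (4 * (1 / 2) ^ (n - 1)) * indicator {0..2} t"
    proof (cases "0 \<le> t")
      case True
      have "ennreal (2 * t) * emeasure M {\<omega>\<in>space M. t < min_in n W C l v \<omega>}
        \<le> ennreal (2 * t) * (ennreal (exp (- (real n - 1) * tailq l t)) + ennreal ((1 / 2) ^ (n - 1)) * indicator {0..2} t)"
        using emeasure_min_in_gt_le[OF n v l True] by (rule mult_left_mono) simp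
      also have "\<dots> = ennreal (2 * t * exp (- (real n - 1) * tailq l t)) + ennreal (2 * t * (1 / 2) ^ (n - 1)) * indicator {0..2} t"
        using True by (simp add: distrib_left ennreal_mult mult.assoc)
      also have "\<dots> \<le> ennreal (2 * t * exp (- (real n - 1) * tailq l t)) + ennreal (4 * (1 / 2) ^ (n - 1)) * indicator {0..2} t"
        by (intro add_left_mono) (auto simp: indicator_def intro!: ennreal_leI mult_right_mono)
      finally show ?thesis using True by simp
    qed simp
  qed
  also have "\<dots> = (\<integral>\<^sup>+t. ennreal (2 * t * exp (- (real n - 1) * tailq l t)) * indicator {0..} t \<partial>lborel)
      + ennreal (4 * (1 / 2) ^ (n - 1)) * 2"
    by (subst nn_integral_add) (auto simp: nn_integral_cmult_indicator)
  also have "\<dots> \<le> ennreal (8 * (f_lim ((real n - 1) * l) / (real n - 1))\<^sup>2) + ennreal (4 * (1 / 2) ^ (n - 1)) * 2"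
    by (intro add_right_mono nn_integral_tail_first_moment[OF N l(1)])
  also have "ennreal (4 * (1 / 2) ^ (n - 1)) * 2 = ennreal (8 * (1 / 2) ^ (n - 1))"
    using ennreal_mult[of "4 * (1 / 2) ^ (n - 1)" 2] by (simp add: mult.commute)
  also have "ennreal (8 * (f_lim ((real n - 1) * l) / (real n - 1))\<^sup>2) + ennreal (8 * (1 / 2) ^ (n - 1))
     = ennreal (8 * (f_lim ((real n - 1) * l) / (real n - 1))\<^sup>2 + 8 * (1 / 2) ^ (n - 1))"
    by (rule ennreal_plus[symmetric]) auto
  finally show ?thesis by (subst (asm) ennreal_le_iff) auto
qed

text \<open>Only \<open>t \<le> \<epsilon>\<close> is kept. There \<open>q = tailq l t\<close> is at
  most \<open>\<epsilon> \<le> 1 / 2\<close>, so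
  \<open>1 - q \<ge> exp (- (1 + 2 * \<epsilon>) * q)\<close>. The price is a rate \<open>N\<close>
  that exceeds \<open>n - 1\<close> by the factor \<open>1 + 2 * \<epsilon>\<close>.\<close>

lemma expectation_min_in_ge:
  assumes n: "2 \<le> n" and v: "v \<in> {1..n}" and l: "0 < l" "l \<le> 1" and e: "0 < \<epsilon>" "\<epsilon> \<le> 1 / 2"
  defines "N \<equiv> (1 + 2 * \<epsilon>) * (real n - 1)"
  shows "f_lim (N * l) / N - 2 / (N * \<epsilon>) * exp (- N * \<epsilon>\<^sup>2 / 2) \<le> expectation (min_in n W C l v)"
proof -
  have n1: "real n - 1 = real (n - 1)" using n by simp
  have N: "0 < N" using n e by (auto simp: N_def)
  have E0: "0 \<le> expectation (min_in n W C l v)"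
    using AE_min_in[OF n v, of l] l by (intro integral_nonneg_AE) (auto elim!: eventually_mono)
  have "ennreal (f_lim (N * l) / N - 2 / (N * \<epsilon>) * exp (- N * \<epsilon>\<^sup>2 / 2))
      \<le> (\<integral>\<^sup>+t. ennreal (exp (- N * tailq l t)) * indicator {0..\<epsilon>} t \<partial>lborel)"
    using e by (intro nn_integral_tail_lower[OF N l]) auto
  also have "\<dots> \<le> (\<integral>\<^sup>+t. indicator {0..} t * emeasure M {\<omega>\<in>space M. t < min_in n W C l v \<omega>} \<partial>lborel)"
  proof (rule nn_integral_mono)
    fix t :: real
    have "ennreal (exp (- N * tailq l t)) \<le> emeasure M {\<omega>\<in>space M. t < min_in n W C l v \<omega>}" if t: "0 \<le> t" "t \<le> \<epsilon>"
    proof -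
      define q where "q = tailq l t"
      have q: "0 \<le> q" "q \<le> \<epsilon>" using tailq_nonneg[OF l(1) t(1)] tailq_le[OF l(1) t(1)] t by (auto simp: q_def)
      have "q * q \<le> \<epsilon> * q" using q by (intro mult_right_mono) auto
      then have "- ((1 + 2 * \<epsilon>) * q) \<le> - q - 2 * q\<^sup>2" by (simp add: power2_eq_square algebra_simps)
      also have "\<dots> \<le> ln (1 - q)" using q e by (intro ln_one_minus_pos_lower_bound) auto
      finally have "exp (- ((1 + 2 * \<epsilon>) * q)) \<le> 1 - q" using q e by (simp add: ln_ge_iff)
      then have "exp (- ((1 + 2 * \<epsilon>) * q)) ^ (n - 1) \<le> (1 - q) ^ (n - 1)" by (intro power_mono) auto
      also have "exp (- ((1 + 2 * \<epsilon>) * q)) ^ (n - 1) = exp (- N * q)"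
        unfolding N_def n1 by (simp flip: exp_of_nat_mult add: mult_ac)
      also have "(1 - q) ^ (n - 1) = prob {\<omega>\<in>space M. t < min_in n W C l v \<omega>}"
        using prob_min_in_gt[OF n v l] t e by (simp add: q_def)
      finally show ?thesis by (simp add: emeasure_eq_measure q_def ennreal_leI)
    qed
    then show "ennreal (exp (- N * tailq l t)) * indicator {0..\<epsilon>} t
        \<le> indicator {0..} t * emeasure M {\<omega>\<in>space M. t < min_in n W C l v \<omega>}"
      by (auto simp: indicator_def)
  qed
  also have "\<dots> = ennreal (expectation (min_in n W C l v))"
    using nn_integral_min_in[OF n v l(1)] by simp
  finally show ?thesis using E0 by (subst (asm) ennreal_le_iff) auto
qed

end

section \<open>Events of large inner probability; concentration uniformly in the multiplier\<close>

text \<open>Unlike \<^const>\<open>whp\<close>, this notion does not require \<open>P\<close> to be a measurable predicate.\<close>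

definition likely :: "'a measure \<Rightarrow> real \<Rightarrow> ('a \<Rightarrow> bool) \<Rightarrow> bool" where
  "likely M d P \<longleftrightarrow> (\<exists>E\<in>sets M. 1 - d \<le> measure M E \<and> (\<forall>x\<in>E. P x))"

lemma likelyI: "{x\<in>space M. P x} \<in> sets M \<Longrightarrow> 1 - d \<le> measure M {x\<in>space M. P x} \<Longrightarrow> likely M d P"
  unfolding likely_def by (rule bexI[of _ "{x\<in>space M. P x}"]) auto

lemma likely_mono:
  assumes "likely M d P" "d \<le> d'" "\<And>x. x \<in> space M \<Longrightarrow> P x \<Longrightarrow> Q x"
  shows "likely M d' Q"
proof -
  obtain E where E: "E \<in> sets M" "1 - d \<le> measure M E" "\<forall>x\<in>E. P x"
    using assms(1) by (auto simp: likely_def)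
  then have "\<forall>x\<in>E. Q x" using assms(3) sets.sets_into_space by blast
  then show ?thesis using E assms(2) unfolding likely_def by (intro bexI[OF _ E(1)]) auto
qed

lemma (in prob_space) likely_conj:
  assumes "likely M d P" "likely M d' Q" shows "likely M (d + d') (\<lambda>x. P x \<and> Q x)"
proof -
  obtain E1 E2 where E: "E1 \<in> events" "1 - d \<le> prob E1" "\<forall>x\<in>E1. P x"
    "E2 \<in> events" "1 - d' \<le> prob E2" "\<forall>x\<in>E2. Q x"
    using assms by (auto simp: likely_def)
  have "prob (E1 \<union> E2) = prob E1 + prob (E2 - E1)"
    using E by (intro finite_measure_Union') auto
  moreover have "prob (E2 - E1) = prob E2 - prob (E1 \<inter> E2)"
    using E by (subst finite_measure_Diff') (auto simp: Int_commute)
  moreover have "prob (E1 \<union> E2) \<le> 1" by simp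
  ultimately have "1 - (d + d') \<le> prob (E1 \<inter> E2)" using E by linarith
  then show ?thesis using E unfolding likely_def by (intro bexI[of _ "E1 \<inter> E2"]) auto
qed

lemma (in prob_space) likely_AE: "AE x in M. P x \<Longrightarrow> likely M 0 P"
proof (erule AE_E)
  fix N assume N: "{x\<in>space M. \<not> P x} \<subseteq> N" "emeasure M N = 0" "N \<in> events"
  have "prob (space M - N) = 1" using prob_compl[OF N(3)] N(2) by (simp add: measure_def)
  then show ?thesis using N unfolding likely_def by (intro bexI[of _ "space M - N"]) auto
qed

text \<open>The bound on the single terms is there because the in-arcs of an arborescence miss one
  vertex, its root.\<close>

definition concentrated :: "nat \<Rightarrow> (nat \<times> nat \<Rightarrow> 'a \<Rightarrow> real) \<Rightarrow> (nat \<times> nat \<Rightarrow> 'a \<Rightarrow> real) \<Rightarrow> real \<Rightarrow> real \<Rightarrow> real \<Rightarrow> 'a \<Rightarrow> bool" where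
  "concentrated n W C l L e \<omega> \<longleftrightarrow>
     \<bar>min_tot n W C l \<omega> - L\<bar> \<le> e \<and> (\<forall>v\<in>{1..n}. min_in n W C l v \<omega> \<le> e)"

context arc_weights
begin

text \<open>The three numerical hypotheses involve \<open>n\<close> and \<open>\<delta>\<close> but
  neither \<open>l\<close> nor \<open>M\<close>, so large \<open>n\<close> gives concentration
  uniformly in the multiplier. Additive errors become relative ones since
  \<open>f_lim (n * l) \<ge> 1\<close>.\<close>

lemma min_tot_concentration:
  fixes l \<delta> :: real
  assumes n: "2 \<le> n" and l: "0 < l" "l \<le> 1" and d: "0 < \<delta>" "\<delta> \<le> 1"
    and upper: "real n / (real n - 1) + real n * (4 * (1 / 2) ^ n) \<le> 1 + \<delta> / 2"
    and lower: "1 - \<delta> / 2 \<le> 1 / (1 + \<delta> / 4) -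
        real n * (2 / ((1 + \<delta> / 4) * (real n - 1) * (\<delta> / 8)) * exp (- ((1 + \<delta> / 4) * (real n - 1)) * (\<delta> / 8)\<^sup>2 / 2))"
    and var: "5 / \<delta>\<^sup>2 * (real n * (8 / (real n - 1)\<^sup>2 + 16 * (1 / 2) ^ n)) \<le> \<delta>"
  shows "likely M \<delta> (concentrated n W C l (f_lim (n * l)) (\<delta> * f_lim (n * l)))" (is "likely M \<delta> ?P")
proof -
  define F where "F = f_lim (n * l)"
  define N where "N = real n - 1"
  define h where "h = (1 / 2 :: real) ^ n"
  define c where "c = 8 / N\<^sup>2 + 16 * h"
  have N: "0 < N" "N \<le> real n" using n by (auto simp: N_def)
  have half: "(1 / 2 :: real) ^ (n - 1) = 2 * h" using n by (cases n) (auto simp: h_def)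
  have F: "1 \<le> F" using l by (auto simp: F_def intro: f_lim_ge_1)
  have h: "0 \<le> h" by (simp add: h_def)
  have FN: "f_lim (N * l) \<le> F"
    using N l by (auto simp: F_def intro!: f_lim_mono)
  have mean_upper: "real n * expectation (min_in n W C l v) \<le> (1 + \<delta> / 2) * F" if v: "v \<in> {1..n}" for v
  proof -
    have "expectation (min_in n W C l v) \<le> f_lim (N * l) / N + 4 * h"
      using expectation_min_in_le[OF n v l, unfolded half] by (simp add: N_def)
    also have "\<dots> \<le> F / N + 4 * h * F"
      using FN N F h mult_left_mono[OF F, of h] by (intro add_mono divide_right_mono) auto
    finally have "real n * expectation (min_in n W C l v) \<le> real n * (F / N + 4 * h * F)"
      by (intro mult_left_mono) auto
    also have "\<dots> = (real n / N + real n * (4 * h)) * F" by (simp add: algebra_simps)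
    also have "\<dots> \<le> (1 + \<delta> / 2) * F" using upper F by (intro mult_right_mono) (auto simp: N_def h_def)
    finally show ?thesis .
  qed
  have mean_lower: "(1 - \<delta> / 2) * F \<le> real n * expectation (min_in n W C l v)" if v: "v \<in> {1..n}" for v
  proof -
    define r where "r = 2 / ((1 + \<delta> / 4) * N * (\<delta> / 8)) * exp (- ((1 + \<delta> / 4) * N) * (\<delta> / 8)\<^sup>2 / 2)"
    have r: "0 \<le> r" using N d by (auto simp: r_def)
    \<comment> \<open>\<open>expectation_min_in_ge\<close> with
      \<open>\<epsilon> = \<delta> / 8\<close> has the rate \<open>(1 + \<delta> / 4) * N\<close>.
      Raising the rate to \<open>K\<close> only lowers the bound, by
      \<open>f_lim_div_antimono\<close>, and then \<open>f_lim (K * l) \<ge> F\<close> because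
      \<open>K \<ge> n\<close>.\<close>
    define K where "K = (1 + \<delta> / 4) * real n"
    have K: "0 < K" "(1 + \<delta> / 4) * N \<le> K" "real n \<le> K" "0 < (1 + \<delta> / 4) * N"
      using N d n by (auto simp: K_def intro!: mult_left_mono mult_pos_pos)
    have "F / K - r \<le> f_lim (K * l) / K - r"
      using l K unfolding F_def by (intro diff_right_mono divide_right_mono f_lim_mono mult_right_mono) auto
    also have "\<dots> \<le> f_lim ((1 + \<delta> / 4) * N * l) / ((1 + \<delta> / 4) * N) - r"
      using f_lim_div_antimono[OF K(4,2) l(1)] by simp
    also have "\<dots> \<le> expectation (min_in n W C l v)"
      using expectation_min_in_ge[OF n v l, of "\<delta> / 8"] d by (simp add: r_def N_def)
    finally have "real n * (F / K - r) \<le> real n * expectation (min_in n W C l v)"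
      by (intro mult_left_mono) auto
    moreover have "real n * (F / K) = F * (1 / (1 + \<delta> / 4))" using n by (simp add: K_def)
    moreover have "real n * r \<le> F * (real n * r)" using mult_right_mono[OF F, of "real n * r"] r by simp
    ultimately have "F * (1 / (1 + \<delta> / 4) - real n * r) \<le> real n * expectation (min_in n W C l v)"
      by (simp add: algebra_simps)
    moreover have "(1 - \<delta> / 2) * F \<le> F * (1 / (1 + \<delta> / 4) - real n * r)"
      using mult_left_mono[OF lower, of F] F by (simp add: r_def N_def mult.commute)
    ultimately show ?thesis by linarith
  qed
  have second: "expectation (\<lambda>\<omega>. (min_in n W C l v \<omega>)\<^sup>2) \<le> F\<^sup>2 * c" if v: "v \<in> {1..n}" for v
  proof -
    have "expectation (\<lambda>\<omega>. (min_in n W C l v \<omega>)\<^sup>2) \<le> 8 * (f_lim (N * l) / N)\<^sup>2 + 16 * h"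
      using expectation_min_in_square_le[OF n v l, unfolded half] by (simp add: N_def)
    also have "\<dots> \<le> 8 * (F / N)\<^sup>2 + 16 * h * F\<^sup>2"
    proof (intro add_mono)
      have "0 \<le> f_lim (N * l)" using f_lim_ge_1[of "N * l"] N l by auto
      then show "8 * (f_lim (N * l) / N)\<^sup>2 \<le> 8 * (F / N)\<^sup>2"
        using FN N by (intro mult_left_mono power_mono divide_right_mono) auto
      show "16 * h \<le> 16 * h * F\<^sup>2"
        using h F mult_left_mono[of 1 "F\<^sup>2" "16 * h"] by (auto simp: one_le_power)
    qed
    also have "\<dots> = F\<^sup>2 * c" by (simp add: c_def power_divide algebra_simps)
    finally show ?thesis .
  qed
  have [measurable]: "\<And>v. v \<in> {1..n} \<Longrightarrow> random_variable borel (min_in n W C l v)"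
    by (rule min_in_measurable)
  have [measurable]: "random_variable borel (min_tot n W C l)"
    unfolding min_tot_def[abs_def] by (intro borel_measurable_sum) auto
  note int = min_in_integrable[OF n _ less_imp_le[OF l(1)]]
  note sqsum = expectation_square_sum_indep[OF finite_atLeastAtMost min_in_indep int]
  have ES: "expectation (min_tot n W C l) = (\<Sum>v\<in>{1..n}. expectation (min_in n W C l v))"
    unfolding min_tot_def[abs_def] using int by (intro Bochner_Integration.integral_sum) auto
  have sums: "(\<Sum>v\<in>{1..n}. x / real n) = x" for x :: real using n by simp
  have "expectation (min_tot n W C l) \<le> (\<Sum>v\<in>{1..n}. (1 + \<delta> / 2) * F / real n)"
    unfolding ES using mean_upper n by (intro sum_mono) (simp add: field_simps)
  moreover have "(\<Sum>v\<in>{1..n}. (1 - \<delta> / 2) * F / real n) \<le> expectation (min_tot n W C l)"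
    unfolding ES using mean_lower n by (intro sum_mono) (simp add: field_simps)
  ultimately have mean: "\<bar>expectation (min_tot n W C l) - F\<bar> \<le> \<delta> / 2 * F"
    unfolding sums by (intro abs_leI) (simp_all add: algebra_simps)
  \<comment> \<open>Chebyshev's inequality for the total, Markov's for the squared single terms.
    Both failure bounds are multiples of \<open>n * c\<close>, which has order \<open>1 / n\<close>
    because \<open>c\<close> has order \<open>1 / n\<^sup>2\<close>. First moments would not survive
    the union bound over \<open>v\<close>.\<close>
  let ?bad1 = "{\<omega>\<in>space M. \<bar>min_tot n W C l \<omega> - expectation (min_tot n W C l)\<bar> \<ge> \<delta> / 2 * F}"
  let ?bad2 = "\<lambda>v. {\<omega>\<in>space M. (min_in n W C l v \<omega>)\<^sup>2 \<ge> (\<delta> * F)\<^sup>2}"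
  have pos: "0 < \<delta> / 2 * F" "0 < (\<delta> * F)\<^sup>2" using d F by auto
  have "prob ?bad1 \<le> variance (min_tot n W C l) / (\<delta> / 2 * F)\<^sup>2"
    using sqsum(1) pos by (intro Chebyshev_inequality) (auto simp: min_tot_def)
  also have "\<dots> \<le> (\<Sum>v\<in>{1..n}. F\<^sup>2 * c) / (\<delta> / 2 * F)\<^sup>2"
  proof (rule divide_right_mono)
    have "variance (min_tot n W C l) \<le> (\<Sum>v\<in>{1..n}. expectation (\<lambda>\<omega>. (min_in n W C l v \<omega>)\<^sup>2))"
      unfolding min_tot_def[abs_def] by (rule sqsum(2))
    also have "\<dots> \<le> (\<Sum>v\<in>{1..n}. F\<^sup>2 * c)" by (intro sum_mono second)
    finally show "variance (min_tot n W C l) \<le> (\<Sum>v\<in>{1..n}. F\<^sup>2 * c)" .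
  qed simp
  also have "\<dots> = 4 / \<delta>\<^sup>2 * (real n * c)"
    using F d by (simp add: power_divide power_mult_distrib field_simps)
  finally have b1: "prob ?bad1 \<le> 4 / \<delta>\<^sup>2 * (real n * c)" .
  have "prob (\<Union>v\<in>{1..n}. ?bad2 v) \<le> (\<Sum>v\<in>{1..n}. prob (?bad2 v))"
    by (intro finite_measure_subadditive_finite) auto
  also have "\<dots> \<le> (\<Sum>v\<in>{1..n}. F\<^sup>2 * c / (\<delta> * F)\<^sup>2)"
  proof (rule sum_mono)
    fix v assume v: "v \<in> {1..n}"
    have "prob (?bad2 v) \<le> expectation (\<lambda>\<omega>. (min_in n W C l v \<omega>)\<^sup>2) / (\<delta> * F)\<^sup>2"
      using int(2)[OF v] pos by (intro integral_Markov_inequality_measure[where A = "{}"]) auto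
    also have "\<dots> \<le> F\<^sup>2 * c / (\<delta> * F)\<^sup>2" using second[OF v] by (intro divide_right_mono) auto
    finally show "prob (?bad2 v) \<le> F\<^sup>2 * c / (\<delta> * F)\<^sup>2" .
  qed
  also have "\<dots> = 1 / \<delta>\<^sup>2 * (real n * c)"
    using F d by (simp add: power_mult_distrib field_simps)
  finally have b2: "prob (\<Union>v\<in>{1..n}. ?bad2 v) \<le> 1 / \<delta>\<^sup>2 * (real n * c)" .
  have meas: "{\<omega>\<in>space M. ?P \<omega>} \<in> events" unfolding concentrated_def by measurable
  have ev: "?bad1 \<union> (\<Union>v\<in>{1..n}. ?bad2 v) \<in> events" by measurable
  have "prob (?bad1 \<union> (\<Union>v\<in>{1..n}. ?bad2 v)) \<le> prob ?bad1 + prob (\<Union>v\<in>{1..n}. ?bad2 v)"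
    by (intro measure_Un_le) auto
  also have "\<dots> \<le> 4 / \<delta>\<^sup>2 * (real n * c) + 1 / \<delta>\<^sup>2 * (real n * c)" by (intro add_mono b1 b2)
  also have "\<dots> = 5 / \<delta>\<^sup>2 * (real n * c)" by (simp add: field_simps)
  also have "\<dots> \<le> \<delta>" using var by (simp add: c_def N_def h_def)
  finally have "1 - \<delta> \<le> prob (space M - (?bad1 \<union> (\<Union>v\<in>{1..n}. ?bad2 v)))"
    using ev by (simp add: prob_compl)
  also have "\<dots> \<le> prob {\<omega>\<in>space M. ?P \<omega>}"
  proof (rule finite_measure_mono)
    show "space M - (?bad1 \<union> (\<Union>v\<in>{1..n}. ?bad2 v)) \<subseteq> {\<omega>\<in>space M. ?P \<omega>}"
    proof
      fix \<omega> assume w: "\<omega> \<in> space M - (?bad1 \<union> (\<Union>v\<in>{1..n}. ?bad2 v))"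
      then have "\<bar>min_tot n W C l \<omega> - expectation (min_tot n W C l)\<bar> < \<delta> / 2 * F" by auto
      with mean have "\<bar>min_tot n W C l \<omega> - F\<bar> \<le> \<delta> * F" by linarith
      moreover have "min_in n W C l v \<omega> \<le> \<delta> * F" if "v \<in> {1..n}" for v
      proof -
        have "\<not> (\<delta> * F)\<^sup>2 \<le> (min_in n W C l v \<omega>)\<^sup>2" using w that by blast
        moreover have "0 \<le> \<delta> * F" using d F by simp
        ultimately show ?thesis using power_mono[of "\<delta> * F" "min_in n W C l v \<omega>" 2] by linarith
      qed
      ultimately show "\<omega> \<in> {\<omega>\<in>space M. ?P \<omega>}" using w by (auto simp: F_def concentrated_def)
    qed
  qed (rule meas)
  finally show ?thesis using meas by (intro likelyI)
qed

lemma min_in_swap: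
  assumes "2 \<le> n" "0 < l" shows "min_in n W C l v \<omega> = l * min_in n C W (1 / l) v \<omega>"
proof -
  have "l * min_in n C W (1 / l) v \<omega> = Min ((\<lambda>x. l * x) ` (\<lambda>u. C (u, v) \<omega> + 1 / l * W (u, v) \<omega>) ` others n v)"
    unfolding min_in_def using assms others_nonempty[of n v]
    by (intro mono_Min_commute) (auto intro!: monoI mult_left_mono)
  also have "\<dots> = min_in n W C l v \<omega>"
    unfolding min_in_def image_image
    using assms by (intro arg_cong[where f = Min] image_cong) (auto simp: field_simps)
  finally show ?thesis by simp
qed

lemma min_tot_swap:
  assumes "2 \<le> n" "0 < l" shows "min_tot n W C l \<omega> = l * min_tot n C W (1 / l) \<omega>"
  by (simp add: min_tot_def min_in_swap[OF assms] sum_distrib_left)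

end

text \<open>The asymptotic value of \<^const>\<open>min_tot\<close>; the second case is the first one with the roles
  of weights and costs exchanged.\<close>

definition min_tot_lim :: "nat \<Rightarrow> real \<Rightarrow> real" where
  "min_tot_lim n l = (if l \<le> 1 then f_lim (n * l) else l * f_lim (n / l))"

lemma min_tot_lim_pos: "0 < l \<Longrightarrow> 0 < min_tot_lim n l"
  using f_lim_ge_1[of "n * l"] f_lim_ge_1[of "n / l"] by (auto simp: min_tot_lim_def intro: less_le_trans)

text \<open>The threshold for \<open>n\<close> precedes \<open>M\<close>, \<open>W\<close>,
  \<open>C\<close> and \<open>l\<close>, so the result applies to multipliers that vary with
  \<open>n\<close>, even across 1.\<close>

lemma eventually_concentration:
  assumes d: "0 < \<delta>" "\<delta> \<le> 1"
  shows "\<forall>\<^sub>F n in sequentially. \<forall>(M :: 'a measure) W C l. arc_weights n M W C \<longrightarrow> 0 < l \<longrightarrow>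
    likely M \<delta> (concentrated n W C l (min_tot_lim n l) (\<delta> * min_tot_lim n l))"
proof -
  have "(\<lambda>n. real n / (real n - 1) + real n * (4 * (1 / 2) ^ n)) \<longlonglongrightarrow> 1" by real_asymp
  then have e1: "\<forall>\<^sub>F n in sequentially. real n / (real n - 1) + real n * (4 * (1 / 2) ^ n) < 1 + \<delta> / 2"
    by (rule order_tendstoD) (use d in auto)
  have "(\<lambda>n. 1 / (1 + \<delta> / 4) -
        real n * (2 / ((1 + \<delta> / 4) * (real n - 1) * (\<delta> / 8)) * exp (- ((1 + \<delta> / 4) * (real n - 1)) * (\<delta> / 8)\<^sup>2 / 2)))
        \<longlonglongrightarrow> 1 / (1 + \<delta> / 4)"
  proof -
    have "(\<lambda>n. a - real n * (k / (real n - 1) * exp (- c * (real n - 1)))) \<longlonglongrightarrow> a" if "0 < c" for a k c :: real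
      using that by real_asymp
    from this[of "(1 + \<delta> / 4) * (\<delta> / 8)\<^sup>2 / 2" "1 / (1 + \<delta> / 4)" "2 / ((1 + \<delta> / 4) * (\<delta> / 8))"]
    show ?thesis using d by (simp add: mult_ac)
  qed
  then have e2: "\<forall>\<^sub>F n in sequentially. 1 - \<delta> / 2 < 1 / (1 + \<delta> / 4) -
        real n * (2 / ((1 + \<delta> / 4) * (real n - 1) * (\<delta> / 8)) * exp (- ((1 + \<delta> / 4) * (real n - 1)) * (\<delta> / 8)\<^sup>2 / 2))"
    by (rule order_tendstoD) (use d in \<open>simp add: field_simps add_pos_pos\<close>)
  have "(\<lambda>n. 5 / \<delta>\<^sup>2 * (real n * (8 / (real n - 1)\<^sup>2 + 16 * (1 / 2) ^ n))) \<longlonglongrightarrow> 0"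
    using d by real_asymp
  then have e3: "\<forall>\<^sub>F n in sequentially. 5 / \<delta>\<^sup>2 * (real n * (8 / (real n - 1)\<^sup>2 + 16 * (1 / 2) ^ n)) < \<delta>"
    by (rule order_tendstoD) (use d in auto)
  show ?thesis
    using e1 e2 e3 eventually_ge_at_top[of 2]
  proof eventually_elim
    case (elim n)
    show ?case
    proof (intro allI impI)
      fix M :: "'a measure" and W C and l :: real
      assume aw: "arc_weights n M W C" and l: "0 < l"
      have conc: "likely M \<delta> (concentrated n W C l (f_lim (n * l)) (\<delta> * f_lim (n * l)))"
        if "arc_weights n M W C" "0 < l" "l \<le> 1" for W C and l :: real
        using elim that d by (intro arc_weights.min_tot_concentration) auto
      show "likely M \<delta> (concentrated n W C l (min_tot_lim n l) (\<delta> * min_tot_lim n l))"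
      proof (cases "l \<le> 1")
        case True
        then show ?thesis using conc[OF aw l] by (simp add: min_tot_lim_def)
      next
        case False
        interpret arc_weights n M W C by fact
        let ?F = "f_lim (n * (1 / l))"
        have lim: "min_tot_lim n l = l * ?F" using False by (simp add: min_tot_lim_def)
        have "likely M \<delta> (concentrated n C W (1 / l) ?F (\<delta> * ?F))"
          using False l by (intro conc[OF swap]) auto
        then show ?thesis
        proof (rule likely_mono)
          fix \<omega>
          assume w: "concentrated n C W (1 / l) ?F (\<delta> * ?F) \<omega>"
          have "\<bar>min_tot n W C l \<omega> - min_tot_lim n l\<bar> = l * \<bar>min_tot n C W (1 / l) \<omega> - ?F\<bar>"
            using l elim min_tot_swap[OF _ l] by (simp add: lim abs_mult flip: right_diff_distrib)
          also have "\<dots> \<le> l * (\<delta> * ?F)" using w l by (intro mult_left_mono) (auto simp: concentrated_def)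
          finally have "\<bar>min_tot n W C l \<omega> - min_tot_lim n l\<bar> \<le> \<delta> * min_tot_lim n l" by (simp add: lim mult_ac)
          moreover have "min_in n W C l v \<omega> \<le> l * (\<delta> * ?F)" if "v \<in> {1..n}" for v
            using w that l elim min_in_swap[OF _ l] by (auto simp: concentrated_def intro!: mult_left_mono)
          ultimately show "concentrated n W C l (min_tot_lim n l) (\<delta> * min_tot_lim n l) \<omega>"
            by (simp add: concentrated_def lim mult_ac)
        qed simp
      qed
    qed
  qed
qed

section \<open>From inner probabilities to \<open>whp\<close> and \<open>whp_approx\<close>\<close>

definition holds_whp :: "(nat \<Rightarrow> 'a measure) \<Rightarrow> (nat \<Rightarrow> 'a \<Rightarrow> bool) \<Rightarrow> bool" where
  "holds_whp M P \<longleftrightarrow> (\<forall>\<delta>>0. \<forall>\<^sub>F n in sequentially. likely (M n) \<delta> (P n))"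

lemma holds_whp_mono:
  assumes "holds_whp M P" "\<forall>\<^sub>F n in sequentially. \<forall>x. P n x \<longrightarrow> Q n x"
  shows "holds_whp M Q"
  unfolding holds_whp_def
proof (intro allI impI)
  fix \<delta> :: real assume "0 < \<delta>"
  then have "\<forall>\<^sub>F n in sequentially. likely (M n) \<delta> (P n)"
    using assms(1) by (simp add: holds_whp_def)
  with assms(2) show "\<forall>\<^sub>F n in sequentially. likely (M n) \<delta> (Q n)"
    by eventually_elim (erule likely_mono, auto)
qed

lemma holds_whp_conj:
  assumes M: "\<forall>\<^sub>F n in sequentially. prob_space (M n)" and "holds_whp M P" "holds_whp M Q"
  shows "holds_whp M (\<lambda>n x. P n x \<and> Q n x)"
  unfolding holds_whp_def
proof (intro allI impI)
  fix \<delta> :: real assume "0 < \<delta>"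
  then have "\<forall>\<^sub>F n in sequentially. likely (M n) (\<delta> / 2) (P n)"
    "\<forall>\<^sub>F n in sequentially. likely (M n) (\<delta> / 2) (Q n)"
    using assms(2,3) half_gt_zero unfolding holds_whp_def by blast+
  with M show "\<forall>\<^sub>F n in sequentially. likely (M n) \<delta> (\<lambda>x. P n x \<and> Q n x)"
  proof eventually_elim
    case (elim n)
    then show ?case using prob_space.likely_conj[OF elim] by simp
  qed
qed

text \<open>Measurability enters here: \<open>measure\<close> is 0 on sets that are not measurable,
  so a large measurable subset alone would say nothing about \<open>whp\<close>.\<close>

lemma whpI:
  assumes M: "\<forall>\<^sub>F n in sequentially. prob_space (M n)" and P: "holds_whp M P"
    and meas: "\<forall>\<^sub>F n in sequentially. {x\<in>space (M n). P n x} \<in> sets (M n)"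
  shows "whp M P"
  unfolding whp_def
proof (rule order_tendstoI)
  fix a :: real assume "a < 1"
  then have "\<forall>\<^sub>F n in sequentially. likely (M n) ((1 - a) / 2) (P n)"
    using P by (simp add: holds_whp_def)
  with M meas show "\<forall>\<^sub>F n in sequentially. a < measure (M n) {x\<in>space (M n). P n x}"
  proof eventually_elim
    case (elim n)
    interpret prob_space "M n" by fact
    obtain E where E: "E \<in> events" "1 - (1 - a) / 2 \<le> prob E" "\<forall>x\<in>E. P n x"
      using elim by (auto simp: likely_def)
    have "prob E \<le> prob {x\<in>space (M n). P n x}"
      using E elim sets.sets_into_space[OF E(1)] by (intro finite_measure_mono) auto
    then show ?case using E \<open>a < 1\<close> by (simp add: field_simps)
  qed
next
  fix a :: real assume "1 < a"
  from M show "\<forall>\<^sub>F n in sequentially. measure (M n) {x\<in>space (M n). P n x} < a"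
  proof eventually_elim
    case (elim n)
    interpret prob_space "M n" by fact
    show ?case using \<open>1 < a\<close> prob_le_1 by (rule le_less_trans[rotated])
  qed
qed

text \<open>This trades one statement for each fixed error for a single error sequence that tends to
  0.\<close>

lemma eventually_diagonal:
  assumes "\<And>k. \<forall>\<^sub>F n in sequentially. Q k n"
  shows "\<exists>K. filterlim K at_top sequentially \<and> (\<forall>\<^sub>F n in sequentially. Q (K n :: nat) n)"
proof -
  have "\<forall>k. \<exists>N. \<forall>n\<ge>N. Q k n" using assms by (simp add: eventually_sequentially)
  then obtain N where N: "\<And>k n. N k \<le> n \<Longrightarrow> Q k n" by metis
  \<comment> \<open>\<open>K n\<close> will be the largest index up to \<open>n\<close> such that
    all thresholds up to it are at most \<open>n\<close>; the cap \<open>k \<le> n\<close> makes the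
    set finite.\<close>
  define S where "S n = {k. k \<le> n \<and> (\<forall>j\<le>k. N j \<le> n)}" for n
  define K where "K n = Max (S n)" for n
  have fin: "finite (S n)" for n by (rule finite_subset[of _ "{..n}"]) (auto simp: S_def)
  have ge: "k \<le> K n" if "max k (Max (N ` {..k})) \<le> n" for k n
  proof -
    have "N j \<le> n" if "j \<le> k" for j
      using that \<open>max k (Max (N ` {..k})) \<le> n\<close> by (auto intro: order_trans[OF Max_ge])
    then have "k \<in> S n" using that by (auto simp: S_def)
    then show ?thesis unfolding K_def using fin by (rule Max_ge[rotated])
  qed
  have "filterlim K at_top sequentially"
    unfolding filterlim_at_top using ge by (metis eventually_sequentially)
  moreover have "\<forall>\<^sub>F n in sequentially. Q (K n) n"
    using eventually_ge_at_top[of "N 0"]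
  proof eventually_elim
    case (elim n)
    then have "0 \<in> S n" by (auto simp: S_def)
    then have "K n \<in> S n" unfolding K_def using fin by (intro Max_in) auto
    then show ?case by (intro N) (auto simp: S_def)
  qed
  ultimately show ?thesis by blast
qed

text \<open>\<open>whp_approx\<close> multiplies the random quantity by
  \<open>1 - \<epsilon>\<close> and \<open>1 + \<epsilon>\<close>, whereas the hypothesis bounds it
  by multiples of \<open>B\<close>. Doubling the error converts one form into the other:
  \<open>(1 - 2 * d) * (1 + d) \<le> 1 \<le> (1 + 2 * d) * (1 - d)\<close> for
  \<open>0 < d \<le> 1 / 2\<close>.\<close>

lemma whp_approxI:
  assumes M: "\<forall>\<^sub>F n in sequentially. prob_space (M n)"
    and meas: "\<forall>\<^sub>F n in sequentially. A n \<in> borel_measurable (M n)"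
    and B: "\<forall>\<^sub>F n in sequentially. 0 < B n"
    and A: "\<And>\<delta>. 0 < \<delta> \<Longrightarrow> holds_whp M (\<lambda>n x. ereal ((1 - \<delta>) * B n) \<le> A n x \<and> A n x \<le> ereal ((1 + \<delta>) * B n))"
  shows "whp_approx M A B"
proof -
  \<comment> \<open>The shift by 2 keeps the errors at most 1/2, as the conversion requires.\<close>
  let ?d = "\<lambda>k. 1 / (real k + 2)"
  define P where "P \<epsilon> n x \<longleftrightarrow> ereal (1 - \<epsilon>) * A n x \<le> ereal (B n) \<and> ereal (B n) \<le> ereal (1 + \<epsilon>) * A n x" for \<epsilon> n x
  have "holds_whp M (P (2 * ?d k))" for k
  proof (rule holds_whp_mono[OF A[of "?d k"]])
    show "\<forall>\<^sub>F n in sequentially. \<forall>x. (ereal ((1 - ?d k) * B n) \<le> A n x \<and> A n x \<le> ereal ((1 + ?d k) * B n))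
        \<longrightarrow> P (2 * ?d k) n x"
      using B
    proof (eventually_elim, intro allI impI)
      fix n x assume B: "0 < B n" and "ereal ((1 - ?d k) * B n) \<le> A n x \<and> A n x \<le> ereal ((1 + ?d k) * B n)"
      then obtain a where a: "A n x = ereal a" "(1 - ?d k) * B n \<le> a" "a \<le> (1 + ?d k) * B n"
        by (cases "A n x") auto
      define d where "d = ?d k"
      have d: "0 < d" "d \<le> 1 / 2" by (auto simp: d_def)
      have "(1 - 2 * d) * a \<le> (1 - 2 * d) * ((1 + d) * B n)" using a d by (intro mult_left_mono) (auto simp: d_def)
      also have "\<dots> = (1 - d - 2 * d * d) * B n" by (simp add: algebra_simps)
      also have "\<dots> \<le> 1 * B n"
      proof (rule mult_right_mono)
        have "0 \<le> 2 * d * d" using d by simp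
        then show "1 - d - 2 * d * d \<le> 1" using d by linarith
      qed (use B in simp)
      finally have 1: "(1 - 2 * d) * a \<le> B n" by simp
      have "d * d \<le> 1 / 2 * d" using d by (intro mult_right_mono) auto
      then have "1 * B n \<le> (1 + d - 2 * d * d) * B n" using B d by (intro mult_right_mono) auto
      also have "\<dots> = (1 + 2 * d) * ((1 - d) * B n)" by (simp add: algebra_simps)
      also have "\<dots> \<le> (1 + 2 * d) * a" using a d by (intro mult_left_mono) (auto simp: d_def)
      finally have 2: "B n \<le> (1 + 2 * d) * a" by simp
      show "P (2 * ?d k) n x" using 1 2 by (simp add: P_def a(1) d_def)
    qed
  qed auto
  then have "\<forall>\<^sub>F n in sequentially. likely (M n) (?d k) (P (2 * ?d k) n)" for k
    by (simp add: holds_whp_def)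
  then have "\<exists>K. filterlim K at_top sequentially \<and>
      (\<forall>\<^sub>F n in sequentially. likely (M n) (?d (K n)) (P (2 * ?d (K n)) n))"
    by (rule eventually_diagonal)
  then obtain K where K: "filterlim K at_top sequentially"
    and E: "\<forall>\<^sub>F n in sequentially. likely (M n) (?d (K n)) (P (2 * ?d (K n)) n)"
    by (elim exE conjE)
  have "((\<lambda>k. ?d k) \<longlongrightarrow> 0) at_top" by real_asymp
  then have d0: "(\<lambda>n. ?d (K n)) \<longlonglongrightarrow> 0" using K by (rule filterlim_compose)
  have "holds_whp M (\<lambda>n. P (2 * ?d (K n)) n)"
    unfolding holds_whp_def
  proof (intro allI impI)
    fix \<delta> :: real assume "0 < \<delta>"
    with d0 have "\<forall>\<^sub>F n in sequentially. ?d (K n) < \<delta>" by (rule order_tendstoD)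
    with E show "\<forall>\<^sub>F n in sequentially. likely (M n) \<delta> (P (2 * ?d (K n)) n)"
      by eventually_elim (rule likely_mono, auto)
  qed
  then have "whp M (\<lambda>n. P (2 * ?d (K n)) n)"
  proof (rule whpI[OF M])
    show "\<forall>\<^sub>F n in sequentially. {x\<in>space (M n). P (2 * ?d (K n)) n x} \<in> sets (M n)"
      using meas
    proof eventually_elim
      case (elim n)
      note [measurable] = this
      show ?case unfolding P_def by measurable
    qed
  qed
  moreover have "(\<lambda>n. 2 * ?d (K n)) \<longlonglongrightarrow> 0" using tendsto_mult_right[OF d0, of 2] by simp
  ultimately show ?thesis
    unfolding whp_approx_def P_def by (intro exI[of _ "\<lambda>n. 2 * ?d (K n)"] conjI)
qed

section \<open>Measurability of the optimum and of infeasibility\<close>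

lemma finite_spanning_arborescences: "finite {A. spanning_arborescence n A}"
  by (rule finite_subset[of _ "Pow (complete_arcs n)"]) (auto simp: spanning_arborescence_def)

text \<open>The feasible set is random. An infimum over the fixed finite set of all arborescences,
  with value infinity for the infeasible ones, is visibly measurable.\<close>

lemma arb_opt_eq:
  "arb_opt n w c c0 = (INF A\<in>{A. spanning_arborescence n A}. if (\<Sum>e\<in>A. c e) \<le> c0 then ereal (\<Sum>e\<in>A. w e) else \<infinity>)"
  unfolding arb_opt_def
proof (rule antisym)
  show "(INF A\<in>feasible_arbs n c c0. ereal (\<Sum>e\<in>A. w e))
      \<le> (INF A\<in>{A. spanning_arborescence n A}. if (\<Sum>e\<in>A. c e) \<le> c0 then ereal (\<Sum>e\<in>A. w e) else \<infinity>)"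
    by (rule INF_greatest) (auto simp: feasible_arbs_def intro!: INF_lower)
  show "(INF A\<in>{A. spanning_arborescence n A}. if (\<Sum>e\<in>A. c e) \<le> c0 then ereal (\<Sum>e\<in>A. w e) else \<infinity>)
      \<le> (INF A\<in>feasible_arbs n c c0. ereal (\<Sum>e\<in>A. w e))"
  proof (rule INF_greatest)
    fix A assume "A \<in> feasible_arbs n c c0"
    then show "(INF A\<in>{A. spanning_arborescence n A}. if (\<Sum>e\<in>A. c e) \<le> c0 then ereal (\<Sum>e\<in>A. w e) else \<infinity>)
        \<le> ereal (\<Sum>e\<in>A. w e)"
      by (intro INF_lower2[of A]) (auto simp: feasible_arbs_def)
  qed
qed

context arc_weights
begin

lemma arb_sum_measurable [measurable]:
  assumes "spanning_arborescence n A"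
  shows "random_variable borel (\<lambda>x. \<Sum>e\<in>A. W e x)" "random_variable borel (\<lambda>x. \<Sum>e\<in>A. C e x)"
  using assms by (auto simp: spanning_arborescence_def intro!: borel_measurable_sum W_measurable C_measurable)

lemma arb_opt_measurable:
  "random_variable borel (\<lambda>x. arb_opt n (\<lambda>e. W e x) (\<lambda>e. C e x) c0)"
  unfolding arb_opt_eq
  using finite_spanning_arborescences[of n]
  by (intro borel_measurable_INF measurable_If) (auto intro!: countable_finite)

lemma infeasible_measurable:
  "{x\<in>space M. feasible_arbs n (\<lambda>e. C e x) c0 = {}} \<in> events"
proof -
  have "{x\<in>space M. feasible_arbs n (\<lambda>e. C e x) c0 = {}}
      = {x\<in>space M. \<forall>A\<in>{A. spanning_arborescence n A}. \<not> (\<Sum>e\<in>A. C e x) \<le> c0}"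
    by (auto simp: feasible_arbs_def)
  also have "\<dots> \<in> events"
    using finite_spanning_arborescences[of n] by (intro sets.sets_Collect_finite_All) auto
  finally show ?thesis .
qed

end

section \<open>Walks of a random mapping, its number of cycles, cheap detours\<close>

section \<open>Cycles of the greedy in-arcs\<close>

fun walk :: "('v \<Rightarrow> 'v) \<Rightarrow> 'v \<Rightarrow> 'v list \<Rightarrow> 'v \<Rightarrow> bool" where
  "walk \<phi> v [] z \<longleftrightarrow> \<phi> v = z"
| "walk \<phi> v (y # ys) z \<longleftrightarrow> \<phi> v = y \<and> walk \<phi> y ys z"

fun walk_weight :: "('v \<Rightarrow> 'v \<Rightarrow> real) \<Rightarrow> 'v \<Rightarrow> 'v list \<Rightarrow> 'v \<Rightarrow> real" where
  "walk_weight p v [] z = p v z"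
| "walk_weight p v (y # ys) z = p v y * walk_weight p y ys z"

fun walk_next :: "'v \<Rightarrow> 'v list \<Rightarrow> 'v \<Rightarrow> 'v \<Rightarrow> 'v" where
  "walk_next v [] z = (\<lambda>x. z)"
| "walk_next v (y # ys) z = (walk_next y ys z)(v := y)"

text \<open>A walk through distinct vertices prescribes one image per vertex, so for the greedy
  mapping it is an intersection of independent events.\<close>

lemma walk_iff_next:
  "distinct (v # ys) \<Longrightarrow> walk \<phi> v ys z \<longleftrightarrow> (\<forall>x\<in>set (v # ys). \<phi> x = walk_next v ys z x)"
proof (induction ys arbitrary: v)
  case (Cons y ys)
  then have "walk \<phi> y ys z \<longleftrightarrow> (\<forall>x\<in>set (y # ys). \<phi> x = walk_next y ys z x)" by simp
  moreover have "walk_next v (y # ys) z x = walk_next y ys z x" if "x \<in> set (y # ys)" for x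
    using that Cons.prems by auto
  ultimately show ?case by auto
qed simp

lemma walk_weight_eq_prod:
  "distinct (v # ys) \<Longrightarrow> walk_weight p v ys z = (\<Prod>x\<in>set (v # ys). p x (walk_next v ys z x))"
proof (induction ys arbitrary: v)
  case (Cons y ys)
  then have "walk_weight p y ys z = (\<Prod>x\<in>set (y # ys). p x (walk_next y ys z x))" by simp
  also have "\<dots> = (\<Prod>x\<in>set (y # ys). p x (walk_next v (y # ys) z x))"
    using Cons.prems by (intro prod.cong) auto
  finally show ?case using Cons.prems by (simp add: prod.insert)
qed simp

lemma walk_weight_nonneg: "(\<And>x y. 0 \<le> p x y) \<Longrightarrow> 0 \<le> walk_weight p v ys z"
  by (induction ys arbitrary: v) auto

text \<open>The rows of \<open>p\<close> are substochastic, so only the last step of a walk contributes.\<close>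

lemma sum_walk_weight_le:
  fixes p :: "'v \<Rightarrow> 'v \<Rightarrow> real"
  assumes "finite V" and p0: "\<And>x y. 0 \<le> p x y" and row: "\<And>x. x \<in> V \<Longrightarrow> (\<Sum>y\<in>V. p x y) \<le> 1"
    and c: "\<And>x y. x \<in> V \<Longrightarrow> y \<in> V \<Longrightarrow> p x y \<le> c" and "v \<in> V" "z \<in> V"
  shows "(\<Sum>ys | set ys \<subseteq> V \<and> length ys = k. walk_weight p v ys z) \<le> c"
  using \<open>v \<in> V\<close>
proof (induction k arbitrary: v)
  case 0
  have "{ys. set ys \<subseteq> V \<and> length ys = 0} = {[]}" by auto
  then show ?case using c 0 \<open>z \<in> V\<close> by simp
next
  case (Suc k)
  have c0: "0 \<le> c" using c[OF Suc.prems \<open>z \<in> V\<close>] p0[of v z] by linarith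
  have "{ys. set ys \<subseteq> V \<and> length ys = Suc k}
      = (\<lambda>(y, ys). y # ys) ` (V \<times> {ys. set ys \<subseteq> V \<and> length ys = k})"
    by (auto simp: length_Suc_conv)
  then have "(\<Sum>ys | set ys \<subseteq> V \<and> length ys = Suc k. walk_weight p v ys z)
      = (\<Sum>(y, ys)\<in>V \<times> {ys. set ys \<subseteq> V \<and> length ys = k}. p v y * walk_weight p y ys z)"
    by (simp add: sum.reindex inj_on_def case_prod_unfold)
  also have "\<dots> = (\<Sum>y\<in>V. p v y * (\<Sum>ys | set ys \<subseteq> V \<and> length ys = k. walk_weight p y ys z))"
    by (simp add: sum.cartesian_product[symmetric] sum_distrib_left)
  also have "\<dots> \<le> (\<Sum>y\<in>V. p v y * c)"
    by (intro sum_mono mult_left_mono Suc.IH p0)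
  also have "\<dots> = (\<Sum>y\<in>V. p v y) * c" by (simp add: sum_distrib_right)
  also have "\<dots> \<le> 1 * c" by (rule mult_right_mono[OF row[OF Suc.prems] c0])
  finally show ?case by simp
qed

lemma walk_funpow: "walk \<phi> v (map (\<lambda>i. (\<phi> ^^ Suc i) v) [0..<j]) ((\<phi> ^^ Suc j) v)"
proof (induction j arbitrary: v)
  case (Suc j)
  have "map (\<lambda>i. (\<phi> ^^ Suc i) v) [0..<Suc j] = \<phi> v # map (\<lambda>i. (\<phi> ^^ Suc i) (\<phi> v)) [0..<j]"
    by (simp only: upt_conv_Cons[of 0 "Suc j"] map_Suc_upt[symmetric] map_map list.map comp_def)
       (simp add: funpow_swap1)
  moreover have "(\<phi> ^^ Suc (Suc j)) v = (\<phi> ^^ Suc j) (\<phi> v)" by (simp add: funpow_swap1)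
  ultimately show ?case using Suc.IH[of "\<phi> v"] by simp
qed simp

lemma periodic_walk:
  assumes per: "v \<in> orbit \<phi> v" and V: "orbit \<phi> v \<subseteq> V"
  shows "\<exists>ys. set ys \<subseteq> V \<and> Suc (length ys) = card (orbit \<phi> v) \<and> distinct (v # ys) \<and> walk \<phi> v ys v"
proof -
  define k where "k = funpow_dist1 \<phi> v v"
  have k: "k = Suc (k - 1)" by (simp add: k_def)
  have orb: "orbit \<phi> v = (\<lambda>i. (\<phi> ^^ i) v) ` {0..<k}"
    unfolding k_def by (rule orbit_conv_funpow_dist1[OF per])
  have inj: "inj_on (\<lambda>i. (\<phi> ^^ i) v) {0..<k}"
    unfolding k_def by (rule inj_on_funpow_dist1[OF per])
  have ret: "(\<phi> ^^ k) v = v" unfolding k_def by (rule funpow_dist1_prop[OF per])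
  define ys where "ys = map (\<lambda>i. (\<phi> ^^ Suc i) v) [0..<k - 1]"
  have vys: "v # ys = map (\<lambda>i. (\<phi> ^^ i) v) [0..<k]"
    by (subst k, subst upt_conv_Cons) (simp_all add: ys_def map_Suc_upt[symmetric] comp_def del: upt_Suc)
  have "distinct (v # ys)" unfolding vys using inj by (simp add: distinct_map)
  moreover have "set (v # ys) = orbit \<phi> v" unfolding vys orb by simp
  moreover have "Suc (length ys) = card (orbit \<phi> v)"
    unfolding orb using inj k by (simp add: card_image ys_def)
  moreover have "walk \<phi> v ys v"
    using walk_funpow[of \<phi> v "k - 1"] ret k unfolding ys_def by simp
  ultimately show ?thesis using V by (intro exI[of _ ys]) auto
qed

text \<open>Breaking ties by \<open>LEAST\<close> makes \<open>pick\<close> a function of the arcs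
  into \<open>v\<close> alone, so its values at different vertices are independent.\<close>

definition pick :: "nat \<Rightarrow> (nat \<times> nat \<Rightarrow> 'a \<Rightarrow> real) \<Rightarrow> (nat \<times> nat \<Rightarrow> 'a \<Rightarrow> real) \<Rightarrow> real \<Rightarrow> nat \<Rightarrow> 'a \<Rightarrow> nat" where
  "pick n W C l v \<omega> = (LEAST u. u \<in> others n v \<and>
     (\<forall>w\<in>others n v. W (u, v) \<omega> + l * C (u, v) \<omega> \<le> W (w, v) \<omega> + l * C (w, v) \<omega>))"

lemma pick_properties:
  assumes "2 \<le> n"
  shows "pick n W C l v \<omega> \<in> others n v"
    "W (pick n W C l v \<omega>, v) \<omega> + l * C (pick n W C l v \<omega>, v) \<omega> = min_in n W C l v \<omega>"
proof -
  let ?x = "\<lambda>u. W (u, v) \<omega> + l * C (u, v) \<omega>"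
  have "Min (?x ` others n v) \<in> ?x ` others n v"
    using others_nonempty[OF assms, of v] by (intro Min_in) auto
  then obtain u where u: "u \<in> others n v" "?x u = Min (?x ` others n v)" by force
  then have "\<exists>u. u \<in> others n v \<and> (\<forall>w\<in>others n v. ?x u \<le> ?x w)" by (intro exI[of _ u]) auto
  then have *: "pick n W C l v \<omega> \<in> others n v \<and> (\<forall>w\<in>others n v. ?x (pick n W C l v \<omega>) \<le> ?x w)"
    unfolding pick_def by (rule LeastI_ex)
  then show "pick n W C l v \<omega> \<in> others n v" by blast
  show "?x (pick n W C l v \<omega>) = min_in n W C l v \<omega>"
    unfolding min_in_def using * by (intro Min_eqI[symmetric]) auto
qed

lemma min_in_le: "u \<in> others n v \<Longrightarrow> min_in n W C l v \<omega> \<le> W (u, v) \<omega> + l * C (u, v) \<omega>"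
  unfolding min_in_def by (intro Min_le) auto

lemma pick_swap:
  assumes "0 < l" shows "pick n W C l v \<omega> = pick n C W (1 / l) v \<omega>"
proof -
  have "W (u, v) \<omega> + l * C (u, v) \<omega> \<le> W (w, v) \<omega> + l * C (w, v) \<omega>
     \<longleftrightarrow> C (u, v) \<omega> + 1 / l * W (u, v) \<omega> \<le> C (w, v) \<omega> + 1 / l * W (w, v) \<omega>" for u w
  proof -
    have "C e \<omega> + 1 / l * W e \<omega> = (W e \<omega> + l * C e \<omega>) / l" for e using assms by (simp add: field_simps)
    then show ?thesis using assms by (simp only: divide_le_cancel) simp
  qed
  then show ?thesis by (simp add: pick_def)
qed

text \<open>Values up to 1/2 are reached because \<open>tailq l 1 = 1 - l / 2\<close>. This allows a
  threshold \<open>t\<close> to be chosen through its probability \<open>y\<close>.\<close>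

lemma tailq_surj:
  assumes "0 < l" "l \<le> 1" "0 \<le> y" "y \<le> 1 / 2" shows "\<exists>t. 0 \<le> t \<and> t \<le> 1 \<and> tailq l t = y"
proof (cases "2 * y \<le> l")
  case True
  have "(sqrt (2 * l * y))\<^sup>2 \<le> l\<^sup>2" using True assms by (simp add: power2_eq_square mult.assoc)
  then have "sqrt (2 * l * y) \<le> l" by (rule power2_le_imp_le) (use assms in simp)
  moreover from this have "sqrt (2 * l * y) \<le> 1" using assms by linarith
  ultimately show ?thesis using assms by (intro exI[of _ "sqrt (2 * l * y)"]) (simp add: tailq_def)
next
  case False
  then show ?thesis using assms by (intro exI[of _ "y + l / 2"]) (auto simp: tailq_def)
qed

context arc_weights
begin

lemma pick_indep: "indep_vars (\<lambda>_. count_space UNIV) (pick n W C l) {1..n}"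
proof -
  define K :: "nat \<Rightarrow> ((nat \<times> nat) + (nat \<times> nat)) set"
    where "K v = (\<lambda>u. Inl (u, v)) ` others n v \<union> (\<lambda>u. Inr (u, v)) ` others n v" for v
  define Y where "Y v f = (LEAST u. u \<in> others n v \<and>
      (\<forall>w\<in>others n v. f (Inl (u, v)) + l * f (Inr (u, v)) \<le> f (Inl (w, v)) + l * f (Inr (w, v)) :: bool))"
    for v and f :: "(nat \<times> nat) + (nat \<times> nat) \<Rightarrow> real"
  have "indep_vars (\<lambda>_. count_space UNIV) (\<lambda>v \<omega>. Y v (restrict (\<lambda>i. WC i \<omega>) (K v))) {1..n}"
  proof (rule indep_vars_group[OF indep])
    show "K v \<subseteq> arcs <+> arcs" if "v \<in> {1..n}" for v
      using others_arc[OF that] by (auto simp: K_def)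
    show "disjoint_family_on K {1..n}"
      by (auto simp: disjoint_family_on_def K_def)
    show "Y v \<in> measurable (PiM (K v) (\<lambda>_. borel)) (count_space UNIV)" for v
      unfolding Y_def
    proof (rule measurable_Least)
      fix u
      show "Measurable.pred (PiM (K v) (\<lambda>_. borel)) (\<lambda>f. u \<in> others n v \<and>
        (\<forall>w\<in>others n v. f (Inl (u, v)) + l * f (Inr (u, v)) \<le> f (Inl (w, v)) + l * f (Inr (w, v))))"
      proof (cases "u \<in> others n v")
        case True
        have m: "(\<lambda>f. f (Inl (w, v)) + l * f (Inr (w, v))) \<in> borel_measurable (PiM (K v) (\<lambda>_. borel))"
          if "w \<in> others n v" for w
          using that by (intro borel_measurable_add borel_measurable_times measurable_const measurable_component_singleton)
            (auto simp: K_def)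
        have "Measurable.pred (PiM (K v) (\<lambda>_. borel))
          (\<lambda>f. \<forall>w\<in>others n v. f (Inl (u, v)) + l * f (Inr (u, v)) \<le> f (Inl (w, v)) + l * f (Inr (w, v)))"
        proof (intro pred_intros_finite)
          fix w assume w: "w \<in> others n v"
          show "Measurable.pred (PiM (K v) (\<lambda>_. borel))
            (\<lambda>f. f (Inl (u, v)) + l * f (Inr (u, v)) \<le> f (Inl (w, v)) + l * f (Inr (w, v)))"
            unfolding pred_def by (rule borel_measurable_le[OF m[OF True] m[OF w]])
        qed simp
        then show ?thesis using True by simp
      qed simp
    qed
  qed
  moreover have "Y v (restrict (\<lambda>i. WC i \<omega>) (K v)) = pick n W C l v \<omega>" for v \<omega>
    unfolding Y_def pick_def by (rule arg_cong[where f = Least]) (auto simp: K_def fun_eq_iff)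
  ultimately show ?thesis by simp
qed

lemma pick_measurable [measurable]: "v \<in> {1..n} \<Longrightarrow> pick n W C l v \<in> measurable M (count_space UNIV)"
  using pick_indep by (auto simp: indep_vars_def)

text \<open>If \<open>u\<close> is picked, then either the arc \<open>(u, v)\<close> has value at
  most \<open>t\<close>, or every arc into \<open>v\<close> exceeds \<open>t\<close>. Symmetry would
  give \<open>1 / (n - 1)\<close>; this cruder bound loses only a logarithmic factor and spares an
  argument about ties and exchangeability.\<close>

lemma prob_pick_le_aux:
  assumes n: "2 \<le> n" and v: "v \<in> {1..n}" and u: "u \<in> others n v" and l: "0 < l" "l \<le> 1"
    and y: "0 \<le> y" "y \<le> 1 / 2"
  shows "prob {\<omega>\<in>space M. pick n W C l v \<omega> = u} \<le> y + exp (- y * (real n - 1))"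
proof -
  obtain t where t: "0 \<le> t" "t \<le> 1" "tailq l t = y" using tailq_surj[OF l y] by blast
  note e = others_arc[OF v u]
  note [measurable] = W_measurable[OF e] C_measurable[OF e] min_in_measurable[OF v]
  let ?A = "{\<omega>\<in>space M. W (u, v) \<omega> + l * C (u, v) \<omega> \<le> t}"
  let ?B = "{\<omega>\<in>space M. t < min_in n W C l v \<omega>}"
  have "prob {\<omega>\<in>space M. pick n W C l v \<omega> = u} \<le> prob (?A \<union> ?B)"
  proof (rule finite_measure_mono)
    show "{\<omega>\<in>space M. pick n W C l v \<omega> = u} \<subseteq> ?A \<union> ?B"
      using pick_properties(2)[OF n, where W = W and C = C and l = l and v = v] by (auto simp: not_less)
  qed measurable
  also have "\<dots> \<le> prob ?A + prob ?B" by (intro measure_Un_le) measurable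
  also have "prob ?A = y" using prob_arc_le[OF e l t(1,2)] t by simp
  also have "prob ?B = (1 - y) ^ (n - 1)" using prob_min_in_gt[OF n v l t(1,2)] t by simp
  also have "(1 - y) ^ (n - 1) \<le> exp (- y) ^ (n - 1)"
    using y exp_ge_add_one_self[of "- y"] by (intro power_mono) auto
  also have "exp (- y) ^ (n - 1) = exp (- y * (real n - 1))"
    using n by (simp flip: exp_of_nat_mult add: mult.commute)
  finally show ?thesis by simp
qed

lemma prob_pick_le:
  assumes n: "2 \<le> n" and v: "v \<in> {1..n}" and l: "0 < l" and y: "0 \<le> y" "y \<le> 1 / 2"
  shows "prob {\<omega>\<in>space M. pick n W C l v \<omega> = u} \<le> y + exp (- y * (real n - 1))"
proof (cases "u \<in> others n v")
  case True
  show ?thesis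
  proof (cases "l \<le> 1")
    case True
    then show ?thesis using prob_pick_le_aux[OF n v \<open>u \<in> others n v\<close> l _ y] by simp
  next
    case False
    then show ?thesis
      using arc_weights.prob_pick_le_aux[OF swap n v True _ _ y, of "1 / l"] l by (simp add: pick_swap[OF l])
  qed
next
  case False
  then have "{\<omega>\<in>space M. pick n W C l v \<omega> = u} = {}"
    using pick_properties(1)[OF n, of W C l v] by auto
  then have "prob {\<omega>\<in>space M. pick n W C l v \<omega> = u} = 0" by (simp only: measure_empty)
  then show ?thesis using y by (simp add: add_nonneg_nonneg)
qed

text \<open>Counting each vertex of a cycle of length \<open>k\<close> with weight
  \<open>1 / k\<close> turns the uniform bound \<open>n * c\<close> for every length into a harmonic
  sum. Markov's inequality then applies.\<close>

lemma prob_many_cycles: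
  assumes n: "2 \<le> n" and l: "0 < l" and y: "0 \<le> y" "y \<le> 1 / 2" and K: "0 < K"
  defines "c \<equiv> y + exp (- y * (real n - 1))"
  shows "likely M (real n * c * harm n / K) (\<lambda>\<omega>. cycle_count n (\<lambda>v. pick n W C l v \<omega>) \<le> K)"
proof -
  define \<phi> where "\<phi> \<omega> v = pick n W C l v \<omega>" for \<omega> v
  define p where "p v u = prob {\<omega>\<in>space M. \<phi> \<omega> v = u}" for v u
  define Ys where "Ys k = {ys. set ys \<subseteq> {1..n} \<and> length ys = k}" for k
  define cyc where "cyc v ys = {\<omega>\<in>space M. distinct (v # ys) \<and> walk (\<phi> \<omega>) v ys v}" for v ys
  have finYs: "finite (Ys k)" for k unfolding Ys_def by (rule finite_lists_length_eq) simp
  have phiV: "\<phi> \<omega> v \<in> {1..n}" for v \<omega>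
    using pick_properties(1)[OF n, of W C l v \<omega>] by (auto simp: \<phi>_def others_def)
  have p0: "0 \<le> p v u" for v u by (simp add: p_def)
  have row: "(\<Sum>u\<in>{1..n}. p v u) \<le> 1" if v: "v \<in> {1..n}" for v
  proof -
    note [measurable] = pick_measurable[OF v]
    have "(\<Sum>u\<in>{1..n}. p v u) = prob (\<Union>u\<in>{1..n}. {\<omega>\<in>space M. \<phi> \<omega> v = u})"
      unfolding p_def \<phi>_def
      by (intro finite_measure_finite_Union[symmetric]) (auto simp: disjoint_family_on_def)
    then show ?thesis by simp
  qed
  have pc: "p v u \<le> c" if v: "v \<in> {1..n}" for v u
    using prob_pick_le[OF n v l y] by (simp add: p_def \<phi>_def c_def)
  have cycp: "cyc v ys \<in> events \<and> prob (cyc v ys) \<le> walk_weight p v ys v"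
    if v: "v \<in> {1..n}" and ys: "ys \<in> Ys k" for v ys k
  proof (cases "distinct (v # ys)")
    case True
    let ?s = "walk_next v ys v" and ?L = "set (v # ys)"
    have L: "?L \<subseteq> {1..n}" using v ys by (auto simp: Ys_def)
    have eq: "cyc v ys = (\<Inter>x\<in>?L. (\<lambda>\<omega>. \<phi> \<omega> x) -` {?s x} \<inter> space M)"
      unfolding cyc_def walk_iff_next[OF True] using True by auto
    have "prob (\<Inter>x\<in>?L. (pick n W C l x) -` {?s x} \<inter> space M)
        = (\<Prod>x\<in>?L. prob ((pick n W C l x) -` {?s x} \<inter> space M))"
      using L by (intro indep_varsD[OF pick_indep]) auto
    then have "prob (cyc v ys) = (\<Prod>x\<in>?L. prob ((\<lambda>\<omega>. \<phi> \<omega> x) -` {?s x} \<inter> space M))"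
      unfolding eq by (simp add: \<phi>_def[abs_def])
    also have "\<dots> = walk_weight p v ys v"
      unfolding walk_weight_eq_prod[OF True] p_def
      by (intro prod.cong arg_cong[where f = prob]) auto
    finally have 1: "prob (cyc v ys) = walk_weight p v ys v" .
    have "(\<lambda>\<omega>. \<phi> \<omega> x) -` {?s x} \<inter> space M \<in> events" if "x \<in> ?L" for x
      using measurable_sets[OF pick_measurable, of x "{?s x}"] that L by (auto simp: \<phi>_def)
    then have "cyc v ys \<in> events" unfolding eq by (intro sets.finite_INT) auto
    with 1 show ?thesis by simp
  next
    case False
    then have "cyc v ys = {}" unfolding cyc_def by blast
    then show ?thesis using walk_weight_nonneg[OF p0] by simp
  qed
  \<comment> \<open>\<open>Z\<close> dominates \<open>cycle_count\<close>: a vertex on a cycle of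
    length \<open>k\<close> is witnessed by the list of the other \<open>k - 1\<close> vertices in
    cyclic order.\<close>
  define Z where "Z \<omega> = (\<Sum>v\<in>{1..n}. \<Sum>k\<in>{1..n}. \<Sum>ys\<in>Ys (k - 1). 1 / real k * indicator (cyc v ys) \<omega>)" for \<omega>
  have int: "integrable M (\<lambda>\<omega>. 1 / real k * indicator (cyc v ys) \<omega>)" if "v \<in> {1..n}" "ys \<in> Ys j" for v ys k j
    using cycp[OF that] by (intro integrable_mult_right integrable_real_indicator) (auto simp: emeasure_eq_measure)
  have Zint: "integrable M Z"
    unfolding Z_def using int by (intro Bochner_Integration.integrable_sum) auto
  have Z0: "0 \<le> Z \<omega>" for \<omega> unfolding Z_def by (intro sum_nonneg) auto
  have "expectation Z = (\<Sum>v\<in>{1..n}. \<Sum>k\<in>{1..n}. \<Sum>ys\<in>Ys (k - 1). expectation (\<lambda>\<omega>. 1 / real k * indicator (cyc v ys) \<omega>))"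
    unfolding Z_def using int
    by (subst Bochner_Integration.integral_sum; intro Bochner_Integration.integrable_sum sum.cong refl)+ auto
  also have "\<dots> = (\<Sum>v\<in>{1..n}. \<Sum>k\<in>{1..n}. 1 / real k * (\<Sum>ys\<in>Ys (k - 1). prob (cyc v ys)))"
    using cycp by (intro sum.cong refl) (auto simp: sum_distrib_left intro!: sum.cong)
  also have "\<dots> \<le> (\<Sum>v\<in>{1..n}. \<Sum>k\<in>{1..n}. 1 / real k * c)"
  proof (intro sum_mono mult_left_mono)
    fix v k assume v: "v \<in> {1..n}"
    have "(\<Sum>ys\<in>Ys (k - 1). prob (cyc v ys)) \<le> (\<Sum>ys\<in>Ys (k - 1). walk_weight p v ys v)"
      using cycp[OF v] by (intro sum_mono) auto
    also have "\<dots> \<le> c"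
      unfolding Ys_def using p0 row pc v by (intro sum_walk_weight_le) auto
    finally show "(\<Sum>ys\<in>Ys (k - 1). prob (cyc v ys)) \<le> c" .
  qed auto
  also have "\<dots> = real n * c * harm n"
  proof -
    have "(\<Sum>k\<in>{1..n}. 1 / real k * c) = c * harm n"
      unfolding harm_def sum_distrib_left by (intro sum.cong) (simp_all add: inverse_eq_divide)
    then show ?thesis by simp
  qed
  finally have EZ: "expectation Z \<le> real n * c * harm n" .
  have [measurable]: "Z \<in> borel_measurable M" using Zint by auto
  have "prob {\<omega>\<in>space M. K \<le> Z \<omega>} \<le> expectation Z / K"
    using Zint Z0 K by (intro integral_Markov_inequality_measure[where A = "{}"]) auto
  also have "\<dots> \<le> real n * c * harm n / K" using EZ K by (intro divide_right_mono) auto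
  finally have "1 - real n * c * harm n / K \<le> prob (space M - {\<omega>\<in>space M. K \<le> Z \<omega>})"
    by (subst prob_compl) auto
  moreover have "cycle_count n (\<phi> \<omega>) \<le> Z \<omega>" if w: "\<omega> \<in> space M" for \<omega>
  proof -
    have "1 / real (card (orbit (\<phi> \<omega>) v)) \<le> (\<Sum>k\<in>{1..n}. \<Sum>ys\<in>Ys (k - 1). 1 / real k * indicator (cyc v ys) \<omega>)"
      if v: "v \<in> {1..n}" and per: "v \<in> orbit (\<phi> \<omega>) v" for v
    proof -
      have orbV: "orbit (\<phi> \<omega>) v \<subseteq> {1..n}"
      proof
        fix x assume "x \<in> orbit (\<phi> \<omega>) v"
        then show "x \<in> {1..n}" by (rule orbit.cases) (simp_all only: phiV)
      qed
      let ?k = "card (orbit (\<phi> \<omega>) v)"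
      obtain ys where ys: "set ys \<subseteq> {1..n}" "Suc (length ys) = ?k" "distinct (v # ys)" "walk (\<phi> \<omega>) v ys v"
        using periodic_walk[OF per orbV] by blast
      have kn: "?k \<in> {1..n}" using ys(2) card_mono[OF finite_atLeastAtMost orbV] by auto
      have ysY: "ys \<in> Ys (?k - 1)" using ys by (auto simp: Ys_def)
      have "1 / real ?k = 1 / real ?k * indicator (cyc v ys) \<omega>"
        using ys w by (simp add: cyc_def)
      also have "\<dots> \<le> (\<Sum>ys\<in>Ys (?k - 1). 1 / real ?k * indicator (cyc v ys) \<omega>)"
        using ysY finYs by (intro member_le_sum) auto
      also have "\<dots> \<le> (\<Sum>k\<in>{1..n}. \<Sum>ys\<in>Ys (k - 1). 1 / real k * indicator (cyc v ys) \<omega>)"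
        using kn by (intro member_le_sum[where f = "\<lambda>k. \<Sum>ys\<in>Ys (k - 1). 1 / real k * indicator (cyc v ys) \<omega>"] sum_nonneg) auto
      finally show ?thesis .
    qed
    then have "cycle_count n (\<phi> \<omega>)
      \<le> (\<Sum>v\<in>{v\<in>{1..n}. v \<in> orbit (\<phi> \<omega>) v}. \<Sum>k\<in>{1..n}. \<Sum>ys\<in>Ys (k - 1). 1 / real k * indicator (cyc v ys) \<omega>)"
      unfolding cycle_count_def by (intro sum_mono) auto
    also have "\<dots> \<le> Z \<omega>"
      unfolding Z_def by (intro sum_mono2 sum_nonneg) auto
    finally show ?thesis .
  qed
  ultimately show ?thesis unfolding likely_def
    by (intro bexI[of _ "space M - {\<omega>\<in>space M. K \<le> Z \<omega>}"]) (force simp: \<phi>_def[abs_def])+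
qed

text \<open>For fixed \<open>v\<close> the \<open>n - 2\<close> possible middle vertices involve
  disjoint sets of four variables, so the detours fail independently, each with probability
  \<open>1 - a ^ 4\<close>. Detours to different \<open>v\<close> share the arcs
  \<open>(r, u)\<close>, hence the union bound over \<open>v\<close>.\<close>

lemma prob_cheap_detours:
  assumes r: "r \<in> {1..n}" and n: "3 \<le> n" and a: "0 \<le> a" "a \<le> 1"
  shows "likely M (real n * (1 - a ^ 4) ^ (n - 2)) (\<lambda>\<omega>. \<forall>v\<in>{1..n} - {r}.
     \<exists>u\<in>{1..n} - {r, v}. W (r, u) \<omega> \<le> a \<and> C (r, u) \<omega> \<le> a \<and> W (u, v) \<omega> \<le> a \<and> C (u, v) \<omega> \<le> a)"
proof -
  define K where "K v u = {Inl (r, u), Inr (r, u), Inl (u, v), Inr (u, v)}" for u v :: nat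
  define Q where "Q v u f \<longleftrightarrow> \<not> (\<forall>s\<in>K v u. f s \<le> a)" for v u and f :: "(nat \<times> nat) + (nat \<times> nat) \<Rightarrow> real"
  let ?R = "\<lambda>v u \<omega>. restrict (\<lambda>i. WC i \<omega>) (K v u)"
  let ?bad = "\<lambda>v. {\<omega>\<in>space M. \<forall>u\<in>{1..n} - {r, v}. Q v u (?R v u \<omega>)}"
  have arcsK: "K v u \<subseteq> arcs <+> arcs" if "v \<in> {1..n} - {r}" "u \<in> {1..n} - {r, v}" for u v
    using that r by (auto simp: K_def complete_arcs_def)
  have Qm: "Measurable.pred (PiM (K v u) (\<lambda>_. borel)) (Q v u)" for u v
    unfolding Q_def by (intro pred_intros_logic pred_intros_finite) (auto simp: K_def)
  have meas: "Measurable.pred M (\<lambda>\<omega>. Q v u (?R v u \<omega>))" if "v \<in> {1..n} - {r}" "u \<in> {1..n} - {r, v}" for u v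
  proof (rule measurable_compose[OF _ Qm])
    show "(\<lambda>\<omega>. ?R v u \<omega>) \<in> measurable M (PiM (K v u) (\<lambda>_. borel))"
      using arcsK[OF that] WC_measurable by (intro measurable_restrict) auto
  qed
  have badm: "?bad v \<in> events" if "v \<in> {1..n} - {r}" for v
    using meas[OF that] by measurable
  have bad: "prob (?bad v) = (1 - a ^ 4) ^ (n - 2)" if v: "v \<in> {1..n} - {r}" for v
  proof -
    have ne: "{1..n} - {r, v} \<noteq> {}"
    proof
      assume "{1..n} - {r, v} = {}"
      then have "card {1..n} \<le> card {r, v}" by (intro card_mono) auto
      also have "card {r, v} \<le> 2" by (simp add: card_insert_if)
      finally show False using n by simp
    qed
    have "prob (?bad v) = (\<Prod>u\<in>{1..n} - {r, v}. prob {\<omega>\<in>space M. Q v u (?R v u \<omega>)})"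
    proof (rule prob_indep_group[OF indep])
      show "disjoint_family_on (K v) ({1..n} - {r, v})" by (auto simp: disjoint_family_on_def K_def)
    qed (use arcsK[OF v] Qm ne in \<open>simp_all\<close>)
    also have "\<dots> = (\<Prod>u\<in>{1..n} - {r, v}. 1 - a ^ 4)"
    proof (rule prod.cong[OF refl])
      fix u assume u: "u \<in> {1..n} - {r, v}"
      have card: "card (K v u) = 4" using u v by (auto simp: K_def)
      have fin: "finite (K v u)" "K v u \<noteq> {}" by (auto simp: K_def)
      have "prob (\<Inter>s\<in>K v u. WC s -` {..a} \<inter> space M) = (\<Prod>s\<in>K v u. prob (WC s -` {..a} \<inter> space M))"
        using fin arcsK[OF v u] by (intro indep_varsD[OF indep]) auto
      also have "\<dots> = (\<Prod>s\<in>K v u. a)"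
      proof (rule prod.cong[OF refl])
        fix s assume s: "s \<in> K v u"
        have "prob {\<omega>\<in>space M. WC s \<omega> \<le> a} = a"
        proof (cases s)
          case (Inl e)
          then show ?thesis using prob_W_le[of e a] a arcsK[OF v u] s by auto
        next
          case (Inr e)
          then show ?thesis using arc_weights.prob_W_le[OF swap, of e a] a arcsK[OF v u] s by auto
        qed
        moreover have "WC s -` {..a} \<inter> space M = {\<omega>\<in>space M. WC s \<omega> \<le> a}" by auto
        ultimately show "prob (WC s -` {..a} \<inter> space M) = a" by simp
      qed
      also have "\<dots> = a ^ 4" using card by simp
      finally have good: "prob (\<Inter>s\<in>K v u. WC s -` {..a} \<inter> space M) = a ^ 4" .
      have "{\<omega>\<in>space M. Q v u (?R v u \<omega>)} = space M - (\<Inter>s\<in>K v u. WC s -` {..a} \<inter> space M)"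
        using fin by (auto simp: Q_def)
      moreover have "(\<Inter>s\<in>K v u. WC s -` {..a} \<inter> space M) \<in> events"
        using fin arcsK[OF v u] WC_measurable by (intro sets.finite_INT measurable_sets) auto
      ultimately show "prob {\<omega>\<in>space M. Q v u (?R v u \<omega>)} = 1 - a ^ 4"
        using good by (simp add: prob_compl)
    qed
    also have "\<dots> = (1 - a ^ 4) ^ (n - 2)" using v r by (simp add: card_Diff_subset numeral_2_eq_2)
    finally show ?thesis .
  qed
  let ?B = "\<Union>v\<in>{1..n} - {r}. ?bad v"
  have a4: "a ^ 4 \<le> 1" using a by (simp add: power_le_one)
  have "prob ?B \<le> (\<Sum>v\<in>{1..n} - {r}. prob (?bad v))"
    by (rule finite_measure_subadditive_finite[OF _ image_subsetI[OF badm]]) simp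
  also have "\<dots> = real (card ({1..n} - {r})) * (1 - a ^ 4) ^ (n - 2)" using bad by simp
  also have "\<dots> \<le> real n * (1 - a ^ 4) ^ (n - 2)"
    using a4 r by (intro mult_right_mono) auto
  finally have "1 - real n * (1 - a ^ 4) ^ (n - 2) \<le> prob (space M - ?B)"
    using badm by (subst prob_compl) (auto intro!: sets.finite_UN)
  moreover have "space M - ?B \<in> events" using badm by (intro sets.Diff sets.finite_UN) auto
  moreover have "\<forall>v\<in>{1..n} - {r}. \<exists>u\<in>{1..n} - {r, v}.
      W (r, u) \<omega> \<le> a \<and> C (r, u) \<omega> \<le> a \<and> W (u, v) \<omega> \<le> a \<and> C (u, v) \<omega> \<le> a" if "\<omega> \<in> space M - ?B" for \<omega>
  proof
    fix v assume v: "v \<in> {1..n} - {r}"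
    with that obtain u where u: "u \<in> {1..n} - {r, v}" "\<not> Q v u (?R v u \<omega>)" by blast
    then have "W (r, u) \<omega> \<le> a \<and> C (r, u) \<omega> \<le> a \<and> W (u, v) \<omega> \<le> a \<and> C (u, v) \<omega> \<le> a"
      by (auto simp: Q_def K_def)
    with u show "\<exists>u\<in>{1..n} - {r, v}. W (r, u) \<omega> \<le> a \<and> C (r, u) \<omega> \<le> a \<and> W (u, v) \<omega> \<le> a \<and> C (u, v) \<omega> \<le> a"
      by blast
  qed
  ultimately show ?thesis unfolding likely_def by blast
qed

end

section \<open>Relaxed lower bound and the repaired greedy mapping\<close>

section \<open>Bounds for the optimum\<close>

lemma harm_le_ln: "1 \<le> n \<Longrightarrow> harm n \<le> 1 + ln (real n)"
proof (induction n rule: nat_induct_at_least)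
  case base
  show ?case by (simp add: harm_def)
next
  case (Suc n)
  have "ln (1 - 1 / real (Suc n)) \<le> - (1 / real (Suc n))"
    using ln_le_minus_one[of "1 - 1 / real (Suc n)"] Suc.hyps by simp
  moreover have "1 - 1 / real (Suc n) = real n / real (Suc n)" by (simp add: field_simps)
  ultimately have "1 / real (Suc n) \<le> ln (real (Suc n)) - ln (real n)"
    using Suc.hyps by (simp add: ln_div)
  then show ?case using Suc.IH by (simp add: harm_Suc inverse_eq_divide)
qed

lemma sum_subset_three_images_le:
  fixes w :: "'e \<Rightarrow> real"
  assumes A: "A \<subseteq> f ` V \<union> g ` B \<union> h ` B" and fin: "finite V" "finite B"
    and w: "\<And>e. e \<in> f ` V \<union> g ` B \<union> h ` B \<Longrightarrow> 0 \<le> w e"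
    and a: "\<And>v. v \<in> B \<Longrightarrow> w (g v) \<le> a" "\<And>v. v \<in> B \<Longrightarrow> w (h v) \<le> a"
  shows "sum w A \<le> (\<Sum>v\<in>V. w (f v)) + 2 * a * card B"
proof -
  have "sum w A \<le> sum w (f ` V \<union> g ` B \<union> h ` B)"
    using A fin w by (intro sum_mono2) auto
  also have "\<dots> \<le> sum w (f ` V) + sum w (g ` B) + sum w (h ` B)"
  proof -
    have "sum w (f ` V \<union> g ` B \<union> h ` B) \<le> sum w (f ` V \<union> g ` B) + sum w (h ` B)"
      using fin w by (subst sum.union_inter[symmetric]) (auto intro!: sum_nonneg)
    moreover have "sum w (f ` V \<union> g ` B) \<le> sum w (f ` V) + sum w (g ` B)"
      using fin w by (subst sum.union_inter[symmetric]) (auto intro!: sum_nonneg)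
    ultimately show ?thesis by linarith
  qed
  also have "\<dots> \<le> (\<Sum>v\<in>V. w (f v)) + (\<Sum>v\<in>B. w (g v)) + (\<Sum>v\<in>B. w (h v))"
    using fin w by (intro add_mono order_trans[OF sum_image_le]) auto
  also have "\<dots> \<le> (\<Sum>v\<in>V. w (f v)) + (\<Sum>v\<in>B. a) + (\<Sum>v\<in>B. a)"
    using a by (intro add_mono sum_mono) auto
  finally show ?thesis by simp
qed

text \<open>In-arcs of distinct vertices are distinct, so their sum is a part of the sum over
  \<open>A\<close>; only the root may lack one. Weights and costs are arbitrary nonnegative numbers,
  which later permits weight zero.\<close>

lemma arborescence_ge_min_in:
  assumes A: "spanning_arborescence n A" and l: "0 \<le> l"
    and nonneg: "\<And>e. e \<in> complete_arcs n \<Longrightarrow> 0 \<le> W e \<omega> \<and> 0 \<le> C e \<omega>"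
  shows "\<exists>r\<in>{1..n}. min_tot n W C l \<omega> - min_in n W C l r \<omega> \<le> (\<Sum>e\<in>A. W e \<omega>) + l * (\<Sum>e\<in>A. C e \<omega>)"
proof -
  obtain r where r: "r \<in> {1..n}" "directed_away A r"
    and tree: "oriented_spanning_tree {1..n} A" and arcs: "A \<subseteq> complete_arcs n"
    using A by (auto simp: spanning_arborescence_def)
  have "\<forall>v\<in>{1..n} - {r}. \<exists>u. (u, v) \<in> A"
    using arborescence_in_arc[OF tree r(2,1)] by blast
  then obtain g where g: "\<And>v. v \<in> {1..n} - {r} \<Longrightarrow> (g v, v) \<in> A" by metis
  let ?x = "\<lambda>e. W e \<omega> + l * C e \<omega>"
  have finA: "finite A" using arcs finite_subset[OF _ finite_complete_arcs] by blast
  have "min_tot n W C l \<omega> - min_in n W C l r \<omega> = (\<Sum>v\<in>{1..n} - {r}. min_in n W C l v \<omega>)"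
    using r(1) by (simp add: min_tot_def sum_diff1)
  also have "\<dots> \<le> (\<Sum>v\<in>{1..n} - {r}. ?x (g v, v))"
  proof (rule sum_mono)
    fix v assume v: "v \<in> {1..n} - {r}"
    have "(g v, v) \<in> complete_arcs n" using g[OF v] arcs by blast
    then show "min_in n W C l v \<omega> \<le> ?x (g v, v)"
      by (intro min_in_le) (auto simp: others_def complete_arcs_def)
  qed
  also have "\<dots> = sum ?x ((\<lambda>v. (g v, v)) ` ({1..n} - {r}))"
    by (subst sum.reindex) (auto simp: inj_on_def)
  also have "\<dots> \<le> sum ?x A"
  proof (rule sum_mono2[OF finA])
    show "(\<lambda>v. (g v, v)) ` ({1..n} - {r}) \<subseteq> A" using g by blast
    show "0 \<le> ?x e" if "e \<in> A - (\<lambda>v. (g v, v)) ` ({1..n} - {r})" for e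
      using nonneg[of e] arcs that l by (intro add_nonneg_nonneg mult_nonneg_nonneg) auto
  qed
  also have "\<dots> = (\<Sum>e\<in>A. W e \<omega>) + l * (\<Sum>e\<in>A. C e \<omega>)"
    by (simp add: sum.distrib sum_distrib_left)
  finally show ?thesis using r(1) by blast
qed

text \<open>Here \<open>a\<close> and \<open>b\<close> are the total weight and cost of the greedy mapping.\<close>

definition greedy_arb :: "nat \<Rightarrow> (nat \<times> nat \<Rightarrow> 'a \<Rightarrow> real) \<Rightarrow> (nat \<times> nat \<Rightarrow> 'a \<Rightarrow> real) \<Rightarrow> real \<Rightarrow> real \<Rightarrow> 'a \<Rightarrow> bool" where
  "greedy_arb n W C l d \<omega> \<longleftrightarrow> (\<exists>A a b. spanning_arborescence n A \<and>
      (\<Sum>e\<in>A. W e \<omega>) \<le> a + d \<and> (\<Sum>e\<in>A. C e \<omega>) \<le> b + d \<and>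
      a + l * b = min_tot n W C l \<omega> \<and> (\<forall>l'. min_tot n W C l' \<omega> \<le> a + l' * b))"

text \<open>Each of at most \<open>K\<close> cycles costs two arcs of weight and cost at most
  \<open>a\<close>, so the repair adds at most \<open>2 * a * K\<close> to either sum. The greedy
  mapping for \<open>l\<close> also competes for every other multiplier \<open>l'\<close>, which
  gives the last clause of \<open>greedy_arb\<close>.\<close>

lemma (in arc_weights) greedy_arborescence:
  assumes n: "3 \<le> n" and l: "0 < l" and y: "0 \<le> y" "y \<le> 1 / 2" and K: "0 < K" and a: "0 \<le> a" "a \<le> 1"
    and d1: "real n * (y + exp (- y * (real n - 1))) * harm n / K \<le> \<delta> / 2"
    and d2: "real n * (1 - a ^ 4) ^ (n - 2) \<le> \<delta> / 2" and d3: "2 * a * K \<le> \<delta>"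
  shows "likely M \<delta> (greedy_arb n W C l \<delta>)"
proof -
  have n2: "2 \<le> n" using n by simp
  have r: "1 \<in> {1..n}" using n by simp
  show ?thesis
  proof (rule likely_mono[OF likely_conj[OF likely_conj[OF prob_many_cycles[OF n2 l y K]
        prob_cheap_detours[OF r n a]] likely_AE[OF AE_arcs]]], goal_cases)
    case 1
    show ?case using d1 d2 by linarith
  next
    case (2 \<omega>)
    then have cycles: "cycle_count n (\<lambda>v. pick n W C l v \<omega>) \<le> K"
      and detours: "\<forall>v\<in>{1..n} - {1}. \<exists>u\<in>{1..n} - {1, v}.
         W (1, u) \<omega> \<le> a \<and> C (1, u) \<omega> \<le> a \<and> W (u, v) \<omega> \<le> a \<and> C (u, v) \<omega> \<le> a"
      and range: "\<And>e. e \<in> arcs \<Longrightarrow> 0 \<le> W e \<omega> \<and> W e \<omega> \<le> 1 \<and> 0 \<le> C e \<omega> \<and> C e \<omega> \<le> 1"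
      by blast+
    define \<phi> where "\<phi> v = pick n W C l v \<omega>" for v
    have phi: "\<phi> v \<in> others n v" for v
      using pick_properties(1)[OF n2] by (simp add: \<phi>_def)
    obtain u where u: "\<And>v. v \<in> {1..n} - {1} \<Longrightarrow> u v \<in> {1..n} - {1, v} \<and>
        W (1, u v) \<omega> \<le> a \<and> C (1, u v) \<omega> \<le> a \<and> W (u v, v) \<omega> \<le> a \<and> C (u v, v) \<omega> \<le> a"
      using bchoice[OF detours[unfolded Bex_def]] by blast
    have "\<exists>A B. spanning_arborescence n A \<and> B \<subseteq> {1..n} - {1} \<and>
       real (card B) \<le> cycle_count n \<phi> \<and>
       A \<subseteq> (\<lambda>v. (\<phi> v, v)) ` {1..n} \<union> (\<lambda>v. (u v, v)) ` B \<union> (\<lambda>v. (1, u v)) ` B"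
    proof (rule spanning_arborescence_of_mapping[OF r])
      show "\<phi> v \<in> {1..n}" for v using phi[of v] by (simp add: others_def)
      show "u v \<in> {1..n} - {1}" if "v \<in> {1..n} - {1}" for v using u[OF that] by blast
    qed
    then obtain A B where A: "spanning_arborescence n A" and B: "B \<subseteq> {1..n} - {1}"
      "real (card B) \<le> cycle_count n \<phi>"
      and AB: "A \<subseteq> (\<lambda>v. (\<phi> v, v)) ` {1..n} \<union> (\<lambda>v. (u v, v)) ` B \<union> (\<lambda>v. (1, u v)) ` B"
      by blast
    have finB: "finite B" using B(1) finite_subset by blast
    have "real (card B) \<le> K" using B(2) cycles by (simp add: \<phi>_def[abs_def])
    then have cB: "2 * a * card B \<le> \<delta>" using d3 a mult_left_mono[of "real (card B)" K "2 * a"] by linarith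
    have in_arcs: "(\<lambda>v. (\<phi> v, v)) ` {1..n} \<union> (\<lambda>v. (u v, v)) ` B \<union> (\<lambda>v. (1, u v)) ` B \<subseteq> arcs"
    proof -
      have "(\<phi> v, v) \<in> arcs" if "v \<in> {1..n}" for v using others_arc[OF that phi] .
      moreover have "(u v, v) \<in> arcs \<and> (1, u v) \<in> arcs" if "v \<in> B" for v
      proof -
        have v: "v \<in> {1..n} - {1}" using that B(1) by blast
        show ?thesis using u[OF v] v r by (auto simp: complete_arcs_def)
      qed
      ultimately show ?thesis by blast
    qed
    have uB: "W (1, u v) \<omega> \<le> a" "C (1, u v) \<omega> \<le> a" "W (u v, v) \<omega> \<le> a" "C (u v, v) \<omega> \<le> a" if "v \<in> B" for v
      using u[of v] that B(1) by blast+
    define wt where "wt = (\<Sum>v\<in>{1..n}. W (\<phi> v, v) \<omega>)"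
    define ct where "ct = (\<Sum>v\<in>{1..n}. C (\<phi> v, v) \<omega>)"
    have "(\<Sum>e\<in>A. W e \<omega>) \<le> wt + 2 * a * card B"
      unfolding wt_def
      by (rule sum_subset_three_images_le[OF AB]) (use finB in_arcs range uB in auto)
    moreover have "(\<Sum>e\<in>A. C e \<omega>) \<le> ct + 2 * a * card B"
      unfolding ct_def
      by (rule sum_subset_three_images_le[OF AB]) (use finB in_arcs range uB in auto)
    moreover have "wt + l * ct = min_tot n W C l \<omega>"
      unfolding wt_def ct_def min_tot_def sum_distrib_left sum.distrib[symmetric]
      using pick_properties(2)[OF n2] by (intro sum.cong refl) (simp add: \<phi>_def)
    moreover have "min_tot n W C l' \<omega> \<le> wt + l' * ct" for l'
      unfolding wt_def ct_def min_tot_def sum_distrib_left sum.distrib[symmetric]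
      by (intro sum_mono min_in_le phi)
    ultimately show ?case
      unfolding greedy_arb_def using A cB by (intro exI[of _ A] exI[of _ wt] exI[of _ ct]) auto
  qed
qed

lemma eventually_arborescence:
  assumes d: "0 < \<delta>"
  shows "\<forall>\<^sub>F n in sequentially. \<forall>(M :: 'a measure) W C l. arc_weights n M W C \<longrightarrow> 0 < l \<longrightarrow>
    likely M \<delta> (greedy_arb n W C l \<delta>)"
proof -
  \<comment> \<open>With \<open>y = 2 ln n / n\<close> the term \<open>exp (- y (n - 1))\<close> has
    order \<open>1 / n\<^sup>2\<close>, so the expected number of cycles is at most of order
    \<open>(ln n)\<^sup>2\<close>, far below \<open>K\<close>. For
    \<open>a = n powr (- 1 / 5)\<close> the product \<open>n * a ^ 4\<close> is still a positive
    power of \<open>n\<close>, which beats the union bound, while \<open>a * K\<close> tends to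
    0.\<close>
  define y where "y n = 2 * ln (real n) / real n" for n :: nat
  define K where "K n = real n powr (1 / 10)" for n :: nat
  define a where "a n = real n powr (- 1 / 5)" for n :: nat
  have "(\<lambda>n. real n * (2 * ln (real n) / real n + exp (- (2 * ln (real n) / real n) * (real n - 1))) * (1 + ln (real n)) / real n powr (1 / 10)) \<longlonglongrightarrow> 0"
    by real_asymp
  then have e1: "\<forall>\<^sub>F n in sequentially. real n * (y n + exp (- y n * (real n - 1))) * (1 + ln (real n)) / K n < \<delta> / 2"
    unfolding y_def K_def by (rule order_tendstoD) (use d in simp)
  have "(\<lambda>n. real n * exp (- ((real n powr (- 1 / 5)) ^ 4) * (real n - 2))) \<longlonglongrightarrow> 0"
    by real_asymp
  then have e2: "\<forall>\<^sub>F n in sequentially. real n * exp (- (a n ^ 4) * (real n - 2)) < \<delta> / 2"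
    unfolding a_def by (rule order_tendstoD) (use d in simp)
  have "(\<lambda>n. 2 * real n powr (- 1 / 5) * real n powr (1 / 10)) \<longlonglongrightarrow> 0"
    by real_asymp
  then have e3: "\<forall>\<^sub>F n in sequentially. 2 * a n * K n < \<delta>"
    unfolding a_def K_def by (rule order_tendstoD) (use d in simp)
  have "(\<lambda>n. 2 * ln (real n) / real n) \<longlonglongrightarrow> 0" by real_asymp
  then have e4: "\<forall>\<^sub>F n in sequentially. y n < 1 / 2"
    unfolding y_def by (rule order_tendstoD) simp
  show ?thesis
    using e1 e2 e3 e4 eventually_ge_at_top[of 3]
  proof eventually_elim
    case (elim n)
    have y0: "0 \<le> y n" and K0: "0 < K n" and a: "0 \<le> a n" "a n \<le> 1"
      using elim powr_mono[of "- 1 / 5" 0 "real n"] by (auto simp: y_def K_def a_def)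
    have d1: "real n * (y n + exp (- y n * (real n - 1))) * harm n / K n \<le> \<delta> / 2"
    proof -
      have "real n * (y n + exp (- y n * (real n - 1))) * harm n / K n
          \<le> real n * (y n + exp (- y n * (real n - 1))) * (1 + ln (real n)) / K n"
        using elim y0 K0 by (intro divide_right_mono mult_left_mono harm_le_ln mult_nonneg_nonneg add_nonneg_nonneg) auto
      then show ?thesis using elim by linarith
    qed
    have d2: "real n * (1 - a n ^ 4) ^ (n - 2) \<le> \<delta> / 2"
    proof -
      have "(1 - a n ^ 4) ^ (n - 2) \<le> exp (- (a n ^ 4)) ^ (n - 2)"
        using a exp_ge_add_one_self[of "- (a n ^ 4)"] by (intro power_mono) (auto simp: power_le_one)
      also have "\<dots> = exp (- (a n ^ 4) * (real n - 2))"
        using elim by (simp flip: exp_of_nat_mult add: mult.commute of_nat_diff)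
      finally have "real n * (1 - a n ^ 4) ^ (n - 2) \<le> real n * exp (- (a n ^ 4) * (real n - 2))"
        by (intro mult_left_mono) auto
      then show ?thesis using elim by linarith
    qed
    show ?case
    proof (intro allI impI)
      fix M :: "'a measure" and W C and l :: real
      assume "arc_weights n M W C" and l: "0 < l"
      then interpret arc_weights n M W C by simp
      show "likely M \<delta> (greedy_arb n W C l \<delta>)"
        using elim by (intro greedy_arborescence[OF _ l y0 _ K0 a d1 d2]) auto
    qed
  qed
qed

section \<open>Sequences of weighted digraphs\<close>

locale arc_weights_seq =
  fixes M :: "nat \<Rightarrow> 'a measure" and W C :: "nat \<Rightarrow> nat \<times> nat \<Rightarrow> 'a \<Rightarrow> real"
  assumes arc_weights: "\<And>n. 1 \<le> n \<Longrightarrow> arc_weights n (M n) (W n) (C n)"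
begin

lemma eventually_prob_space: "\<forall>\<^sub>F n in sequentially. prob_space (M n)"
  using eventually_ge_at_top[of 1]
proof eventually_elim
  case (elim n)
  then interpret arc_weights n "M n" "W n" "C n" by (rule arc_weights)
  show ?case by (rule prob_space_axioms)
qed

lemmas holds_whp_both = holds_whp_conj[OF eventually_prob_space]

lemma holds_whp_range:
  "holds_whp M (\<lambda>n x. \<forall>e\<in>complete_arcs n. 0 \<le> W n e x \<and> W n e x \<le> 1 \<and> 0 \<le> C n e x \<and> C n e x \<le> 1)"
  unfolding holds_whp_def
proof (intro allI impI)
  fix \<delta> :: real assume d: "0 < \<delta>"
  show "\<forall>\<^sub>F n in sequentially. likely (M n) \<delta>
      (\<lambda>x. \<forall>e\<in>complete_arcs n. 0 \<le> W n e x \<and> W n e x \<le> 1 \<and> 0 \<le> C n e x \<and> C n e x \<le> 1)"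
    using eventually_ge_at_top[of 1]
  proof eventually_elim
    case (elim n)
    then interpret arc_weights n "M n" "W n" "C n" by (rule arc_weights)
    show ?case by (rule likely_mono[OF likely_AE[OF AE_arcs]]) (use d in auto)
  qed
qed

lemma holds_whp_concentration:
  assumes d: "0 < \<delta>" and l: "\<forall>\<^sub>F n in sequentially. 0 < l n"
  shows "holds_whp M (\<lambda>n. concentrated n (W n) (C n) (l n) (min_tot_lim n (l n)) (\<delta> * min_tot_lim n (l n)))"
  unfolding holds_whp_def
proof (intro allI impI)
  fix \<eta> :: real assume e: "0 < \<eta>"
  \<comment> \<open>In the uniform result the error and the failure bound coincide, so one value
    below both is used.\<close>
  define m where "m = min (min \<delta> \<eta>) 1"
  have m: "0 < m" "m \<le> 1" "m \<le> \<delta>" "m \<le> \<eta>" using d e by (auto simp: m_def)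
  show "\<forall>\<^sub>F n in sequentially. likely (M n) \<eta>
      (concentrated n (W n) (C n) (l n) (min_tot_lim n (l n)) (\<delta> * min_tot_lim n (l n)))"
    using eventually_concentration[OF m(1,2), where 'a = 'a] l eventually_ge_at_top[of 1]
  proof eventually_elim
    case (elim n)
    have le: "m * min_tot_lim n (l n) \<le> \<delta> * min_tot_lim n (l n)"
      using min_tot_lim_pos[of "l n" n] elim m by (intro mult_right_mono) auto
    show ?case
    proof (rule likely_mono[OF elim(1)[rule_format, OF arc_weights[OF elim(3)] elim(2)] m(4)])
      fix x assume "concentrated n (W n) (C n) (l n) (min_tot_lim n (l n)) (m * min_tot_lim n (l n)) x"
      then show "concentrated n (W n) (C n) (l n) (min_tot_lim n (l n)) (\<delta> * min_tot_lim n (l n)) x"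
        using order_trans[OF _ le] unfolding concentrated_def by blast
    qed
  qed
qed

lemma holds_whp_arborescence:
  assumes d: "0 < \<delta>" and l: "\<forall>\<^sub>F n in sequentially. 0 < l n"
  shows "holds_whp M (\<lambda>n. greedy_arb n (W n) (C n) (l n) \<delta>)"
  unfolding holds_whp_def
proof (intro allI impI)
  fix \<eta> :: real assume e: "0 < \<eta>"
  define m where "m = min \<delta> \<eta>"
  have m: "0 < m" "m \<le> \<delta>" "m \<le> \<eta>" using d e by (auto simp: m_def)
  show "\<forall>\<^sub>F n in sequentially. likely (M n) \<eta> (greedy_arb n (W n) (C n) (l n) \<delta>)"
    using eventually_arborescence[OF m(1), where 'a = 'a] l eventually_ge_at_top[of 1]
  proof eventually_elim
    case (elim n)
    show ?case
    proof (rule likely_mono[OF elim(1)[rule_format, OF arc_weights[OF elim(3)] elim(2)] m(3)])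
      fix x assume "greedy_arb n (W n) (C n) (l n) m x"
      moreover have "y \<le> z + m \<Longrightarrow> y \<le> z + \<delta>" for y z using m(2) by linarith
      ultimately show "greedy_arb n (W n) (C n) (l n) \<delta> x" unfolding greedy_arb_def by meson
    qed
  qed
qed

end

section \<open>Lagrangian duality for scaled multipliers\<close>

definition secant :: "(real \<Rightarrow> real) \<Rightarrow> real \<Rightarrow> real \<Rightarrow> real" where
  "secant h a b = (h b - h a) / (b - a)"

text \<open>In all regimes \<^term>\<open>min_tot n W C (l n * \<theta>)\<close> is asymptotic to \<open>s n * h \<theta>\<close> for a scale
  \<open>l\<close> of the Lagrange multiplier and a scale \<open>s\<close> of the weight.\<close>

locale scaled_weights = arc_weights_seq M W C for M :: "nat \<Rightarrow> 'a measure" and W C +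
  fixes l s :: "nat \<Rightarrow> real" and h :: "real \<Rightarrow> real" and c :: real
  assumes l_pos: "\<forall>\<^sub>F n in sequentially. 0 < l n" and c: "0 < c"
    and s_ge: "\<forall>\<^sub>F n in sequentially. c \<le> s n" "\<forall>\<^sub>F n in sequentially. c * l n \<le> s n"
    and lim: "\<And>\<theta>. 0 < \<theta> \<Longrightarrow> (\<lambda>n. min_tot_lim n (l n * \<theta>) / s n) \<longlonglongrightarrow> h \<theta>"
begin

text \<open>A relative error becomes an additive one in units of \<open>s n\<close>, the form in
  which the values at different multipliers can be subtracted.\<close>

lemma holds_whp_scaled:
  assumes t: "0 < \<theta>" and d: "0 < \<delta>"
  shows "holds_whp M (\<lambda>n. concentrated n (W n) (C n) (l n * \<theta>) (s n * h \<theta>) (\<delta> * s n))"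
proof -
  define H where "H = \<bar>h \<theta>\<bar> + 1"
  define \<eta> where "\<eta> = min 1 (\<delta> / (2 * H))"
  have H: "1 \<le> H" by (simp add: H_def)
  have eta: "0 < \<eta>" "\<eta> * H \<le> \<delta> / 2"
    using d H by (auto simp: \<eta>_def min_def field_simps)
  have lt: "\<forall>\<^sub>F n in sequentially. 0 < l n * \<theta>" using l_pos t by (auto elim!: eventually_mono)
  have e1: "\<forall>\<^sub>F n in sequentially. \<bar>min_tot_lim n (l n * \<theta>) / s n - h \<theta>\<bar> < min 1 (\<delta> / 2)"
    using tendstoD[OF lim[OF t], of "min 1 (\<delta> / 2)"] d by (simp add: dist_real_def)
  show ?thesis
  proof (rule holds_whp_mono[OF holds_whp_concentration[OF eta(1) lt]])
    show "\<forall>\<^sub>F n in sequentially. \<forall>x.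
      concentrated n (W n) (C n) (l n * \<theta>) (min_tot_lim n (l n * \<theta>)) (\<eta> * min_tot_lim n (l n * \<theta>)) x \<longrightarrow>
      concentrated n (W n) (C n) (l n * \<theta>) (s n * h \<theta>) (\<delta> * s n) x"
      using e1 s_ge(1)
    proof (eventually_elim, intro allI impI)
      fix n x
      define L where "L = min_tot_lim n (l n * \<theta>)"
      assume e1: "\<bar>min_tot_lim n (l n * \<theta>) / s n - h \<theta>\<bar> < min 1 (\<delta> / 2)" and "c \<le> s n"
        and "concentrated n (W n) (C n) (l n * \<theta>) (min_tot_lim n (l n * \<theta>)) (\<eta> * min_tot_lim n (l n * \<theta>)) x"
      then have x: "\<bar>min_tot n (W n) (C n) (l n * \<theta>) x - L\<bar> \<le> \<eta> * L"
          "\<And>v. v \<in> {1..n} \<Longrightarrow> min_in n (W n) (C n) (l n * \<theta>) v x \<le> \<eta> * L"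
        unfolding concentrated_def L_def by blast+
      have s: "0 < s n" using \<open>c \<le> s n\<close> c by linarith
      have "L / s n \<le> H" using e1 by (auto simp: L_def H_def)
      then have "L \<le> H * s n" using s by (simp add: field_simps)
      then have "\<eta> * L \<le> \<eta> * H * s n" using eta by (simp add: mult.assoc)
      also have "\<dots> \<le> \<delta> / 2 * s n" using eta s by (intro mult_right_mono) auto
      finally have 1: "\<eta> * L \<le> \<delta> / 2 * s n" .
      have "L - s n * h \<theta> = (L / s n - h \<theta>) * s n" using s by (simp add: field_simps)
      then have "\<bar>L - s n * h \<theta>\<bar> = \<bar>L / s n - h \<theta>\<bar> * s n" using s by (simp add: abs_mult)
      also have "\<dots> \<le> \<delta> / 2 * s n" using e1 s by (intro mult_right_mono) (auto simp: L_def)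
      finally have 2: "\<bar>L - s n * h \<theta>\<bar> \<le> \<delta> / 2 * s n" .
      have 3: "\<delta> * s n = \<delta> / 2 * s n + \<delta> / 2 * s n" "0 \<le> \<delta> / 2 * s n" using d s by auto
      have "\<bar>min_tot n (W n) (C n) (l n * \<theta>) x - s n * h \<theta>\<bar> \<le> \<delta> * s n"
        using x(1) 1 2 3(1) by linarith
      moreover have "min_in n (W n) (C n) (l n * \<theta>) v x \<le> \<delta> * s n" if "v \<in> {1..n}" for v
        using x(2)[OF that] 1 3 by linarith
      ultimately show "concentrated n (W n) (C n) (l n * \<theta>) (s n * h \<theta>) (\<delta> * s n) x"
        unfolding concentrated_def by blast
    qed
  qed
qed

lemma holds_whp_lower:
  assumes t: "0 < \<theta>" and d: "0 < \<delta>"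
  shows "holds_whp M (\<lambda>n x. \<forall>A. spanning_arborescence n A \<longrightarrow>
     s n * (h \<theta> - \<delta>) \<le> (\<Sum>e\<in>A. W n e x) + l n * \<theta> * (\<Sum>e\<in>A. C n e x))"
proof (rule holds_whp_mono[OF holds_whp_both[OF holds_whp_range holds_whp_scaled[OF t half_gt_zero[OF d]]]])
  show "\<forall>\<^sub>F n in sequentially. \<forall>x.
    (\<forall>e\<in>complete_arcs n. 0 \<le> W n e x \<and> W n e x \<le> 1 \<and> 0 \<le> C n e x \<and> C n e x \<le> 1) \<and>
    concentrated n (W n) (C n) (l n * \<theta>) (s n * h \<theta>) (\<delta> / 2 * s n) x \<longrightarrow>
    (\<forall>A. spanning_arborescence n A \<longrightarrow>
     s n * (h \<theta> - \<delta>) \<le> (\<Sum>e\<in>A. W n e x) + l n * \<theta> * (\<Sum>e\<in>A. C n e x))"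
    using l_pos
  proof (eventually_elim, intro impI allI, elim conjE)
    fix n x A
    assume l: "0 < l n" and A: "spanning_arborescence n A"
      and range: "\<forall>e\<in>complete_arcs n. 0 \<le> W n e x \<and> W n e x \<le> 1 \<and> 0 \<le> C n e x \<and> C n e x \<le> 1"
      and "concentrated n (W n) (C n) (l n * \<theta>) (s n * h \<theta>) (\<delta> / 2 * s n) x"
    then have tot: "\<bar>min_tot n (W n) (C n) (l n * \<theta>) x - s n * h \<theta>\<bar> \<le> \<delta> / 2 * s n"
      and mx: "\<forall>v\<in>{1..n}. min_in n (W n) (C n) (l n * \<theta>) v x \<le> \<delta> / 2 * s n"
      by (auto simp: concentrated_def)
    obtain r where r: "r \<in> {1..n}" and le: "min_tot n (W n) (C n) (l n * \<theta>) x - min_in n (W n) (C n) (l n * \<theta>) r x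
        \<le> (\<Sum>e\<in>A. W n e x) + l n * \<theta> * (\<Sum>e\<in>A. C n e x)"
      using arborescence_ge_min_in[OF A, of "l n * \<theta>" "W n" x "C n"] range l t by auto
    have "s n * (h \<theta> - \<delta>) = s n * h \<theta> - \<delta> / 2 * s n - \<delta> / 2 * s n" by (simp add: algebra_simps)
    moreover have "min_in n (W n) (C n) (l n * \<theta>) r x \<le> \<delta> / 2 * s n" using mx r by blast
    ultimately show "s n * (h \<theta> - \<delta>) \<le> (\<Sum>e\<in>A. W n e x) + l n * \<theta> * (\<Sum>e\<in>A. C n e x)"
      using le tot by linarith
  qed
qed

text \<open>The minimum over mappings is concave in the multiplier, with the total cost of an optimal
  mapping as a supergradient; hence difference quotients control cost and weight separately.\<close>

lemma holds_whp_upper: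
  assumes t: "0 < \<theta>1" "\<theta>1 < \<theta>2" "\<theta>2 < \<theta>3" and d: "0 < \<delta>"
  shows "holds_whp M (\<lambda>n x. \<exists>A. spanning_arborescence n A \<and>
     (\<Sum>e\<in>A. C n e x) \<le> s n / l n * (secant h \<theta>1 \<theta>2 + \<delta>) \<and>
     (\<Sum>e\<in>A. W n e x) \<le> s n * (h \<theta>2 - \<theta>2 * secant h \<theta>2 \<theta>3 + \<delta>))"
proof -
  \<comment> \<open>Subtracting two optima doubles the error and divides it by a gap between
    multipliers; the resulting errors in cost and in weight both have to stay below
    \<open>\<delta> / 2\<close>.\<close>
  define \<eta> where "\<eta> = min (\<delta> * (\<theta>2 - \<theta>1) / 4) (\<delta> / (2 * (1 + 2 * \<theta>2 / (\<theta>3 - \<theta>2))))"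
  have q: "0 < 1 + 2 * \<theta>2 / (\<theta>3 - \<theta>2)" using t by (intro add_pos_nonneg) auto
  have eta: "0 < \<eta>" using t d q by (auto simp: \<eta>_def)
  have "\<eta> \<le> \<delta> * (\<theta>2 - \<theta>1) / 4" unfolding \<eta>_def by (rule min.cobounded1)
  then have eta1: "2 * \<eta> / (\<theta>2 - \<theta>1) \<le> \<delta> / 2" using t by (simp add: field_simps)
  have "\<eta> \<le> \<delta> / (2 * (1 + 2 * \<theta>2 / (\<theta>3 - \<theta>2)))" unfolding \<eta>_def by (rule min.cobounded2)
  moreover have "x \<le> \<delta> / (2 * y) \<Longrightarrow> 0 < y \<Longrightarrow> x * y \<le> \<delta> / 2" for x y :: real by (simp add: field_simps)
  ultimately have eta2: "\<eta> * (1 + 2 * \<theta>2 / (\<theta>3 - \<theta>2)) \<le> \<delta> / 2" using q by blast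
  \<comment> \<open>The repair error is a constant. Since \<open>c \<le> s n\<close> and
    \<open>c * l n \<le> s n\<close>, it is at most \<open>\<delta> / 2\<close> in the unit
    \<open>s n\<close> of weight and in the unit \<open>s n / l n\<close> of cost.\<close>
  have dc: "0 < \<delta> * c / 2" using d c by simp
  have lt: "\<forall>\<^sub>F n in sequentially. 0 < l n * \<theta>2" using l_pos t by (auto elim!: eventually_mono)
  have t2: "0 < \<theta>2" "0 < \<theta>3" using t by auto
  note whp = holds_whp_both[OF holds_whp_both[OF holds_whp_scaled[OF t(1) eta] holds_whp_scaled[OF t2(1) eta]]
     holds_whp_both[OF holds_whp_scaled[OF t2(2) eta] holds_whp_arborescence[OF dc lt]]]
  show ?thesis
  proof (rule holds_whp_mono[OF whp])
    show "\<forall>\<^sub>F n in sequentially. \<forall>x.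
      (concentrated n (W n) (C n) (l n * \<theta>1) (s n * h \<theta>1) (\<eta> * s n) x \<and>
       concentrated n (W n) (C n) (l n * \<theta>2) (s n * h \<theta>2) (\<eta> * s n) x) \<and>
      concentrated n (W n) (C n) (l n * \<theta>3) (s n * h \<theta>3) (\<eta> * s n) x \<and>
      greedy_arb n (W n) (C n) (l n * \<theta>2) (\<delta> * c / 2) x \<longrightarrow>
      (\<exists>A. spanning_arborescence n A \<and>
       (\<Sum>e\<in>A. C n e x) \<le> s n / l n * (secant h \<theta>1 \<theta>2 + \<delta>) \<and>
       (\<Sum>e\<in>A. W n e x) \<le> s n * (h \<theta>2 - \<theta>2 * secant h \<theta>2 \<theta>3 + \<delta>))"
      using l_pos s_ge unfolding greedy_arb_def concentrated_def
    proof (eventually_elim, intro allI impI, elim conjE exE)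
      fix n x A a b
      assume l: "0 < l n" and s: "c \<le> s n" "c * l n \<le> s n" and A: "spanning_arborescence n A"
        and T1: "\<bar>min_tot n (W n) (C n) (l n * \<theta>1) x - s n * h \<theta>1\<bar> \<le> \<eta> * s n"
        and T2: "\<bar>min_tot n (W n) (C n) (l n * \<theta>2) x - s n * h \<theta>2\<bar> \<le> \<eta> * s n"
        and T3: "\<bar>min_tot n (W n) (C n) (l n * \<theta>3) x - s n * h \<theta>3\<bar> \<le> \<eta> * s n"
        and Wa: "(\<Sum>e\<in>A. W n e x) \<le> a + \<delta> * c / 2" and Cb: "(\<Sum>e\<in>A. C n e x) \<le> b + \<delta> * c / 2"
        and ab: "a + l n * \<theta>2 * b = min_tot n (W n) (C n) (l n * \<theta>2) x"
        and env: "\<forall>l'. min_tot n (W n) (C n) l' x \<le> a + l' * b"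
      have sp: "0 < s n" using s c by linarith
      \<comment> \<open>\<open>B\<close> is the cost of the greedy mapping in units of
        \<open>s n / l n\<close>. The mapping is optimal at \<open>\<theta>2\<close> and merely
        competes at \<open>\<theta>1\<close> and \<open>\<theta>3\<close>: the first comparison
        bounds \<open>B\<close> above, the second below. The lower bound on the cost is what bounds
        the weight above.\<close>
      define B where "B = l n * b / s n"
      have lb: "l n * b = s n * B" using sp by (simp add: B_def)
      have e1: "s n * h \<theta>1 - \<eta> * s n \<le> a + \<theta>1 * (s n * B)"
        using env[rule_format, of "l n * \<theta>1"] T1 lb by (simp add: mult_ac)
      have e2: "a + \<theta>2 * (s n * B) \<le> s n * h \<theta>2 + \<eta> * s n" "s n * h \<theta>2 - \<eta> * s n \<le> a + \<theta>2 * (s n * B)"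
        using T2 ab lb by (simp_all add: mult_ac)
      have e3: "s n * h \<theta>3 - \<eta> * s n \<le> a + \<theta>3 * (s n * B)"
        using env[rule_format, of "l n * \<theta>3"] T3 lb by (simp add: mult_ac)
      have "s n * ((\<theta>2 - \<theta>1) * B) \<le> s n * (h \<theta>2 - h \<theta>1 + 2 * \<eta>)"
        using e1 e2 by (simp add: algebra_simps)
      then have "(\<theta>2 - \<theta>1) * B \<le> h \<theta>2 - h \<theta>1 + 2 * \<eta>" using sp by simp
      then have "B \<le> (h \<theta>2 - h \<theta>1 + 2 * \<eta>) / (\<theta>2 - \<theta>1)" using t by (simp add: field_simps)
      also have "\<dots> = secant h \<theta>1 \<theta>2 + 2 * \<eta> / (\<theta>2 - \<theta>1)" by (simp add: secant_def add_divide_distrib)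
      also have "\<dots> \<le> secant h \<theta>1 \<theta>2 + \<delta> / 2" using eta1 by simp
      finally have B1: "B \<le> secant h \<theta>1 \<theta>2 + \<delta> / 2" .
      have "s n * (h \<theta>3 - h \<theta>2 - 2 * \<eta>) \<le> s n * ((\<theta>3 - \<theta>2) * B)"
        using e3 e2 by (simp add: algebra_simps)
      then have "h \<theta>3 - h \<theta>2 - 2 * \<eta> \<le> (\<theta>3 - \<theta>2) * B" using sp by simp
      then have "(h \<theta>3 - h \<theta>2 - 2 * \<eta>) / (\<theta>3 - \<theta>2) \<le> B" using t by (simp add: field_simps)
      then have B2: "secant h \<theta>2 \<theta>3 - 2 * \<eta> / (\<theta>3 - \<theta>2) \<le> B" by (simp add: secant_def diff_divide_distrib)
      have "b = s n / l n * B" using l sp by (simp add: B_def)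
      also have "\<dots> \<le> s n / l n * (secant h \<theta>1 \<theta>2 + \<delta> / 2)"
        using B1 l sp by (intro mult_left_mono) auto
      finally have "b \<le> s n / l n * (secant h \<theta>1 \<theta>2 + \<delta> / 2)" .
      moreover have "\<delta> * c / 2 \<le> s n / l n * (\<delta> / 2)"
      proof -
        have "c \<le> s n / l n" using s(2) l by (simp add: field_simps)
        then have "c * (\<delta> / 2) \<le> s n / l n * (\<delta> / 2)" using d by (intro mult_right_mono) auto
        then show ?thesis by (simp add: mult.commute)
      qed
      moreover have "s n / l n * (secant h \<theta>1 \<theta>2 + \<delta> / 2) + s n / l n * (\<delta> / 2)
          = s n / l n * (secant h \<theta>1 \<theta>2 + \<delta>)"
        unfolding distrib_left[symmetric] by simp
      ultimately have Cfin: "(\<Sum>e\<in>A. C n e x) \<le> s n / l n * (secant h \<theta>1 \<theta>2 + \<delta>)"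
        using Cb by linarith
      have "\<theta>2 * (secant h \<theta>2 \<theta>3 - 2 * \<eta> / (\<theta>3 - \<theta>2)) \<le> \<theta>2 * B"
        using B2 t2 by (intro mult_left_mono) auto
      moreover have "\<theta>2 * (2 * \<eta> / (\<theta>3 - \<theta>2)) + \<eta> \<le> \<delta> / 2" using eta2 by (simp add: algebra_simps)
      ultimately have "h \<theta>2 + \<eta> - \<theta>2 * B \<le> h \<theta>2 - \<theta>2 * secant h \<theta>2 \<theta>3 + \<delta> / 2"
        unfolding right_diff_distrib by linarith
      then have "s n * (h \<theta>2 + \<eta> - \<theta>2 * B) \<le> s n * (h \<theta>2 - \<theta>2 * secant h \<theta>2 \<theta>3 + \<delta> / 2)"
        using sp by simp
      moreover have "a \<le> s n * (h \<theta>2 + \<eta> - \<theta>2 * B)" using e2(1) by (simp add: algebra_simps)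
      moreover have "\<delta> * c / 2 \<le> s n * (\<delta> / 2)"
        using mult_right_mono[OF s(1), of "\<delta> / 2"] d by (simp add: mult.commute)
      moreover have "s n * (h \<theta>2 - \<theta>2 * secant h \<theta>2 \<theta>3 + \<delta> / 2) + s n * (\<delta> / 2)
         = s n * (h \<theta>2 - \<theta>2 * secant h \<theta>2 \<theta>3 + \<delta>)"
        unfolding distrib_left[symmetric] by simp
      ultimately have "(\<Sum>e\<in>A. W n e x) \<le> s n * (h \<theta>2 - \<theta>2 * secant h \<theta>2 \<theta>3 + \<delta>)"
        using Wa by linarith
      with A Cfin show "\<exists>A. spanning_arborescence n A \<and>
       (\<Sum>e\<in>A. C n e x) \<le> s n / l n * (secant h \<theta>1 \<theta>2 + \<delta>) \<and>
       (\<Sum>e\<in>A. W n e x) \<le> s n * (h \<theta>2 - \<theta>2 * secant h \<theta>2 \<theta>3 + \<delta>)" by blast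
    qed
  qed
qed

end

context scaled_weights
begin

text \<open>Weak duality. If nothing is feasible, the optimum is infinite and the bound still
  holds.\<close>

lemma holds_whp_opt_lower:
  assumes t: "0 < \<theta>" and d: "0 < \<delta>"
  shows "holds_whp M (\<lambda>n x. ereal (s n * (h \<theta> - \<delta>) - l n * \<theta> * c0 n) \<le> W_arb_opt W C c0 n x)"
proof (rule holds_whp_mono[OF holds_whp_lower[OF t d]])
  show "\<forall>\<^sub>F n in sequentially. \<forall>x. (\<forall>A. spanning_arborescence n A \<longrightarrow>
     s n * (h \<theta> - \<delta>) \<le> (\<Sum>e\<in>A. W n e x) + l n * \<theta> * (\<Sum>e\<in>A. C n e x)) \<longrightarrow>
     ereal (s n * (h \<theta> - \<delta>) - l n * \<theta> * c0 n) \<le> W_arb_opt W C c0 n x"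
    using l_pos
  proof (eventually_elim, intro allI impI)
    fix n x
    assume l: "0 < l n" and *: "\<forall>A. spanning_arborescence n A \<longrightarrow>
      s n * (h \<theta> - \<delta>) \<le> (\<Sum>e\<in>A. W n e x) + l n * \<theta> * (\<Sum>e\<in>A. C n e x)"
    show "ereal (s n * (h \<theta> - \<delta>) - l n * \<theta> * c0 n) \<le> W_arb_opt W C c0 n x"
      unfolding W_arb_opt_def arb_opt_def
    proof (rule INF_greatest)
      fix A assume "A \<in> feasible_arbs n (\<lambda>e. C n e x) (c0 n)"
      then have A: "spanning_arborescence n A" "(\<Sum>e\<in>A. C n e x) \<le> c0 n" by (auto simp: feasible_arbs_def)
      have "l n * \<theta> * (\<Sum>e\<in>A. C n e x) \<le> l n * \<theta> * c0 n"
        using A(2) l t by (intro mult_left_mono) auto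
      then show "ereal (s n * (h \<theta> - \<delta>) - l n * \<theta> * c0 n) \<le> ereal (\<Sum>e\<in>A. W n e x)"
        using *[rule_format, OF A(1)] by simp
    qed
  qed
qed

lemma holds_whp_opt_upper:
  assumes t: "0 < \<theta>1" "\<theta>1 < \<theta>2" "\<theta>2 < \<theta>3" and d: "0 < \<delta>"
    and c0: "\<forall>\<^sub>F n in sequentially. s n / l n * (secant h \<theta>1 \<theta>2 + \<delta>) \<le> c0 n"
  shows "holds_whp M (\<lambda>n x. W_arb_opt W C c0 n x
     \<le> ereal (s n * (h \<theta>2 - \<theta>2 * secant h \<theta>2 \<theta>3 + \<delta>)))"
proof (rule holds_whp_mono[OF holds_whp_upper[OF t d]])
  show "\<forall>\<^sub>F n in sequentially. \<forall>x. (\<exists>A. spanning_arborescence n A \<and>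
     (\<Sum>e\<in>A. C n e x) \<le> s n / l n * (secant h \<theta>1 \<theta>2 + \<delta>) \<and>
     (\<Sum>e\<in>A. W n e x) \<le> s n * (h \<theta>2 - \<theta>2 * secant h \<theta>2 \<theta>3 + \<delta>)) \<longrightarrow>
     W_arb_opt W C c0 n x \<le> ereal (s n * (h \<theta>2 - \<theta>2 * secant h \<theta>2 \<theta>3 + \<delta>))"
    using c0
  proof (eventually_elim, intro allI impI, elim exE conjE)
    fix n x A
    assume c0: "s n / l n * (secant h \<theta>1 \<theta>2 + \<delta>) \<le> c0 n" and A: "spanning_arborescence n A"
      and CA: "(\<Sum>e\<in>A. C n e x) \<le> s n / l n * (secant h \<theta>1 \<theta>2 + \<delta>)"
      and WA: "(\<Sum>e\<in>A. W n e x) \<le> s n * (h \<theta>2 - \<theta>2 * secant h \<theta>2 \<theta>3 + \<delta>)"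
    have "A \<in> feasible_arbs n (\<lambda>e. C n e x) (c0 n)"
      using A CA c0 unfolding feasible_arbs_def by simp
    then show "W_arb_opt W C c0 n x \<le> ereal (s n * (h \<theta>2 - \<theta>2 * secant h \<theta>2 \<theta>3 + \<delta>))"
      unfolding W_arb_opt_def arb_opt_def by (rule INF_lower2) (use WA in simp)
  qed
qed

lemma W_arb_opt_measurable:
  "\<forall>\<^sub>F n in sequentially. W_arb_opt W C c0 n \<in> borel_measurable (M n)"
  using eventually_ge_at_top[of 1]
proof eventually_elim
  case (elim n)
  then interpret arc_weights n "M n" "W n" "C n" by (rule arc_weights)
  show ?case unfolding W_arb_opt_def[abs_def] by (rule arb_opt_measurable)
qed

text \<open>The budget is the one for which \<open>\<theta>\<close> is the critical multiplier. For
  the upper bound the multipliers move to \<open>\<theta> + x\<close>,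
  \<open>\<theta> + 2 * x\<close> and \<open>\<theta> + 3 * x\<close>: as \<open>h'\<close> strictly
  decreases, the first secant slope is below \<open>h' \<theta>\<close>, so the greedy cost fits the
  budget with room for an error. A small \<open>x\<close> hardly changes the value, by
  continuity.\<close>

theorem scaled_optimum:
  assumes deriv: "\<And>\<theta>. 0 < \<theta> \<Longrightarrow> (h has_real_derivative h' \<theta>) (at \<theta>)"
    and anti: "\<And>a b. 0 < a \<Longrightarrow> a < b \<Longrightarrow> h' b < h' a"
    and t: "0 < \<theta>" and cont: "isCont h' \<theta>"
    and c0: "\<forall>\<^sub>F n in sequentially. c0 n = s n / l n * h' \<theta>"
    and v: "0 < h \<theta> - \<theta> * h' \<theta>"
  shows "whp_approx M (W_arb_opt W C c0) (\<lambda>n. s n * (h \<theta> - \<theta> * h' \<theta>))"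
proof (rule whp_approxI[OF eventually_prob_space W_arb_opt_measurable])
  define v where "v = h \<theta> - \<theta> * h' \<theta>"
  have v0: "0 < v" using v by (simp add: v_def)
  have s_pos: "\<forall>\<^sub>F n in sequentially. 0 < s n"
    using s_ge(1) by eventually_elim (use c in linarith)
  then show "\<forall>\<^sub>F n in sequentially. 0 < s n * (h \<theta> - \<theta> * h' \<theta>)"
    by eventually_elim (use v in simp)
  fix \<delta> :: real assume d: "0 < \<delta>"
  \<comment> \<open>By the mean value theorem the second secant slope is at least
    \<open>h' (\<theta> + 3 * x)\<close>, so \<open>U x\<close> bounds the weight apart from the
    error \<open>\<epsilon>\<close>. At \<open>x = 0\<close> it is the value of the lower
    bound.\<close>
  define U where "U x = h (\<theta> + 2 * x) - (\<theta> + 2 * x) * h' (\<theta> + 3 * x)" for x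
  have "isCont U 0"
  proof -
    have "isCont h \<theta>" using deriv[OF t] by (rule DERIV_isCont)
    moreover have "isCont (\<lambda>x. \<theta> + k * x) 0" for k :: real by (intro continuous_intros)
    ultimately have *: "isCont (\<lambda>x. h (\<theta> + 2 * x)) 0" "isCont (\<lambda>x. h' (\<theta> + 3 * x)) 0"
      "isCont (\<lambda>x. \<theta> + 2 * x) 0"
      using cont isCont_o2[of 0 "\<lambda>x. \<theta> + 2 * x" h] isCont_o2[of 0 "\<lambda>x. \<theta> + 3 * x" h'] by simp_all
    show ?thesis unfolding U_def[abs_def] by (rule isCont_diff[OF *(1) isCont_mult[OF *(3,2)]])
  qed
  then have "(U \<longlongrightarrow> U 0) (at_right 0)"
    unfolding isCont_def by (rule tendsto_mono[rotated]) (simp add: at_le)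
  then have "\<forall>\<^sub>F x in at_right 0. U x < v + \<delta> * v / 2"
    by (rule order_tendstoD) (use d v0 in \<open>auto simp: U_def v_def\<close>)
  moreover have "\<forall>\<^sub>F x in at_right 0. (0::real) < x" by (rule eventually_at_right_less)
  ultimately have "\<forall>\<^sub>F x in at_right 0. (0::real) < x \<and> U x < v + \<delta> * v / 2" by eventually_elim simp
  then obtain x where x: "0 < x" "U x < v + \<delta> * v / 2"
    using eventually_happens'[of "at_right (0::real)"] by force
  define \<theta>1 \<theta>2 \<theta>3 where "\<theta>1 = \<theta> + x" and "\<theta>2 = \<theta> + 2 * x" and "\<theta>3 = \<theta> + 3 * x"
  have ts: "0 < \<theta>1" "\<theta> < \<theta>1" "\<theta>1 < \<theta>2" "\<theta>2 < \<theta>3" using t x by (auto simp: \<theta>1_def \<theta>2_def \<theta>3_def)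
  obtain z where z: "\<theta>1 < z" "z < \<theta>2" "h \<theta>2 - h \<theta>1 = (\<theta>2 - \<theta>1) * h' z"
    using MVT2[OF ts(3), of h h'] deriv ts by force
  obtain z' where z': "\<theta>2 < z'" "z' < \<theta>3" "h \<theta>3 - h \<theta>2 = (\<theta>3 - \<theta>2) * h' z'"
    using MVT2[OF ts(4), of h h'] deriv ts by force
  have slope: "secant h \<theta>1 \<theta>2 = h' z" "secant h \<theta>2 \<theta>3 = h' z'"
    using z z' ts by (simp_all add: secant_def)
  have hz: "h' z < h' \<theta>" using anti[OF t, of z] z ts by simp
  have hz': "h' \<theta>3 < h' z'" using anti[of z' \<theta>3] z' ts by simp
  define \<epsilon> where "\<epsilon> = min (h' \<theta> - h' z) (\<delta> * v / 2)"
  have eps: "0 < \<epsilon>" "h' z + \<epsilon> \<le> h' \<theta>" "\<epsilon> \<le> \<delta> * v / 2"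
    using hz d v0 min.cobounded1[of "h' \<theta> - h' z" "\<delta> * v / 2"] min.cobounded2[of "h' \<theta> - h' z" "\<delta> * v / 2"]
    unfolding \<epsilon>_def[symmetric] by (simp_all add: \<epsilon>_def)
  have "\<theta>2 * h' \<theta>3 \<le> \<theta>2 * h' z'" using hz' ts by (intro mult_left_mono) auto
  then have val: "h \<theta>2 - \<theta>2 * h' z' + \<epsilon> \<le> (1 + \<delta>) * v"
    using x(2) eps(3) unfolding U_def \<theta>2_def[symmetric] \<theta>3_def[symmetric] by (simp add: algebra_simps)
  have upper: "holds_whp M (\<lambda>n x. W_arb_opt W C c0 n x \<le> ereal (s n * (h \<theta>2 - \<theta>2 * h' z' + \<epsilon>)))"
  proof (rule holds_whp_opt_upper[OF ts(1,3,4) eps(1), unfolded slope])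
    show "\<forall>\<^sub>F n in sequentially. s n / l n * (h' z + \<epsilon>) \<le> c0 n"
      using c0 s_pos l_pos
    proof eventually_elim
      case (elim n)
      then have "s n / l n * (h' z + \<epsilon>) \<le> s n / l n * h' \<theta>"
        using eps(2) by (intro mult_left_mono) auto
      with elim show ?case by simp
    qed
  qed
  have dv: "0 < \<delta> * v" using d v0 by simp
  show "holds_whp M (\<lambda>n x. ereal ((1 - \<delta>) * (s n * (h \<theta> - \<theta> * h' \<theta>))) \<le> W_arb_opt W C c0 n x \<and>
          W_arb_opt W C c0 n x \<le> ereal ((1 + \<delta>) * (s n * (h \<theta> - \<theta> * h' \<theta>))))"
  proof (rule holds_whp_mono[OF holds_whp_both[OF holds_whp_opt_lower[OF t dv] upper]])
    show "\<forall>\<^sub>F n in sequentially. \<forall>x.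
       ereal (s n * (h \<theta> - \<delta> * v) - l n * \<theta> * c0 n) \<le> W_arb_opt W C c0 n x \<and>
       W_arb_opt W C c0 n x \<le> ereal (s n * (h \<theta>2 - \<theta>2 * h' z' + \<epsilon>)) \<longrightarrow>
       ereal ((1 - \<delta>) * (s n * (h \<theta> - \<theta> * h' \<theta>))) \<le> W_arb_opt W C c0 n x \<and>
       W_arb_opt W C c0 n x \<le> ereal ((1 + \<delta>) * (s n * (h \<theta> - \<theta> * h' \<theta>)))"
      using c0 s_pos l_pos
    proof (eventually_elim, intro allI impI, elim conjE)
      fix n x
      assume c0: "c0 n = s n / l n * h' \<theta>" and s: "0 < s n" and l: "0 < l n"
        and lo: "ereal (s n * (h \<theta> - \<delta> * v) - l n * \<theta> * c0 n) \<le> W_arb_opt W C c0 n x"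
        and up: "W_arb_opt W C c0 n x \<le> ereal (s n * (h \<theta>2 - \<theta>2 * h' z' + \<epsilon>))"
      have "l n * \<theta> * c0 n = s n * (\<theta> * h' \<theta>)" unfolding c0 using l by simp
      then have "s n * (h \<theta> - \<delta> * v) - l n * \<theta> * c0 n = s n * (h \<theta> - \<delta> * v) - s n * (\<theta> * h' \<theta>)"
        by (simp only:)
      also have "\<dots> = (1 - \<delta>) * (s n * (h \<theta> - \<theta> * h' \<theta>))"
        by (simp add: v_def algebra_simps)
      finally have "s n * (h \<theta> - \<delta> * v) - l n * \<theta> * c0 n = (1 - \<delta>) * (s n * (h \<theta> - \<theta> * h' \<theta>))" .
      moreover have "s n * (h \<theta>2 - \<theta>2 * h' z' + \<epsilon>) \<le> s n * ((1 + \<delta>) * v)"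
        using val s by (intro mult_left_mono) auto
      then have "ereal (s n * (h \<theta>2 - \<theta>2 * h' z' + \<epsilon>)) \<le> ereal ((1 + \<delta>) * (s n * (h \<theta> - \<theta> * h' \<theta>)))"
        by (simp add: v_def mult.left_commute)
      ultimately show "ereal ((1 - \<delta>) * (s n * (h \<theta> - \<theta> * h' \<theta>))) \<le> W_arb_opt W C c0 n x \<and>
       W_arb_opt W C c0 n x \<le> ereal ((1 + \<delta>) * (s n * (h \<theta> - \<theta> * h' \<theta>)))"
        using lo up by (metis order_trans)
    qed
  qed
qed

end

section \<open>The choice of scales in each regime\<close>

section \<open>The three regimes\<close>

context arc_weights_seq
begin

text \<open>The multiplier \<open>\<theta> / n\<close> has argument
  \<open>n * (\<theta> / n) = \<theta>\<close> in \<open>f_lim\<close>, so the limit is attained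
  exactly from \<open>n \<ge> \<theta>\<close> on.\<close>

lemma scaled_linear_budget: "scaled_weights M W C (\<lambda>n. 1 / real n) (\<lambda>n. 1) f_lim 1"
proof
  show "\<forall>\<^sub>F n in sequentially. 0 < 1 / real n"
    using eventually_gt_at_top[of 0] by eventually_elim simp
  show "\<forall>\<^sub>F n in sequentially. 1 * (1 / real n) \<le> 1"
    using eventually_gt_at_top[of 0] by eventually_elim simp
  fix \<theta> :: real assume t: "0 < \<theta>"
  have "\<forall>\<^sub>F n in sequentially. f_lim \<theta> = min_tot_lim n (1 / real n * \<theta>) / 1"
    using eventually_ge_at_top[of "max 1 (nat \<lceil>\<theta>\<rceil>)"]
  proof eventually_elim
    case (elim n)
    then have "\<theta> \<le> real n" "0 < n" by linarith+
    then show ?case by (simp add: min_tot_lim_def)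
  qed
  then show "(\<lambda>n. min_tot_lim n (1 / real n * \<theta>) / 1) \<longlonglongrightarrow> f_lim \<theta>"
    by (rule Lim_transform_eventually[OF tendsto_const])
qed simp_all

text \<open>The multiplier \<open>n * \<theta>\<close> eventually exceeds 1. Then the second branch
  of \<open>min_tot_lim\<close> equals \<open>n * \<theta> * f_lim (1 / \<theta>)\<close>, which is
  \<open>n * g_lim \<theta>\<close>.\<close>

lemma scaled_constant_budget: "scaled_weights M W C real real g_lim 1"
proof
  show "\<forall>\<^sub>F n in sequentially. 0 < real n"
    using eventually_gt_at_top[of 0] by eventually_elim simp
  show "\<forall>\<^sub>F n in sequentially. 1 \<le> real n"
    using eventually_ge_at_top[of 1] by eventually_elim simp
  fix \<theta> :: real assume t: "0 < \<theta>"
  have "\<forall>\<^sub>F n in sequentially. g_lim \<theta> = min_tot_lim n (real n * \<theta>) / real n"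
    using eventually_ge_at_top[of "max 1 (Suc (nat \<lceil>1 / \<theta>\<rceil>))"]
  proof eventually_elim
    case (elim n)
    then have n: "1 / \<theta> < real n" "0 < n" by linarith+
    then have "1 < real n * \<theta>" using t by (simp add: field_simps)
    then show ?case using n t by (simp add: min_tot_lim_def g_lim_eq)
  qed
  then show "(\<lambda>n. min_tot_lim n (real n * \<theta>) / real n) \<longlonglongrightarrow> g_lim \<theta>"
    by (rule Lim_transform_eventually[OF tendsto_const])
qed simp_all

lemma intermediate_budget:
  assumes w: "filterlim \<omega> at_top sequentially"
    and c0: "\<forall>\<^sub>F n in sequentially. c0 n \<in> {\<omega> n..real n / \<omega> n}"
  shows "whp_approx M (W_arb_opt W C c0) (\<lambda>n. pi * real n / (8 * c0 n))"
proof -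
  \<comment> \<open>For large \<open>x\<close>, \<open>f_lim x\<close> is about
    \<open>sqrt (pi / 2 * x)\<close>, so both branches of
    \<open>min_tot_lim n (l * \<theta>)\<close> are about
    \<open>sqrt (pi * n * l / 2) * sqrt \<theta>\<close>. The scales solve
    \<open>s\<^sup>2 = pi * n * l / 2\<close> and \<open>s / (2 * l) = c0\<close>, which puts the
    critical multiplier of \<open>h = sqrt\<close> at \<open>\<theta> = 1\<close>; the value is then
    \<open>s / 2\<close>.\<close>
  define l where "l n = pi * real n / (8 * (c0 n)\<^sup>2)" for n
  define s where "s n = pi * real n / (4 * c0 n)" for n
  have w1: "\<forall>\<^sub>F n in sequentially. 1 \<le> \<omega> n" using w by (simp add: filterlim_at_top)
  have bounds: "\<forall>\<^sub>F n in sequentially. 1 \<le> \<omega> n \<and> \<omega> n \<le> c0 n \<and> \<omega> n \<le> real n / c0 n \<and> 0 < real n"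
    using w1 c0 eventually_gt_at_top[of 0]
  proof eventually_elim
    case (elim n)
    then have "c0 n * \<omega> n \<le> real n" by (simp add: field_simps)
    then show ?case using elim by (auto simp: field_simps)
  qed
  \<comment> \<open>Up to the constant \<open>\<theta>\<close>, \<open>n * l\<close> and
    \<open>n / l\<close> are the arguments of \<open>f_lim\<close> in the two branches. They equal
    \<open>pi / 8 * (n / c0)\<^sup>2\<close> and \<open>8 / pi * c0\<^sup>2\<close>, so the upper
    end of the budget range makes the first grow and the lower end the second.\<close>
  have nl: "filterlim (\<lambda>n. real n * l n) at_top sequentially"
  proof (rule filterlim_at_top_mono)
    show "filterlim (\<lambda>n. pi / 8 * \<omega> n) at_top sequentially"
      by (rule filterlim_tendsto_pos_mult_at_top[OF tendsto_const _ w]) simp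
    show "\<forall>\<^sub>F n in sequentially. pi / 8 * \<omega> n \<le> real n * l n"
      using bounds
    proof eventually_elim
      case (elim n)
      have "1 \<le> real n / c0 n" using elim by linarith
      then have "\<omega> n * 1 \<le> (real n / c0 n) * (real n / c0 n)"
        by (intro mult_mono) (use elim in linarith)+
      then have "pi / 8 * \<omega> n \<le> pi / 8 * ((real n / c0 n) * (real n / c0 n))"
        by (intro mult_left_mono) simp_all
      also have "\<dots> = real n * l n" by (simp add: l_def power2_eq_square)
      finally show ?case .
    qed
  qed
  have nl': "filterlim (\<lambda>n. real n / l n) at_top sequentially"
  proof (rule filterlim_at_top_mono)
    show "filterlim (\<lambda>n. 8 / pi * \<omega> n) at_top sequentially"
      by (rule filterlim_tendsto_pos_mult_at_top[OF tendsto_const _ w]) simp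
    show "\<forall>\<^sub>F n in sequentially. 8 / pi * \<omega> n \<le> real n / l n"
      using bounds
    proof eventually_elim
      case (elim n)
      have "\<omega> n * 1 \<le> c0 n * c0 n" using elim by (intro mult_mono) auto
      then have "8 / pi * \<omega> n \<le> 8 / pi * (c0 n * c0 n)" by (intro mult_left_mono) auto
      also have "\<dots> = real n / l n" using elim by (simp add: l_def power2_eq_square)
      finally show ?case .
    qed
  qed
  interpret S: scaled_weights M W C l s sqrt "1 / 2"
  proof
    show "\<forall>\<^sub>F n in sequentially. 0 < l n"
      using bounds by eventually_elim (auto simp: l_def)
    show "\<forall>\<^sub>F n in sequentially. 1 / 2 \<le> s n"
      using bounds
    proof eventually_elim
      case (elim n)
      have "1 \<le> real n / c0 n" using elim by linarith
      then have "2 / 4 * 1 \<le> pi / 4 * (real n / c0 n)"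
        by (intro mult_mono) (use pi_ge_two in linarith)+
      then show ?case by (simp add: s_def)
    qed
    show "\<forall>\<^sub>F n in sequentially. 1 / 2 * l n \<le> s n"
      using bounds
    proof eventually_elim
      case (elim n)
      have "s n = 2 * c0 n * l n" using elim by (simp add: s_def l_def power2_eq_square)
      moreover have "1 / 2 * l n \<le> 2 * c0 n * l n" using elim by (intro mult_right_mono) (auto simp: l_def)
      ultimately show ?case by simp
    qed
    fix \<theta> :: real assume t: "0 < \<theta>"
    define z where "z n = (if l n * \<theta> \<le> 1 then real n * (l n * \<theta>) else real n / (l n * \<theta>))" for n
    have "filterlim (\<lambda>n. real n * l n * \<theta>) at_top sequentially"
      using filterlim_at_top_mult_tendsto_pos[OF tendsto_const t nl] .
    moreover have "filterlim (\<lambda>n. real n / l n * (1 / \<theta>)) at_top sequentially"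
      using filterlim_at_top_mult_tendsto_pos[OF tendsto_const _ nl', of "1 / \<theta>"] t by simp
    ultimately have "filterlim z at_top sequentially"
      unfolding filterlim_at_top
    proof (intro allI)
      fix Z
      assume "\<forall>Z. \<forall>\<^sub>F n in sequentially. Z \<le> real n * l n * \<theta>" "\<forall>Z. \<forall>\<^sub>F n in sequentially. Z \<le> real n / l n * (1 / \<theta>)"
      then have "\<forall>\<^sub>F n in sequentially. Z \<le> real n * l n * \<theta>" "\<forall>\<^sub>F n in sequentially. Z \<le> real n / l n * (1 / \<theta>)" by blast+
      then show "\<forall>\<^sub>F n in sequentially. Z \<le> z n"
        by eventually_elim (auto simp: z_def mult.assoc)
    qed
    with f_lim_asymp have "(\<lambda>n. f_lim (z n) / sqrt (z n)) \<longlonglongrightarrow> sqrt (pi / 2)" by (rule filterlim_compose)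
    then have "(\<lambda>n. f_lim (z n) / sqrt (z n) * (sqrt \<theta> / sqrt (pi / 2))) \<longlonglongrightarrow> sqrt (pi / 2) * (sqrt \<theta> / sqrt (pi / 2))"
      by (intro tendsto_intros)
    then have "(\<lambda>n. f_lim (z n) / sqrt (z n) * (sqrt \<theta> / sqrt (pi / 2))) \<longlonglongrightarrow> sqrt \<theta>" by simp
    moreover have "\<forall>\<^sub>F n in sequentially. f_lim (z n) / sqrt (z n) * (sqrt \<theta> / sqrt (pi / 2)) = min_tot_lim n (l n * \<theta>) / s n"
      using bounds
    proof eventually_elim
      case (elim n)
      have l: "0 < l n" using elim by (auto simp: l_def)
      define a b m p where "a = sqrt (l n)" and "b = sqrt \<theta>" and "m = sqrt n" and "p = sqrt (pi / 2)"
      have pos: "0 < a" "0 < b" "0 < m" "0 < p" using l t elim by (auto simp: a_def b_def m_def p_def)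
      have sq: "l n = a\<^sup>2" "\<theta> = b\<^sup>2" "real n = m\<^sup>2" using l t elim by (auto simp: a_def b_def m_def)
      have "s n = m * a * p"
      proof -
        have "(m * a * p)\<^sup>2 = (s n)\<^sup>2"
          using elim l by (simp add: m_def a_def p_def power_mult_distrib) (simp add: l_def s_def power2_eq_square)
        moreover have "0 \<le> s n" using elim by (auto simp: s_def)
        ultimately show ?thesis using pos by (simp add: power2_eq_iff_nonneg)
      qed
      then have s: "s n = m * a * p" .
      show ?case
      proof (cases "l n * \<theta> \<le> 1")
        case True
        have "sqrt (z n) = m * (a * b)"
          using True pos unfolding z_def sq by (simp add: real_sqrt_mult power2_eq_square real_sqrt_unique flip: power_mult_distrib)
        then show ?thesis using True pos by (simp add: min_tot_lim_def z_def s b_def[symmetric] p_def[symmetric])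
      next
        case False
        have "sqrt (z n) = m / (a * b)"
          using False pos unfolding z_def sq by (simp add: real_sqrt_divide real_sqrt_mult flip: power_mult_distrib)
        moreover have "min_tot_lim n (l n * \<theta>) = (a * b) * (a * b) * f_lim (z n)"
          using False by (simp add: min_tot_lim_def z_def sq power2_eq_square)
        ultimately show ?thesis using pos by (simp add: s b_def[symmetric] p_def[symmetric])
      qed
    qed
    ultimately show "(\<lambda>n. min_tot_lim n (l n * \<theta>) / s n) \<longlonglongrightarrow> sqrt \<theta>"
      by (rule Lim_transform_eventually)
  qed simp
  have "whp_approx M (W_arb_opt W C c0) (\<lambda>n. s n * (sqrt 1 - 1 * (1 / (2 * sqrt 1))))"
  proof (rule S.scaled_optimum[where h' = "\<lambda>\<theta>. 1 / (2 * sqrt \<theta>)"])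
    show "(sqrt has_real_derivative 1 / (2 * sqrt \<theta>)) (at \<theta>)" if "0 < \<theta>" for \<theta>
      by (rule DERIV_cong[OF DERIV_real_sqrt[OF that]]) (simp add: inverse_eq_divide)
    show "1 / (2 * sqrt b) < 1 / (2 * sqrt a)" if "0 < a" "a < b" for a b :: real
      using that by (intro divide_strict_left_mono) auto
    show "\<forall>\<^sub>F n in sequentially. c0 n = s n / l n * (1 / (2 * sqrt 1))"
      using bounds by eventually_elim (auto simp: s_def l_def power2_eq_square)
  qed (auto intro!: continuous_intros)
  then show ?thesis by (simp add: s_def)
qed

text \<open>The derivative of \<open>f_lim\<close> stays below 1/2, so no critical multiplier exists
  and the budget is slack. Both bounds use multipliers near 0, where \<open>f_lim\<close> is near
  1.\<close>

lemma large_linear_budget: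
  assumes a: "1 / 2 < \<alpha>"
  shows "whp_approx M (W_arb_opt W C (\<lambda>n. \<alpha> * real n)) (\<lambda>n. 1)"
proof -
  interpret S: scaled_weights M W C "\<lambda>n. 1 / real n" "\<lambda>n. 1" f_lim 1
    by (rule scaled_linear_budget)
  show ?thesis
  proof (rule whp_approxI[OF eventually_prob_space S.W_arb_opt_measurable])
    fix \<delta> :: real assume d: "0 < \<delta>"
    \<comment> \<open>Weak duality loses \<open>\<theta> * \<alpha> = \<delta> / 2\<close> and the
      estimate another \<open>\<delta> / 2\<close>, from
      \<open>f_lim \<theta> \<ge> 1\<close>.\<close>
    define \<theta> where "\<theta> = \<delta> / (2 * \<alpha>)"
    have t: "0 < \<theta>" "\<theta> * \<alpha> = \<delta> / 2" using a d by (auto simp: \<theta>_def)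
    define x where "x = \<delta> / 4"
    have x: "0 < x" "x < 2 * x" "2 * x < 3 * x" using d by (auto simp: x_def)
    define \<epsilon> where "\<epsilon> = min (\<alpha> - 1 / 2) (\<delta> / 2)"
    have eps: "0 < \<epsilon>" "1 / 2 + \<epsilon> \<le> \<alpha>" "\<epsilon> \<le> \<delta> / 2"
      using a d min.cobounded1[of "\<alpha> - 1 / 2" "\<delta> / 2"] min.cobounded2[of "\<alpha> - 1 / 2" "\<delta> / 2"]
      by (simp_all add: \<epsilon>_def)
    obtain z where z: "x < z" "z < 2 * x" "f_lim (2 * x) - f_lim x = (2 * x - x) * f_lim' z"
      using MVT2[OF x(2), of f_lim f_lim'] f_lim_deriv x by force
    have slope: "secant f_lim x (2 * x) \<le> 1 / 2"
      using z x f_lim'_less[of z] by (simp add: secant_def)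
    have "0 \<le> 2 * x * secant f_lim (2 * x) (3 * x)"
      using x f_lim_mono[of "2 * x" "3 * x"] by (simp add: secant_def)
    moreover have "f_lim (2 * x) \<le> 1 + \<delta> / 2" using f_lim_le[of "2 * x"] x by (simp add: x_def)
    ultimately have val: "f_lim (2 * x) - 2 * x * secant f_lim (2 * x) (3 * x) + \<epsilon> \<le> 1 + \<delta>"
      using eps by linarith
    have upper: "holds_whp M (\<lambda>n y. W_arb_opt W C (\<lambda>n. \<alpha> * real n) n y
       \<le> ereal (1 * (f_lim (2 * x) - 2 * x * secant f_lim (2 * x) (3 * x) + \<epsilon>)))"
    proof (rule S.holds_whp_opt_upper[OF x eps(1)])
      show "\<forall>\<^sub>F n in sequentially. 1 / (1 / real n) * (secant f_lim x (2 * x) + \<epsilon>) \<le> \<alpha> * real n"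
      proof (intro always_eventually allI)
        fix n :: nat
        have "real n * (secant f_lim x (2 * x) + \<epsilon>) \<le> real n * \<alpha>"
          using slope eps(2) by (intro mult_left_mono) linarith+
        then show "1 / (1 / real n) * (secant f_lim x (2 * x) + \<epsilon>) \<le> \<alpha> * real n"
          by (simp add: mult.commute)
      qed
    qed
    show "holds_whp M (\<lambda>n y. ereal ((1 - \<delta>) * 1) \<le> W_arb_opt W C (\<lambda>n. \<alpha> * real n) n y \<and>
        W_arb_opt W C (\<lambda>n. \<alpha> * real n) n y \<le> ereal ((1 + \<delta>) * 1))"
    proof (rule holds_whp_mono[OF holds_whp_both[OF S.holds_whp_opt_lower[OF t(1) half_gt_zero[OF d], of "\<lambda>n. \<alpha> * real n"] upper]])
      show "\<forall>\<^sub>F n in sequentially. \<forall>y.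
        ereal (1 * (f_lim \<theta> - \<delta> / 2) - 1 / real n * \<theta> * (\<alpha> * real n)) \<le> W_arb_opt W C (\<lambda>n. \<alpha> * real n) n y \<and>
        W_arb_opt W C (\<lambda>n. \<alpha> * real n) n y
          \<le> ereal (1 * (f_lim (2 * x) - 2 * x * secant f_lim (2 * x) (3 * x) + \<epsilon>)) \<longrightarrow>
        ereal ((1 - \<delta>) * 1) \<le> W_arb_opt W C (\<lambda>n. \<alpha> * real n) n y \<and>
        W_arb_opt W C (\<lambda>n. \<alpha> * real n) n y \<le> ereal ((1 + \<delta>) * 1)"
        using eventually_gt_at_top[of 0]
      proof (eventually_elim, intro allI impI, elim conjE)
        fix n :: nat and y
        assume n: "0 < n"
          and lo: "ereal (1 * (f_lim \<theta> - \<delta> / 2) - 1 / real n * \<theta> * (\<alpha> * real n)) \<le> W_arb_opt W C (\<lambda>n. \<alpha> * real n) n y"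
          and up: "W_arb_opt W C (\<lambda>n. \<alpha> * real n) n y
          \<le> ereal (1 * (f_lim (2 * x) - 2 * x * secant f_lim (2 * x) (3 * x) + \<epsilon>))"
        have "1 / real n * \<theta> * (\<alpha> * real n) = \<delta> / 2" using n t(2) by simp
        then have "ereal ((1 - \<delta>) * 1) \<le> ereal (1 * (f_lim \<theta> - \<delta> / 2) - 1 / real n * \<theta> * (\<alpha> * real n))"
          using f_lim_ge_1[of \<theta>] t(1) by simp
        then have "ereal ((1 - \<delta>) * 1) \<le> W_arb_opt W C (\<lambda>n. \<alpha> * real n) n y"
          using lo by (rule order_trans)
        moreover have "ereal (1 * (f_lim (2 * x) - 2 * x * secant f_lim (2 * x) (3 * x) + \<epsilon>))
            \<le> ereal ((1 + \<delta>) * 1)"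
          using val by simp
        with up have "W_arb_opt W C (\<lambda>n. \<alpha> * real n) n y \<le> ereal ((1 + \<delta>) * 1)"
          by (rule order_trans)
        ultimately show "ereal ((1 - \<delta>) * 1) \<le> W_arb_opt W C (\<lambda>n. \<alpha> * real n) n y \<and>
          W_arb_opt W C (\<lambda>n. \<alpha> * real n) n y \<le> ereal ((1 + \<delta>) * 1)" by blast
      qed
    qed
  qed simp
qed

lemma linear_budget:
  assumes b: "0 < \<beta>"
  shows "whp_approx M (W_arb_opt W C (\<lambda>n. f_lim' \<beta> * real n)) (\<lambda>n. f_lim \<beta> - f_lim' \<beta> * \<beta>)"
proof -
  interpret S: scaled_weights M W C "\<lambda>n. 1 / real n" "\<lambda>n. 1" f_lim 1
    by (rule scaled_linear_budget)
  have "whp_approx M (W_arb_opt W C (\<lambda>n. f_lim' \<beta> * real n)) (\<lambda>n. 1 * (f_lim \<beta> - \<beta> * f_lim' \<beta>))"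
  proof (rule S.scaled_optimum[where h' = f_lim'])
    \<comment> \<open>This product is half the first summand of \<open>f_lim \<beta>\<close>, so the
      limit value is positive.\<close>
    have "\<beta> * f_lim' \<beta> = \<beta> / sqrt \<beta> * gauss (sqrt \<beta>) / 2" by (simp add: f_lim'_def)
    also have "\<beta> / sqrt \<beta> = sqrt \<beta>" using b by (simp add: real_div_sqrt)
    finally have "\<beta> * f_lim' \<beta> = sqrt \<beta> * gauss (sqrt \<beta>) / 2" .
    moreover have "0 < sqrt \<beta> * gauss (sqrt \<beta>)" using b by (simp add: gauss_pos)
    ultimately show "0 < f_lim \<beta> - \<beta> * f_lim' \<beta>"
      unfolding f_lim_gauss using exp_gt_zero[of "- \<beta> / 2"] by linarith
  qed (use b f_lim_deriv f_lim'_strict_antimono f_lim'_cont in auto)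
  then show ?thesis by (simp add: mult.commute)
qed

lemma constant_budget:
  assumes b: "0 < \<beta>"
  shows "whp_approx M (W_arb_opt W C (\<lambda>n. g_lim' \<beta>)) (\<lambda>n. (g_lim \<beta> - g_lim' \<beta> * \<beta>) * real n)"
proof -
  interpret S: scaled_weights M W C real real g_lim 1
    by (rule scaled_constant_budget)
  have "whp_approx M (W_arb_opt W C (\<lambda>n. g_lim' \<beta>)) (\<lambda>n. real n * (g_lim \<beta> - \<beta> * g_lim' \<beta>))"
  proof (rule S.scaled_optimum[where h' = g_lim'])
    show "\<forall>\<^sub>F n in sequentially. g_lim' \<beta> = real n / real n * g_lim' \<beta>"
      using eventually_gt_at_top[of 0] by eventually_elim simp
    \<comment> \<open>This product is the second summand of \<open>g_lim \<beta>\<close> plus half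
      the first, so a positive half remains.\<close>
    have "\<beta> * g_lim' \<beta> = \<beta> / sqrt \<beta> * gauss (1 / sqrt \<beta>) / 2 + \<beta> * exp (- 1 / (2 * \<beta>))"
      by (simp add: g_lim'_def distrib_left)
    also have "\<beta> / sqrt \<beta> = sqrt \<beta>" using b by (simp add: real_div_sqrt)
    finally have "\<beta> * g_lim' \<beta> = sqrt \<beta> * gauss (1 / sqrt \<beta>) / 2 + \<beta> * exp (- 1 / (2 * \<beta>))" .
    moreover have "0 < sqrt \<beta> * gauss (1 / sqrt \<beta>)" using b by (simp add: gauss_pos)
    ultimately show "0 < g_lim \<beta> - \<beta> * g_lim' \<beta>"
      unfolding g_lim_gauss by linarith
  qed (use b g_lim_deriv g_lim'_strict_antimono g_lim'_cont in auto)
  then show ?thesis by (simp add: mult.commute)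
qed

text \<open>Under a large multiplier \<open>n * \<theta>\<close> the costs dominate: the relaxed
  optimum is close to \<open>n * g_lim \<theta> \<ge> n * \<theta>\<close>, which leaves no room for
  a total cost below 1 by a fixed amount.\<close>

lemma small_constant_budget:
  assumes a: "0 < \<alpha>" "\<alpha> < 1"
  shows "whp M (\<lambda>n x. feasible_arbs n (\<lambda>e. C n e x) \<alpha> = {})"
proof (rule whpI[OF eventually_prob_space])
  interpret S: scaled_weights M W C real real g_lim 1
    by (rule scaled_constant_budget)
  \<comment> \<open>The losses amount to at most \<open>3 * n\<close>: one \<open>n\<close> each for
    the weights, the root and the fluctuation. Feasibility would thus give
    \<open>\<theta> * (1 - \<alpha>) \<le> 3\<close>; any constant above 3 serves in place of
    8.\<close>
  define \<theta> where "\<theta> = 8 / (1 - \<alpha>)"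
  have t: "0 < \<theta>" "4 / \<theta> = (1 - \<alpha>) / 2" using a by (auto simp: \<theta>_def)
  have g: "\<theta> \<le> g_lim \<theta>" using t f_lim_ge_1[of "1 / \<theta>"] by (simp add: g_lim_eq)
  show "holds_whp M (\<lambda>n x. feasible_arbs n (\<lambda>e. C n e x) \<alpha> = {})"
  proof (rule holds_whp_mono[OF holds_whp_both[OF holds_whp_range S.holds_whp_scaled[OF t(1) zero_less_one]]])
    show "\<forall>\<^sub>F n in sequentially. \<forall>x.
      (\<forall>e\<in>complete_arcs n. 0 \<le> W n e x \<and> W n e x \<le> 1 \<and> 0 \<le> C n e x \<and> C n e x \<le> 1) \<and>
      concentrated n (W n) (C n) (real n * \<theta>) (real n * g_lim \<theta>) (1 * real n) x \<longrightarrow>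
      feasible_arbs n (\<lambda>e. C n e x) \<alpha> = {}"
      using eventually_ge_at_top[of 2]
    proof (eventually_elim, intro allI impI, elim conjE)
      fix n :: nat and x
      let ?l = "real n * \<theta>"
      assume n: "2 \<le> n"
        and range: "\<forall>e\<in>complete_arcs n. 0 \<le> W n e x \<and> W n e x \<le> 1 \<and> 0 \<le> C n e x \<and> C n e x \<le> 1"
        and "concentrated n (W n) (C n) ?l (real n * g_lim \<theta>) (1 * real n) x"
      then have tot: "\<bar>min_tot n (W n) (C n) ?l x - real n * g_lim \<theta>\<bar> \<le> 1 * real n"
        and mx: "\<forall>v\<in>{1..n}. min_in n (W n) (C n) ?l v x \<le> 1 * real n"
        unfolding concentrated_def by blast+
      have l: "0 < ?l" using n t by simp
      show "feasible_arbs n (\<lambda>e. C n e x) \<alpha> = {}"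
      proof (rule ccontr)
        assume "feasible_arbs n (\<lambda>e. C n e x) \<alpha> \<noteq> {}"
        then obtain A where A: "spanning_arborescence n A" "(\<Sum>e\<in>A. C n e x) \<le> \<alpha>"
          by (auto simp: feasible_arbs_def)
        \<comment> \<open>Zero weights isolate the costs. Restoring the true weights raises each
          minimum by at most 1, hence the sum over the vertices other than the root by at most
          \<open>n\<close>.\<close>
        let ?Z = "\<lambda>e x. 0 :: real"
        have le: "min_in n (W n) (C n) ?l v x \<le> 1 + min_in n ?Z (C n) ?l v x" if v: "v \<in> {1..n}" for v
        proof -
          let ?u = "pick n ?Z (C n) ?l v x"
          have u: "?u \<in> others n v" "0 + ?l * C n (?u, v) x = min_in n ?Z (C n) ?l v x"
            using pick_properties[OF n, where W = ?Z and C = "C n" and l = ?l and v = v and \<omega> = x] by auto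
          have "min_in n (W n) (C n) ?l v x \<le> W n (?u, v) x + ?l * C n (?u, v) x"
            using u(1) by (rule min_in_le)
          moreover have "W n (?u, v) x \<le> 1" using range others_arc[OF v u(1)] by blast
          ultimately show ?thesis using u(2) by linarith
        qed
        obtain r where r: "r \<in> {1..n}" "min_tot n ?Z (C n) ?l x - min_in n ?Z (C n) ?l r x
            \<le> (\<Sum>e\<in>A. ?Z e x) + ?l * (\<Sum>e\<in>A. C n e x)"
          using arborescence_ge_min_in[OF A(1), of ?l ?Z x "C n"] range l by auto
        have "min_tot n (W n) (C n) ?l x - min_in n (W n) (C n) ?l r x = (\<Sum>v\<in>{1..n} - {r}. min_in n (W n) (C n) ?l v x)"
          using r(1) by (simp add: min_tot_def sum_diff1)
        also have "\<dots> \<le> (\<Sum>v\<in>{1..n} - {r}. 1 + min_in n ?Z (C n) ?l v x)"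
          by (intro sum_mono le) auto
        also have "\<dots> = real (card ({1..n} - {r})) + (\<Sum>v\<in>{1..n} - {r}. min_in n ?Z (C n) ?l v x)"
          by (simp add: sum.distrib)
        also have "(\<Sum>v\<in>{1..n} - {r}. min_in n ?Z (C n) ?l v x) = min_tot n ?Z (C n) ?l x - min_in n ?Z (C n) ?l r x"
          using r(1) by (simp add: min_tot_def sum_diff1)
        also have "\<dots> \<le> ?l * \<alpha>"
        proof -
          have "?l * (\<Sum>e\<in>A. C n e x) \<le> ?l * \<alpha>" using A(2) l by (intro mult_left_mono) auto
          then show ?thesis using r(2) by simp
        qed
        also have "real (card ({1..n} - {r})) \<le> real n" using r(1) by simp
        finally have "min_tot n (W n) (C n) ?l x - min_in n (W n) (C n) ?l r x \<le> real n + ?l * \<alpha>" by simp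
        moreover have "min_in n (W n) (C n) ?l r x \<le> real n" using mx r(1) by simp
        moreover have "real n * \<theta> \<le> real n * g_lim \<theta>" using g by (intro mult_left_mono) auto
        ultimately have "real n * \<theta> \<le> real n * (3 + \<theta> * \<alpha>)" using tot by (simp add: algebra_simps)
        then have "\<theta> \<le> 3 + \<theta> * \<alpha>" using n by simp
        then have "\<theta> * (1 - \<alpha>) \<le> 3" by (simp add: algebra_simps)
        moreover have "\<theta> * (1 - \<alpha>) = 8"
          using a nonzero_eq_divide_eq[of "1 - \<alpha>" \<theta> 8] \<theta>_def by linarith
        ultimately show False by simp
      qed
    qed
  qed
  show "\<forall>\<^sub>F n in sequentially. {x\<in>space (M n). feasible_arbs n (\<lambda>e. C n e x) \<alpha> = {}} \<in> sets (M n)"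
    using eventually_ge_at_top[of 1]
  proof eventually_elim
    case (elim n)
    then interpret arc_weights n "M n" "W n" "C n" by (rule arc_weights)
    show ?case by (rule infeasible_measurable)
  qed
qed

end

theorem theorem1:
  fixes M :: "nat \<Rightarrow> 'a measure"
    and W C :: "nat \<Rightarrow> nat \<times> nat \<Rightarrow> 'a \<Rightarrow> real"
  assumes iid: "\<And>n. n \<ge> 1 \<Longrightarrow> iid_uniform_weights_costs n (M n) (W n) (C n)"
  shows
    "(\<comment> \<open>Case 1\<close>
      \<forall>(\<omega> :: nat \<Rightarrow> real) (c0 :: nat \<Rightarrow> real).
        filterlim \<omega> at_top sequentially \<longrightarrow>
        (\<forall>\<^sub>F n in sequentially. c0 n \<in> {\<omega> n..real n / \<omega> n}) \<longrightarrow>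
        whp_approx M (W_arb_opt W C c0) (\<lambda>n. pi * real n / (8 * c0 n))) \<and>
     (\<comment> \<open>Case 2 (i)\<close>
      \<forall>\<alpha>::real. \<alpha> > 1/2 \<longrightarrow>
        whp_approx M (W_arb_opt W C (\<lambda>n. \<alpha> * real n)) (\<lambda>n. 1)) \<and>
     (\<comment> \<open>Case 2 (ii)\<close>
      \<forall>\<alpha>::real. 0 < \<alpha> \<and> \<alpha> < 1/2 \<longrightarrow>
        (\<exists>\<beta>>0. (f_lim has_real_derivative \<alpha>) (at \<beta>) \<and>
           (\<forall>b>0. (f_lim has_real_derivative \<alpha>) (at b) \<longrightarrow> b = \<beta>) \<and>
           whp_approx M (W_arb_opt W C (\<lambda>n. \<alpha> * real n)) (\<lambda>n. f_lim \<beta> - \<alpha> * \<beta>))) \<and>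
     (\<comment> \<open>Case 3 (i)\<close>
      \<forall>\<alpha>::real. 0 < \<alpha> \<and> \<alpha> < 1 \<longrightarrow>
        whp M (\<lambda>n x. feasible_arbs n (\<lambda>e. C n e x) \<alpha> = {})) \<and>
     (\<comment> \<open>Case 3 (ii)\<close>
      \<forall>\<alpha>::real. \<alpha> > 1 \<longrightarrow>
        (\<exists>\<beta>>0. (g_lim has_real_derivative \<alpha>) (at \<beta>) \<and>
           (\<forall>b>0. (g_lim has_real_derivative \<alpha>) (at b) \<longrightarrow> b = \<beta>) \<and>
           whp_approx M (W_arb_opt W C (\<lambda>n. \<alpha>)) (\<lambda>n. (g_lim \<beta> - \<alpha> * \<beta>) * real n)))"
proof -
  interpret arc_weights_seq M W C
    using iid by unfold_locales
  have f: "\<exists>\<beta>>0. (f_lim has_real_derivative \<alpha>) (at \<beta>) \<and>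
           (\<forall>b>0. (f_lim has_real_derivative \<alpha>) (at b) \<longrightarrow> b = \<beta>) \<and>
           whp_approx M (W_arb_opt W C (\<lambda>n. \<alpha> * real n)) (\<lambda>n. f_lim \<beta> - \<alpha> * \<beta>)"
    if a: "0 < \<alpha>" "\<alpha> < 1 / 2" for \<alpha>
  proof -
    obtain \<beta> where b: "0 < \<beta>" "f_lim' \<beta> = \<alpha>" using f_lim'_solution[OF a] by blast
    \<comment> \<open>Strict concavity: a strictly decreasing derivative takes the value
      \<open>\<alpha>\<close> only once.\<close>
    have "b = \<beta>" if "0 < b" "(f_lim has_real_derivative \<alpha>) (at b)" for b
    proof (rule ccontr)
      assume "b \<noteq> \<beta>"
      have "f_lim' b = f_lim' \<beta>" using DERIV_unique[OF f_lim_deriv[OF that(1)] that(2)] b(2) by simp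
      then show False
        using f_lim'_strict_antimono[of b \<beta>] f_lim'_strict_antimono[of \<beta> b] b(1) that(1) \<open>b \<noteq> \<beta>\<close> by linarith
    qed
    then show ?thesis using f_lim_deriv[OF b(1)] linear_budget[OF b(1)] b by blast
  qed
  have g: "\<exists>\<beta>>0. (g_lim has_real_derivative \<alpha>) (at \<beta>) \<and>
           (\<forall>b>0. (g_lim has_real_derivative \<alpha>) (at b) \<longrightarrow> b = \<beta>) \<and>
           whp_approx M (W_arb_opt W C (\<lambda>n. \<alpha>)) (\<lambda>n. (g_lim \<beta> - \<alpha> * \<beta>) * real n)"
    if a: "1 < \<alpha>" for \<alpha>
  proof -
    obtain \<beta> where b: "0 < \<beta>" "g_lim' \<beta> = \<alpha>" using g_lim'_solution[OF a] by blast
    have "b = \<beta>" if "0 < b" "(g_lim has_real_derivative \<alpha>) (at b)" for b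
    proof (rule ccontr)
      assume "b \<noteq> \<beta>"
      have "g_lim' b = g_lim' \<beta>" using DERIV_unique[OF g_lim_deriv[OF that(1)] that(2)] b(2) by simp
      then show False
        using g_lim'_strict_antimono[of b \<beta>] g_lim'_strict_antimono[of \<beta> b] b(1) that(1) \<open>b \<noteq> \<beta>\<close> by linarith
    qed
    then show ?thesis using g_lim_deriv[OF b(1)] constant_budget[OF b(1)] b by blast
  qed
  show ?thesis
    by (intro conjI allI impI intermediate_budget large_linear_budget f small_constant_budget g) auto
qed

end
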